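(* Let $\eta>0$, let $H$ be a selfadjoint operator in a closed subspace $\mathcal{H}\subset L^2(\mathbb{R}^d)$ with $H\ge\eta(-\Delta)$, and let $V\in L^\infty(\mathbb{R}^d)$, $V\ge0$, be $(R,\varrho)$-thick for some $R,\varrho>0$. Let $\alpha\in(0,1)$. Then there exist $T_0,K>0$ such that for all $T\ge T_0$ and all $r\in[1,\infty]$ the linear control problem $$\dot f(t)+Hf(t)=Vu(t),\quad t\in(0,T],\qquad f(0)=f_0\in\mathcal{H},$$ is cost-uniformly $\alpha$-controllable in time $T$ with respect to $L^r((0,T);\mathcal{H})$ and cost $K$.
   Context: The function $V\ge0$ is $(R,\varrho)$-thick if $\frac{1}{R^d}\int_{C_R(y)}V(x)\,\mathrm{d}x\ge\varrho$ for all $y\in\mathbb{R}^d$, where $C_R(y)=y+(0,R)^d$. $H\ge\eta(-\Delta)$ is meant in the sense of (not necessarily densely defined) quadratic forms: the form domain $\mathrm{dom}(H^{1/2})$ of $H$ is contained in $W^{1,2}(\mathbb{R}^d)$ and $\|H^{1/2}u\|^2\ge\eta\int_{\mathbb{R}^d}|\nabla u|^2\,\mathrm{d}x$ for all $u\in\mathrm{dom}(H^{1/2})$ (in particular $H\ge0$). The control operator $V$ is multiplication by the function $V$, regarded as an operator in $\mathcal{H}$ (if $\mathcal{H}$ is not invariant under multiplication by $V$, it is understood as $g\mapsto P_{\mathcal{H}}(Vg)$ with $P_{\mathcal{H}}$ the orthogonal projection of $L^2(\mathbb{R}^d)$ onto $\mathcal{H}$). For a control function $u\in L^r((0,T);\mathcal{H})$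 the solution of the control problem is given by Duhamel's formula $f(t)=e^{-tH}f_0+\int_0^te^{-(t-s)H}Vu(s)\,\mathrm{d}s$, $t\in[0,T]$. Given $\alpha,K\ge0$, $T>0$, $r\in[1,\infty]$, the control problem is called cost-uniformly $\alpha$-controllable in time $T$ with respect to $L^r((0,T);\mathcal{H})$ and cost $K$ if for every $f_0\in\mathcal{H}$ there is a control function $u\in L^r((0,T);\mathcal{H})$ such that $\|f(T)\|\le\alpha\|f_0\|$ and $\|u\|_{L^r((0,T);\mathcal{H})}\le K\|f_0\|$. *)

theory Defs
  imports "HOL-Analysis.Analysis"
begin

section \<open>The complex Hilbert space of square-integrable functions\<close>

definition square_integrable :: "('a::euclidean_space \<Rightarrow> complex) \<Rightarrow> bool"
  where "square_integrable f \<longleftrightarrow>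
    f \<in> borel_measurable lebesgue \<and> integrable lebesgue (\<lambda>x. (cmod (f x))\<^sup>2)"

definition L2_rel :: "('a::euclidean_space \<Rightarrow> complex) \<Rightarrow> ('a \<Rightarrow> complex) \<Rightarrow> bool"
  where "L2_rel f g \<longleftrightarrow>
    square_integrable f \<and> square_integrable g \<and> (AE x in lebesgue. f x = g x)"

lemma square_integrable_zero [simp]: "square_integrable (\<lambda>x. 0)"
  by (simp add: square_integrable_def)

lemma square_integrable_scale:
  assumes "square_integrable f" shows "square_integrable (\<lambda>x. c * f x)"
  using assms unfolding square_integrable_def norm_mult power_mult_distrib by auto

lemma square_integrable_dominated:
  assumes "g \<in> borel_measurable lebesgue" "integrable lebesgue h"
    and "AE x in lebesgue. (cmod (g x))\<^sup>2 \<le> h x"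
  shows "square_integrable g"
  unfolding square_integrable_def
proof
  show "integrable lebesgue (\<lambda>x. (cmod (g x))\<^sup>2)"
    by (rule Bochner_Integration.integrable_bound[OF assms(2)]) (use assms in auto)
qed (use assms in auto)

lemma cmod_add_square_le: "(cmod (a + b))\<^sup>2 \<le> 2 * (cmod a)\<^sup>2 + 2 * (cmod b)\<^sup>2"
proof -
  have "(cmod (a + b))\<^sup>2 \<le> (cmod a + cmod b)\<^sup>2"
    by (intro power_mono norm_triangle_ineq) auto
  also have "\<dots> \<le> 2 * (cmod a)\<^sup>2 + 2 * (cmod b)\<^sup>2"
    using sum_squares_bound[of "cmod a" "cmod b"] by (simp add: power2_sum)
  finally show ?thesis .
qed

lemma square_integrable_add:
  assumes "square_integrable f" "square_integrable g"
  shows "square_integrable (\<lambda>x. f x + g x)"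
  by (rule square_integrable_dominated[where h = "\<lambda>x. 2 * (cmod (f x))\<^sup>2 + 2 * (cmod (g x))\<^sup>2"])
     (use assms cmod_add_square_le in \<open>auto simp: square_integrable_def\<close>)

lemma square_integrable_minus:
  assumes "square_integrable f" shows "square_integrable (\<lambda>x. - f x)"
  using square_integrable_scale[OF assms, of "-1"] by simp

lemma square_integrable_diff:
  assumes "square_integrable f" "square_integrable g"
  shows "square_integrable (\<lambda>x. f x - g x)"
  using square_integrable_add[OF assms(1) square_integrable_minus[OF assms(2)]] by simp

lemma integrable_cnj_mult:
  assumes "square_integrable f" "square_integrable g"
  shows "integrable lebesgue (\<lambda>x. cnj (f x) * g x)"
proof (rule Bochner_Integration.integrable_bound)
  show "integrable lebesgue (\<lambda>x. (cmod (f x))\<^sup>2 + (cmod (g x))\<^sup>2)"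
    using assms by (auto simp: square_integrable_def)
  have "(\<lambda>x. cnj (f x)) \<in> borel_measurable lebesgue"
    using assms by (intro borel_measurable_continuous_on[where f = cnj])
      (auto simp: square_integrable_def intro: continuous_intros)
  then show "(\<lambda>x. cnj (f x) * g x) \<in> borel_measurable lebesgue"
    using assms by (auto simp: square_integrable_def)
  show "AE x in lebesgue. norm (cnj (f x) * g x) \<le> norm ((cmod (f x))\<^sup>2 + (cmod (g x))\<^sup>2)"
  proof (intro AE_I2)
    fix x
    have "cmod (f x) * cmod (g x) \<le> 2 * cmod (f x) * cmod (g x)" by simp
    also have "\<dots> \<le> (cmod (f x))\<^sup>2 + (cmod (g x))\<^sup>2" by (rule sum_squares_bound)
    finally show "norm (cnj (f x) * g x) \<le> norm ((cmod (f x))\<^sup>2 + (cmod (g x))\<^sup>2)"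
      by (simp add: norm_mult)
  qed
qed

quotient_type (overloaded) 'a L2 = "'a::euclidean_space \<Rightarrow> complex" / partial: L2_rel
proof (rule part_equivpI)
  show "\<exists>f. L2_rel f f" by (rule exI[of _ "\<lambda>x. 0"]) (simp add: L2_rel_def)
  show "symp L2_rel" by (auto simp: symp_def L2_rel_def)
  show "transp L2_rel" unfolding transp_def L2_rel_def by fastforce
qed

text \<open>The inner product is linear in its second argument.\<close>

lift_definition cinner :: "'a::euclidean_space L2 \<Rightarrow> 'a L2 \<Rightarrow> complex"
  is "\<lambda>f g. LINT x|lebesgue. cnj (f x) * g x"
proof -
  fix f f' g g' :: "'a \<Rightarrow> complex"
  assume *: "L2_rel f f'" "L2_rel g g'"
  show "(LINT x|lebesgue. cnj (f x) * g x) = (LINT x|lebesgue. cnj (f' x) * g' x)"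
  proof (rule integral_cong_AE)
    show "AE x in lebesgue. cnj (f x) * g x = cnj (f' x) * g' x"
      using * by (fastforce simp: L2_rel_def)
  qed (use * in \<open>auto simp: L2_rel_def dest: integrable_cnj_mult intro!: borel_measurable_integrable\<close>)
qed

lift_definition scaleC :: "complex \<Rightarrow> 'a::euclidean_space L2 \<Rightarrow> 'a L2" (infixr \<open>*\<^sub>C\<close> 75)
  is "\<lambda>c f x. c * f x"
  unfolding L2_rel_def by (auto intro: square_integrable_scale)

text \<open>Only real inner product spaces form a type class in the library; the class instance uses the
  real part of the complex inner product, which induces the usual norm.\<close>

instantiation L2 :: (euclidean_space) real_inner
begin

lift_definition zero_L2 :: "'a L2" is "\<lambda>x. 0" by (simp add: L2_rel_def)
lift_definition plus_L2 :: "'a L2 \<Rightarrow> 'a L2 \<Rightarrow> 'a L2" is "\<lambda>f g x. f x + g x"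
  unfolding L2_rel_def by (auto intro: square_integrable_add)
lift_definition minus_L2 :: "'a L2 \<Rightarrow> 'a L2 \<Rightarrow> 'a L2" is "\<lambda>f g x. f x - g x"
  unfolding L2_rel_def by (auto intro: square_integrable_diff)
lift_definition uminus_L2 :: "'a L2 \<Rightarrow> 'a L2" is "\<lambda>f x. - f x"
  unfolding L2_rel_def by (auto intro: square_integrable_minus)
definition "r *\<^sub>R f = complex_of_real r *\<^sub>C f" for f :: "'a::euclidean_space L2"
definition "f \<bullet> g = Re (cinner f g)" for f g :: "'a::euclidean_space L2"
definition "norm f = sqrt (f \<bullet> f)" for f :: "'a::euclidean_space L2"
definition "dist f g = norm (f - g)" for f g :: "'a::euclidean_space L2"
definition "sgn f = inverse (norm f) *\<^sub>R f" for f :: "'a::euclidean_space L2"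
definition [code del]:
  "uniformity = (INF e\<in>{0<..}. principal {(f, g::'a::euclidean_space L2). dist f g < e})"
definition [code del]:
  "open U \<longleftrightarrow> (\<forall>f\<in>U. eventually (\<lambda>(f', g). f' = f \<longrightarrow> g \<in> U) uniformity)" for U :: "'a::euclidean_space L2 set"

instance
proof
  fix f g h :: "'a L2" and r s :: real and U :: "'a L2 set"
  show "f + g + h = f + (g + h)"
    by transfer (auto simp: L2_rel_def add.assoc intro!: square_integrable_add)
  show "f + g = g + f"
    by transfer (auto simp: L2_rel_def add.commute intro!: square_integrable_add)
  show "0 + f = f"
    by transfer (auto simp: L2_rel_def)
  show "- f + f = 0"
    by transfer (auto simp: L2_rel_def)
  show "f - g = f + - g"
    by transfer (auto simp: L2_rel_def intro!: square_integrable_diff)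
  show "r *\<^sub>R (f + g) = r *\<^sub>R f + r *\<^sub>R g"
    unfolding scaleR_L2_def
    by transfer (auto simp: L2_rel_def distrib_left distrib_right intro!: square_integrable_add square_integrable_scale)
  show "(r + s) *\<^sub>R f = r *\<^sub>R f + s *\<^sub>R f"
    unfolding scaleR_L2_def
    by transfer (auto simp: L2_rel_def distrib_left distrib_right intro!: square_integrable_add square_integrable_scale)
  show "r *\<^sub>R s *\<^sub>R f = (r * s) *\<^sub>R f"
    unfolding scaleR_L2_def
    by transfer (auto simp: L2_rel_def mult.assoc intro!: square_integrable_scale)
  show "1 *\<^sub>R f = f"
    unfolding scaleR_L2_def by transfer (auto simp: L2_rel_def)
  show "dist f g = norm (f - g)" "sgn f = inverse (norm f) *\<^sub>R f" "norm f = sqrt (f \<bullet> f)"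
    "uniformity = (INF e\<in>{0<..}. principal {(f, g::'a::euclidean_space L2). dist f g < e})"
    "open U \<longleftrightarrow> (\<forall>f\<in>U. eventually (\<lambda>(f', g). f' = f \<longrightarrow> g \<in> U) uniformity)"
    by (fact dist_L2_def sgn_L2_def norm_L2_def uniformity_L2_def open_L2_def)+
  show "f \<bullet> g = g \<bullet> f"
    unfolding inner_L2_def
  proof transfer
    fix f g :: "'a \<Rightarrow> complex"
    have "(LINT x|lebesgue. cnj (f x) * g x) = cnj (LINT x|lebesgue. cnj (g x) * f x)"
      by (subst Bochner_Integration.integral_cnj[symmetric]) (simp add: mult.commute del: Bochner_Integration.integral_cnj)
    then show "Re (LINT x|lebesgue. cnj (f x) * g x) = Re (LINT x|lebesgue. cnj (g x) * f x)" by simp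
  qed
  show "(f + g) \<bullet> h = f \<bullet> h + g \<bullet> h"
    unfolding inner_L2_def
    by transfer (simp add: L2_rel_def integrable_cnj_mult distrib_right)
  show "(r *\<^sub>R f) \<bullet> g = r * (f \<bullet> g)"
    unfolding inner_L2_def scaleR_L2_def
    by transfer (simp add: mult.assoc)
  have *: "f \<bullet> f = (LINT x|lebesgue. (cmod (rep_L2 f x))\<^sup>2)" for f :: "'a::euclidean_space L2"
  proof -
    have "f = abs_L2 (rep_L2 f)" "L2_rel (rep_L2 f) (rep_L2 f)"
      using Quotient_L2 by (metis Quotient_abs_rep Quotient_rep_reflp)+
    then have "cinner f f = (LINT x|lebesgue. cnj (rep_L2 f x) * rep_L2 f x)"
      by (metis cinner.abs_eq)
    also have "\<dots> = (LINT x|lebesgue. complex_of_real ((cmod (rep_L2 f x))\<^sup>2))"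
      by (simp only: complex_norm_square mult.commute)
    also have "\<dots> = complex_of_real (LINT x|lebesgue. (cmod (rep_L2 f x))\<^sup>2)"
      by (rule integral_complex_of_real)
    finally show ?thesis unfolding inner_L2_def by simp
  qed
  show "0 \<le> f \<bullet> f" unfolding * by simp
  show "f \<bullet> f = 0 \<longleftrightarrow> f = 0"
  proof
    have "(0 :: 'a L2) \<bullet> 0 = 0" unfolding inner_L2_def by transfer simp
    then show "f \<bullet> f = 0" if "f = 0" using that by simp
  next
    assume "f \<bullet> f = 0"
    moreover have r: "f = abs_L2 (rep_L2 f)" "L2_rel (rep_L2 f) (rep_L2 f)"
      using Quotient_L2 by (metis Quotient_abs_rep Quotient_rep_reflp)+
    ultimately have "AE x in lebesgue. (cmod (rep_L2 f x))\<^sup>2 = 0"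
      unfolding * by (subst (asm) integral_nonneg_eq_0_iff_AE)
        (auto simp: L2_rel_def square_integrable_def)
    then have "L2_rel (rep_L2 f) (\<lambda>x. 0)" using r by (auto simp: L2_rel_def)
    then have "abs_L2 (rep_L2 f) = abs_L2 (\<lambda>x. 0)"
      using Quotient_rel[OF Quotient_L2] by metis
    then show "f = 0" using r(1) by (simp add: zero_L2_def)
  qed
qed

end

lemma L2_rel_refl [simp]: "L2_rel f f \<longleftrightarrow> square_integrable f"
  by (simp add: L2_rel_def)

lemma square_integrable_rep [simp]: "square_integrable (rep_L2 f)"
  using Quotient_L2 by (metis Quotient_rep_reflp L2_rel_refl)

lemma abs_rep_L2 [simp]: "abs_L2 (rep_L2 f) = f"
  using Quotient_L2 by (metis Quotient_abs_rep)

lemma abs_L2_eqI: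
  assumes "square_integrable f" "square_integrable g" "AE x in lebesgue. f x = g x"
  shows "abs_L2 f = abs_L2 g"
  using assms Quotient_rel[OF Quotient_L2, of f g] by (simp add: L2_rel_def)

lemma rep_abs_L2:
  assumes "square_integrable f" shows "AE x in lebesgue. rep_L2 (abs_L2 f) x = f x"
  using Quotient_rep_abs[OF Quotient_L2, of f] assms by (simp add: L2_rel_def)

lemma norm_abs_L2:
  assumes "square_integrable f"
  shows "(norm (abs_L2 f))\<^sup>2 = (LINT x|lebesgue. (cmod (f x))\<^sup>2)"
proof -
  have "cinner (abs_L2 f) (abs_L2 f) = (LINT x|lebesgue. cnj (f x) * f x)"
    using assms by (simp add: cinner.abs_eq)
  also have "\<dots> = (LINT x|lebesgue. complex_of_real ((cmod (f x))\<^sup>2))"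
    by (simp only: complex_norm_square mult.commute)
  also have "\<dots> = complex_of_real (LINT x|lebesgue. (cmod (f x))\<^sup>2)"
    by (rule integral_complex_of_real)
  finally show ?thesis
    by (simp add: power2_norm_eq_inner inner_L2_def)
qed

lemma norm_abs_L2_diff:
  assumes "square_integrable f" "square_integrable g"
  shows "(norm (abs_L2 f - abs_L2 g))\<^sup>2 = (LINT x|lebesgue. (cmod (f x - g x))\<^sup>2)"
  using assms norm_abs_L2[OF square_integrable_diff[OF assms]] by (simp add: minus_L2.abs_eq)

lemma nn_integral_L2:
  assumes "square_integrable f"
  shows "(\<integral>\<^sup>+x. ennreal ((cmod (f x))\<^sup>2) \<partial>lebesgue) = ennreal ((norm (abs_L2 f))\<^sup>2)"
  using assms unfolding norm_abs_L2[OF assms]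
  by (subst nn_integral_eq_integral) (auto simp: square_integrable_def)

instance L2 :: (euclidean_space) complete_space
proof
  fix X :: "nat \<Rightarrow> 'a L2" assume "Cauchy X"
  define F where "F n = rep_L2 (X n)" for n
  have sq [simp]: "square_integrable (F n)" for n by (simp add: F_def)
  have sqd [simp]: "square_integrable (\<lambda>x. F m x - F n x)" for m n by (simp add: square_integrable_diff)
  have [measurable]: "F n \<in> borel_measurable lebesgue" for n
    using sq[of n] unfolding square_integrable_def by blast
  have XF: "X n = abs_L2 (F n)" for n by (simp add: F_def)
  have F_diff: "(\<integral>\<^sup>+x. ennreal ((cmod (F m x - F n x))\<^sup>2) \<partial>lebesgue) = ennreal ((dist (X m) (X n))\<^sup>2)" for m n
    unfolding nn_integral_L2[OF sqd] XF dist_norm by (simp add: minus_L2.abs_eq)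
  have "\<forall>k. \<exists>N. \<forall>m\<ge>N. \<forall>n\<ge>N. dist (X m) (X n) < (1/8)^k"
    using metric_CauchyD[OF \<open>Cauchy X\<close>] by (meson zero_less_divide_1_iff zero_less_numeral zero_less_power)
  then obtain N where N: "dist (X m) (X n) < (1/8)^k" if "m \<ge> N k" "n \<ge> N k" for k m n
    by metis
  define r where "r k = (\<Sum>i\<le>k. N i)" for k
  have r: "r j \<ge> N k" if "j \<ge> k" for j k
    unfolding r_def using that by (intro member_le_sum) auto
  define a where "a k x = cmod (F (r (Suc k)) x - F (r k) x)" for k x
  have [measurable]: "a k \<in> borel_measurable lebesgue" for k unfolding a_def by measurable
  have "(\<integral>\<^sup>+x. (\<Sum>k. ennreal (4^k * (a k x)\<^sup>2)) \<partial>lebesgue)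
      = (\<Sum>k. \<integral>\<^sup>+x. ennreal (4^k * (a k x)\<^sup>2) \<partial>lebesgue)"
    by (rule nn_integral_suminf) measurable
  also have "\<dots> = (\<Sum>k. ennreal (4^k) * ennreal ((dist (X (r (Suc k))) (X (r k)))\<^sup>2))"
    unfolding a_def F_diff[symmetric]
    by (subst nn_integral_cmult[symmetric]) (auto simp: ennreal_mult)
  also have "\<dots> \<le> (\<Sum>k. ennreal ((1/2)^k))"
  proof (intro suminf_le)
    fix k
    have d: "dist (X (r (Suc k))) (X (r k)) \<le> (1/8)^k" using N[OF r r, of k "Suc k" k] by simp
    have "(dist (X (r (Suc k))) (X (r k)))\<^sup>2 \<le> ((1/8)^k)\<^sup>2" by (intro power_mono d) simp
    also have "\<dots> \<le> (1/8)^k" by (simp add: power2_eq_square power_le_one mult_left_le)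
    finally have "4^k * (dist (X (r (Suc k))) (X (r k)))\<^sup>2 \<le> 4^k * (1/8)^k" by simp
    also have "\<dots> = (1/2::real)^k" by (simp flip: power_mult_distrib)
    finally show "ennreal (4^k) * ennreal ((dist (X (r (Suc k))) (X (r k)))\<^sup>2) \<le> ennreal ((1/2)^k)"
      by (simp add: ennreal_leI flip: ennreal_mult)
  qed auto
  also have "\<dots> = ennreal (\<Sum>k. (1/2)^k)"
    by (intro suminf_ennreal_eq) (auto intro: summable_sums summable_geometric)
  finally have "(\<integral>\<^sup>+x. (\<Sum>k. ennreal (4^k * (a k x)\<^sup>2)) \<partial>lebesgue) < \<infinity>"
    by (rule order_le_less_trans) (simp only: infinity_ennreal_def ennreal_less_top)
  then have "AE x in lebesgue. (\<Sum>k. ennreal (4^k * (a k x)\<^sup>2)) \<noteq> \<infinity>"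
    by (intro nn_integral_PInf_AE) auto
  then have conv: "AE x in lebesgue. convergent (\<lambda>k. F (r k) x)"
  proof eventually_elim
    case (elim x)
    then have "summable (\<lambda>k. 4^k * (a k x)\<^sup>2)"
      by (intro summable_suminf_not_top) auto
    then have "(\<lambda>k. 4^k * (a k x)\<^sup>2) \<longlonglongrightarrow> 0" by (rule summable_LIMSEQ_zero)
    then have "eventually (\<lambda>k. 4^k * (a k x)\<^sup>2 < 1) sequentially"
      by (rule order_tendstoD) simp
    then have "eventually (\<lambda>k. norm (F (r (Suc k)) x - F (r k) x) \<le> (1/2)^k) sequentially"
    proof eventually_elim
      case (elim k)
      have "(2^k)\<^sup>2 = (4::real)^k" by (simp add: power2_eq_square flip: power_mult_distrib)
      then have "(2^k * a k x)\<^sup>2 = 4^k * (a k x)\<^sup>2" by (simp add: power_mult_distrib)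
      then have "(2^k * a k x)\<^sup>2 \<le> 1\<^sup>2" using elim by simp
      then have "2^k * a k x \<le> 1" by (rule power2_le_imp_le) simp
      then show ?case by (simp add: a_def field_simps power_one_over)
    qed
    then have "summable (\<lambda>k. F (r (Suc k)) x - F (r k) x)"
      by (rule summable_comparison_test_ev) (simp add: summable_geometric)
    then have "convergent (\<lambda>n. \<Sum>k<n. F (r (Suc k)) x - F (r k) x)"
      by (simp add: summable_iff_convergent)
    then have "convergent (\<lambda>n. F (r n) x - F (r 0) x)"
      unfolding sum_lessThan_telescope[of "\<lambda>k. F (r k) x"] .
    then show ?case
      using convergent_add[OF _ convergent_const[of "F (r 0) x"]] by fastforce
  qed
  define f where "f x = lim (\<lambda>k. F (r k) x)" for x
  have [measurable]: "f \<in> borel_measurable lebesgue" unfolding f_def by measurable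
  have lim: "AE x in lebesgue. (\<lambda>k. F (r k) x) \<longlonglongrightarrow> f x"
    using conv by eventually_elim (simp add: f_def convergent_LIMSEQ_iff)
  have bound: "(\<integral>\<^sup>+x. ennreal ((cmod (F n x - f x))\<^sup>2) \<partial>lebesgue) \<le> ennreal (((1/8)^k)\<^sup>2)"
    if n: "n \<ge> N k" for n k
  proof -
    have "(\<integral>\<^sup>+x. ennreal ((cmod (F n x - f x))\<^sup>2) \<partial>lebesgue)
        = (\<integral>\<^sup>+x. liminf (\<lambda>j. ennreal ((cmod (F n x - F (r j) x))\<^sup>2)) \<partial>lebesgue)"
    proof (rule nn_integral_cong_AE)
      show "AE x in lebesgue. ennreal ((cmod (F n x - f x))\<^sup>2)
          = liminf (\<lambda>j. ennreal ((cmod (F n x - F (r j) x))\<^sup>2))"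
        using lim
      proof eventually_elim
        case (elim x)
        then have "(\<lambda>j. ennreal ((cmod (F n x - F (r j) x))\<^sup>2)) \<longlonglongrightarrow> ennreal ((cmod (F n x - f x))\<^sup>2)"
          by (intro tendsto_ennrealI tendsto_intros)
        then show ?case by (rule lim_imp_Liminf[symmetric, rotated]) simp
      qed
    qed
    also have "\<dots> \<le> liminf (\<lambda>j. \<integral>\<^sup>+x. ennreal ((cmod (F n x - F (r j) x))\<^sup>2) \<partial>lebesgue)"
      by (rule nn_integral_liminf) measurable
    also have "\<dots> \<le> ennreal (((1/8)^k)\<^sup>2)"
      unfolding F_diff
    proof (rule Liminf_le)
      show "\<forall>\<^sub>F j in sequentially. ennreal ((dist (X n) (X (r j)))\<^sup>2) \<le> ennreal (((1/8)^k)\<^sup>2)"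
        using eventually_ge_at_top[of k]
        by eventually_elim (intro ennreal_leI power_mono less_imp_le[OF N] r n; simp)
    qed simp
    finally show ?thesis .
  qed
  have "integrable lebesgue (\<lambda>x. (cmod (F n x - f x))\<^sup>2)" if "n \<ge> N 0" for n
    using order_le_less_trans[OF bound[OF that]]
    by (intro integrableI_nonneg) auto
  then have sqF: "square_integrable (\<lambda>x. F n x - f x)" if "n \<ge> N 0" for n
    using that unfolding square_integrable_def by simp
  have "square_integrable (\<lambda>x. F (N 0) x - (F (N 0) x - f x))"
    by (intro square_integrable_diff sq sqF order_refl)
  then have sqf: "square_integrable f" by simp
  have bound': "dist (X n) (abs_L2 f) \<le> (1/8)^k" if n: "n \<ge> N k" for n k
  proof -
    have sqn: "square_integrable (\<lambda>x. F n x - f x)"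
      using sqf by (simp add: square_integrable_diff)
    have "ennreal ((dist (X n) (abs_L2 f))\<^sup>2) \<le> ennreal (((1/8)^k)\<^sup>2)"
      using bound[OF n] nn_integral_L2[OF sqn] sqf by (simp add: XF dist_norm minus_L2.abs_eq)
    then have "(dist (X n) (abs_L2 f))\<^sup>2 \<le> ((1/8)^k)\<^sup>2" by simp
    then show ?thesis by (rule power2_le_imp_le) simp
  qed
  have "X \<longlonglongrightarrow> abs_L2 f"
  proof (rule metric_LIMSEQ_I)
    fix e :: real assume "e > 0"
    then obtain k where "(1/8)^k < e" using real_arch_pow_inv[of e "1/8"] by auto
    then show "\<exists>no. \<forall>n\<ge>no. dist (X n) (abs_L2 f) < e"
      using bound' by (intro exI[of _ "N k"]) (meson order_le_less_trans)
  qed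
  then show "convergent X" by (auto simp: convergent_def)
qed

instance L2 :: (euclidean_space) banach ..

lemma L2_dominated_convergence:
  fixes F :: "nat \<Rightarrow> 'a::euclidean_space \<Rightarrow> complex"
  assumes [measurable]: "\<And>n. F n \<in> borel_measurable lebesgue" "f \<in> borel_measurable lebesgue"
    and h: "integrable lebesgue h"
    and bound: "\<And>n x. (cmod (F n x))\<^sup>2 \<le> h x" and lim: "\<And>x. (\<lambda>n. F n x) \<longlonglongrightarrow> f x"
  shows "(\<lambda>n. abs_L2 (F n)) \<longlonglongrightarrow> abs_L2 f"
proof -
  have f_bound: "(cmod (f x))\<^sup>2 \<le> h x" for x
  proof (rule LIMSEQ_le_const2)
    show "(\<lambda>n. (cmod (F n x))\<^sup>2) \<longlonglongrightarrow> (cmod (f x))\<^sup>2" by (intro tendsto_intros lim)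
  qed (use bound in blast)
  have sq: "square_integrable (F n)" "square_integrable f" for n
    using square_integrable_dominated[OF _ h] bound f_bound by auto
  have "(\<lambda>n. LINT x|lebesgue. (cmod (F n x - f x))\<^sup>2) \<longlonglongrightarrow> (LINT x|(lebesgue::'a measure). (0::real))"
  proof (rule integral_dominated_convergence)
    show "integrable lebesgue (\<lambda>x. 4 * h x)" using h by simp
    show "AE x in lebesgue. (\<lambda>n. (cmod (F n x - f x))\<^sup>2) \<longlonglongrightarrow> 0"
    proof (intro AE_I2)
      fix x
      have "(\<lambda>n. (cmod (F n x - f x))\<^sup>2) \<longlonglongrightarrow> (cmod (f x - f x))\<^sup>2"
        by (intro tendsto_intros lim)
      then show "(\<lambda>n. (cmod (F n x - f x))\<^sup>2) \<longlonglongrightarrow> 0" by simp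
    qed
    show "AE x in lebesgue. norm ((cmod (F n x - f x))\<^sup>2) \<le> 4 * h x" for n
    proof (intro AE_I2)
      fix x
      show "norm ((cmod (F n x - f x))\<^sup>2) \<le> 4 * h x"
        using cmod_add_square_le[of "F n x" "- f x"] bound[of n x] f_bound[of x] by simp
    qed
  qed measurable
  then have "(\<lambda>n. (norm (abs_L2 (F n) - abs_L2 f))\<^sup>2) \<longlonglongrightarrow> 0"
    using sq by (simp add: norm_abs_L2_diff)
  then have "(\<lambda>n. sqrt ((norm (abs_L2 (F n) - abs_L2 f))\<^sup>2)) \<longlonglongrightarrow> sqrt 0"
    by (intro tendsto_real_sqrt)
  then have "(\<lambda>n. abs_L2 (F n) - abs_L2 f) \<longlonglongrightarrow> 0"
    by (subst tendsto_norm_zero_iff[symmetric]) simp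
  then show ?thesis by (rule LIM_zero_cancel)
qed

lemma norm_scaleC: "norm (c *\<^sub>C f) = cmod c * norm f"
proof -
  have "(norm (c *\<^sub>C f))\<^sup>2 = (norm (abs_L2 (\<lambda>x. c * rep_L2 f x)))\<^sup>2"
    using scaleC.abs_eq[of "rep_L2 f" c] by simp
  also have "\<dots> = (cmod c)\<^sup>2 * (norm (abs_L2 (rep_L2 f)))\<^sup>2"
    by (subst (1 2) norm_abs_L2) (auto simp: square_integrable_scale norm_mult power_mult_distrib)
  also have "\<dots> = (cmod c * norm f)\<^sup>2" by (simp add: power_mult_distrib)
  finally show ?thesis by (simp add: power2_eq_iff_nonneg)
qed

lemma scaleC_diff_left: "(c - d) *\<^sub>C f = c *\<^sub>C f - d *\<^sub>C f"
  by transfer (auto simp: L2_rel_def left_diff_distrib intro!: square_integrable_diff square_integrable_scale)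

lemma tendsto_scaleC:
  assumes "c \<longlonglongrightarrow> l" shows "(\<lambda>n. c n *\<^sub>C f) \<longlonglongrightarrow> l *\<^sub>C f"
proof -
  have "(\<lambda>n. cmod (c n - l) * norm f) \<longlonglongrightarrow> 0"
    using assms by (intro tendsto_mult_left_zero tendsto_norm_zero LIM_zero)
  then have "(\<lambda>n. c n *\<^sub>C f - l *\<^sub>C f) \<longlonglongrightarrow> 0"
    by (subst tendsto_norm_zero_iff[symmetric]) (simp add: norm_scaleC flip: scaleC_diff_left)
  then show ?thesis by (rule LIM_zero_cancel)
qed

lemma integrable_indicator_ball:
  "integrable lebesgue (\<lambda>x::'a::euclidean_space. (c::real) * indicator (ball 0 r) x)"
  using lmeasurable_ball[of "0::'a" r]
  by (intro integrable_mult_right integrable_real_indicator) (auto simp: fmeasurable_def)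

lemma square_integrable_indicator_ball:
  fixes A :: "'a::euclidean_space set"
  assumes [measurable]: "A \<in> sets lebesgue"
  shows "square_integrable (\<lambda>x. c * indicator (A \<inter> ball 0 r) x)"
proof (rule square_integrable_dominated)
  show "integrable lebesgue (\<lambda>x::'a. (cmod c)\<^sup>2 * indicator (ball 0 r) x)"
    by (rule integrable_indicator_ball)
  have "A \<inter> ball 0 r \<in> sets lebesgue" by (intro sets.Int assms sets_completionI_sets) simp
  then show "(\<lambda>x. c * indicator (A \<inter> ball 0 r) x) \<in> borel_measurable lebesgue"
    by (intro borel_measurable_times borel_measurable_const borel_measurable_indicator)
qed (auto simp: indicator_def norm_mult)

text \<open>Separability of \<open>L\<^sup>2\<close> makes the Bochner integral of the library available.\<close>

lemma L2_separable:
  obtains S :: "'a::euclidean_space L2 set" where "countable S" "closure S = UNIV"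
proof -
  obtain B :: "'a set set" where B: "countable B" "topological_basis B"
    using ex_countable_basis by blast
  define G where "G = Inter ` {F. finite F \<and> F \<subseteq> B}"
  have "countable G"
    unfolding G_def by (intro countable_image countable_Collect_finite_subset B)
  have openG: "open A" if "A \<in> G" for A
    using that topological_basis_open[OF B(2)] unfolding G_def by auto
  have "topological_basis G"
  proof (rule topological_basisI)
    fix U :: "'a set" and x assume "open U" "x \<in> U"
    then obtain b where b: "b \<in> B" "x \<in> b" "b \<subseteq> U" using topological_basisE[OF B(2)] by metis
    then have "b = \<Inter>{b}" "finite {b}" "{b} \<subseteq> B" by auto
    then have "b \<in> G" unfolding G_def by blast
    then show "\<exists>b\<in>G. x \<in> b \<and> b \<subseteq> U" using b by blast
  qed (rule openG)
  then have "sets (borel :: 'a measure) = sets (sigma UNIV G)"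
    using borel_eq_countable_basis[OF \<open>countable G\<close>] by simp
  then have borel_G: "sets (borel :: 'a measure) = sigma_sets UNIV G"
    by simp
  have "Int_stable G"
  proof (rule Int_stableI)
    fix a b assume "a \<in> G" "b \<in> G"
    then obtain F F' where *: "a = \<Inter>F" "b = \<Inter>F'" "finite F" "F \<subseteq> B" "finite F'" "F' \<subseteq> B"
      unfolding G_def by blast
    then have "a \<inter> b = \<Inter>(F \<union> F')" "finite (F \<union> F')" "F \<union> F' \<subseteq> B" by auto
    then show "a \<inter> b \<in> G" unfolding G_def by blast
  qed
  have G_Pow: "G \<subseteq> Pow UNIV" by simp
  have "UNIV \<in> G" unfolding G_def by (rule image_eqI[of _ _ "{}"]) auto
  obtain D :: "complex set" where D: "countable D" "\<And>X. open X \<Longrightarrow> X \<noteq> {} \<Longrightarrow> \<exists>d\<in>D. d \<in> X"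
    by (erule countable_dense_setE)
  define I where "I c A n = abs_L2 (\<lambda>x::'a. c * indicator (A \<inter> ball 0 (real n)) x)" for c A n
  define E where "E = (\<lambda>(c, A, n). I c A n) ` (D \<times> G \<times> UNIV)"
  define S where "S = sum_list ` lists E"
  define M where "M = closure S"
  have "countable E" unfolding E_def by (intro countable_image countable_SIGMA D \<open>countable G\<close>) auto
  then have "countable S" unfolding S_def by (intro countable_image countable_lists)
  have "closed M" unfolding M_def by simp
  have M_lim: "f \<in> M" if "\<And>n. F n \<in> M" "F \<longlonglongrightarrow> f" for F f
    using \<open>closed M\<close> that by (auto simp: closed_sequential_limits)
  have M_add: "f + g \<in> M" if fg: "f \<in> M" "g \<in> M" for f g
  proof -
    obtain F F' where F: "\<And>n. F n \<in> S" "F \<longlonglongrightarrow> f" "\<And>n. F' n \<in> S" "F' \<longlonglongrightarrow> g"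
      using fg unfolding M_def closure_sequential by blast
    have "F n + F' n \<in> S" for n
    proof -
      obtain xs ys where "xs \<in> lists E" "F n = sum_list xs" "ys \<in> lists E" "F' n = sum_list ys"
        using F(1,3)[of n] unfolding S_def by blast
      then show ?thesis unfolding S_def by (intro image_eqI[of _ _ "xs @ ys"]) auto
    qed
    then show ?thesis
      unfolding M_def closure_sequential using tendsto_add[OF F(2,4)]
      by (intro exI[of _ "\<lambda>n. F n + F' n"]) blast
  qed
  have "0 \<in> S" unfolding S_def by (intro image_eqI[of _ _ "[]"]) auto
  then have M_0: "0 \<in> M" using closure_subset[of S] unfolding M_def by blast
  have leb: "A \<in> sets lebesgue" if "A \<in> sets borel" for A :: "'a set"
    using that by (simp add: sets_completionI_sets)
  have IG: "I c A n \<in> M" if A: "A \<in> G" for c A n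
  proof -
    have "c \<in> closure D"
      using D(2) by (force simp: closure_iff_nhds_not_empty)
    then obtain d where d: "\<And>k. d k \<in> D" "d \<longlonglongrightarrow> c" unfolding closure_sequential by blast
    define w where "w = abs_L2 (\<lambda>x. 1 * indicator (A \<inter> ball 0 (real n)) x)"
    have "square_integrable (\<lambda>x. 1 * indicator (A \<inter> ball 0 (real n)) x)"
      using openG[OF A] by (intro square_integrable_indicator_ball leb) auto
    then have Iw: "I z A n = z *\<^sub>C w" for z
      unfolding I_def w_def by (subst scaleC.abs_eq) auto
    have "I (d k) A n \<in> E" for k
      unfolding E_def by (rule image_eqI[of _ _ "(d k, A, n)"]) (use d A in auto)
    then have "I (d k) A n \<in> S" for k
      unfolding S_def by (intro image_eqI[of _ _ "[I (d k) A n]"]) simp_all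
    then have "I (d k) A n \<in> M" for k using closure_subset[of S] unfolding M_def by blast
    then show ?thesis
      using tendsto_scaleC[OF d(2), of w] unfolding Iw by (rule M_lim)
  qed
  have I_add: "I c A n + I d B n = I e C n"
    if "A \<in> sets lebesgue" "B \<in> sets lebesgue"
      "\<And>x. c * indicator A x + d * indicator B x = e * (indicator C x :: complex)"
    for c d e A B C n
  proof -
    have eq: "c * indicator (A \<inter> ball 0 (real n)) x + d * indicator (B \<inter> ball 0 (real n)) x
        = e * (indicator (C \<inter> ball 0 (real n)) x :: complex)" for x
      using that(3)[of x] by (cases "x \<in> ball 0 (real n)") (auto simp: indicator_def)
    have "I c A n + I d B n = abs_L2 (\<lambda>x. c * indicator (A \<inter> ball 0 (real n)) x
        + d * indicator (B \<inter> ball 0 (real n)) x)"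
      unfolding I_def by (rule plus_L2.abs_eq) (simp_all only: L2_rel_refl square_integrable_indicator_ball that)
    then show ?thesis unfolding eq I_def .
  qed
  have IB: "\<forall>c n. I c A n \<in> M" if A: "A \<in> sets borel" for A
    using \<open>Int_stable G\<close> G_Pow A[unfolded borel_G]
  proof (induction rule: sigma_sets_induct_disjoint)
    case (basic A)
    then show ?case using IG by blast
  next
    case empty
    then show ?case using M_0 unfolding I_def by (simp add: zero_L2_def)
  next
    case (compl A)
    have A: "A \<in> sets borel" using compl(1) borel_G by blast
    show ?case
    proof (intro allI)
      fix c n
      have "I c UNIV n + I (- c) A n = I c (UNIV - A) n"
        using A by (intro I_add leb) (auto split: split_indicator)
      moreover have "I (- c) A n \<in> M" using compl(2) by blast
      ultimately show "I c (UNIV - A) n \<in> M"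
        using M_add[OF IG[OF \<open>UNIV \<in> G\<close>, of c n], of "I (- c) A n"] by simp
    qed
  next
    case (union A)
    have A: "A i \<in> sets borel" for i using union(2) borel_G by blast
    show ?case
    proof (intro allI)
      fix c n
      have "I c (\<Union>i<m. A i) n \<in> M" for m
      proof (induction m)
        case 0
        show ?case using M_0 unfolding I_def by (simp add: zero_L2_def)
      next
        case (Suc m)
        have "A i \<inter> A m = {}" if "i < m" for i
          using disjoint_family_onD[OF union(1), of i m] that by simp
        then have "(\<Union>i<m. A i) \<inter> A m = {}" by blast
        then have eq: "I c (\<Union>i<m. A i) n + I c (A m) n = I c (\<Union>i<Suc m. A i) n"
          using A by (intro I_add leb) (auto simp: lessThan_Suc split: split_indicator)
        have "I c (A m) n \<in> M" using union(3) by blast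
        from M_add[OF Suc this] show ?case unfolding eq .
      qed
      moreover have "(\<lambda>m. I c (\<Union>i<m. A i) n) \<longlonglongrightarrow> I c (\<Union>i. A i) n"
        unfolding I_def
      proof (rule L2_dominated_convergence)
        show "integrable lebesgue (\<lambda>x::'a. (cmod c)\<^sup>2 * indicator (ball 0 (real n)) x)"
          by (rule integrable_indicator_ball)
        show "(\<lambda>m. c * indicator ((\<Union>i<m. A i) \<inter> ball 0 (real n)) x)
            \<longlonglongrightarrow> c * indicator ((\<Union>i. A i) \<inter> ball 0 (real n)) x" for x
          using LIMSEQ_indicator_UN[of "\<lambda>i. A i \<inter> ball 0 (real n)" x]
          unfolding UN_extend_simps(4)[symmetric] by (rule tendsto_mult_left)
        have "(\<Union>i<m. A i) \<in> sets lebesgue" "(\<Union>i. A i) \<in> sets lebesgue" for m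
          using A by (auto intro!: leb)
        then show "(\<lambda>x. c * indicator ((\<Union>i<m. A i) \<inter> ball 0 (real n)) x) \<in> borel_measurable lebesgue"
          "(\<lambda>x. c * indicator ((\<Union>i. A i) \<inter> ball 0 (real n)) x) \<in> borel_measurable lebesgue" for m
          using square_integrable_indicator_ball[of "\<Union>i<m. A i" c "real n"]
            square_integrable_indicator_ball[of "\<Union>i. A i" c "real n"]
          unfolding square_integrable_def by auto
      qed (auto simp: indicator_def norm_mult)
      ultimately show "I c (\<Union>i. A i) n \<in> M" by (rule M_lim)
    qed
  qed
  have IL: "I c A n \<in> M" if A: "A \<in> sets lebesgue" for c A n
  proof -
    obtain A' N N' where *: "A = A' \<union> N" "N \<subseteq> N'" "N' \<in> null_sets lborel" "A' \<in> sets lborel"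
      by (rule sets_completionE[OF A])
    have "N' \<in> null_sets lebesgue" by (rule null_sets_completionI[OF *(3)])
    then have "AE x in lebesgue. x \<notin> N'" by (rule AE_not_in)
    then have "AE x in lebesgue. c * indicator (A \<inter> ball 0 (real n)) x
        = c * indicator (A' \<inter> ball 0 (real n)) x"
      by eventually_elim (use * in \<open>auto split: split_indicator\<close>)
    moreover have A': "A' \<in> sets borel" using *(4) by simp
    ultimately have "I c A n = I c A' n"
      unfolding I_def by (intro abs_L2_eqI square_integrable_indicator_ball A leb[OF A'])
    then show ?thesis using IB[OF A'] by simp
  qed
  have all_M: "f \<in> M" for f
  proof -
    define g where "g = rep_L2 f"
    have g: "square_integrable g" "f = abs_L2 g" by (auto simp: g_def)
    then have [measurable]: "g \<in> borel_measurable lebesgue" by (simp add: square_integrable_def)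
    obtain s where s: "\<And>i. simple_function lebesgue (s i)" "\<And>x. (\<lambda>i. s i x) \<longlonglongrightarrow> g x"
      "\<And>i x. cmod (s i x) \<le> 2 * cmod (g x)"
      using borel_measurable_implies_sequence_metric[of g lebesgue 0] by (auto simp: dist_norm)
    have [measurable]: "s i \<in> borel_measurable lebesgue" for i
      using s(1) by (rule borel_measurable_simple_function)
    define t where "t n x = s n x * indicator (ball 0 (real n)) x" for n x
    have [measurable]: "ball (0::'a) (real n) \<in> sets lebesgue" for n by (rule leb) simp
    have "abs_L2 (t n) \<in> M" for n
    proof -
      define u where "u y x = y * indicator (s n -` {y} \<inter> ball 0 (real n)) x" for y x
      have fin: "finite (range (s n))" using s(1)[of n] by (simp add: simple_function_def)
      have set: "s n -` {y} \<in> sets lebesgue" for y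
        using simple_functionD(2)[OF s(1)[of n], of "{y}"]
        by (simp only: space_completion space_lborel space_borel Int_UNIV_right)
      have "t n = (\<lambda>x. \<Sum>y\<in>range (s n). u y x)"
      proof
        fix x
        have "(\<Sum>y\<in>range (s n). u y x) = (\<Sum>y\<in>{s n x}. u y x)"
          by (rule sum.mono_neutral_right) (use fin in \<open>auto simp: u_def split: split_indicator\<close>)
        also have "\<dots> = u (s n x) x" by simp
        also have "\<dots> = t n x" by (simp add: u_def t_def indicator_def)
        finally show "t n x = (\<Sum>y\<in>range (s n). u y x)" by (rule sym)
      qed
      moreover have "square_integrable (\<lambda>x. \<Sum>y\<in>Y. u y x) \<and> abs_L2 (\<lambda>x. \<Sum>y\<in>Y. u y x) \<in> M"
        if "finite Y" for Y
        using that
      proof induction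
        case empty
        then show ?case using M_0 by (simp add: zero_L2_def)
      next
        case (insert y Y)
        have sq: "square_integrable (u y)"
          unfolding u_def by (rule square_integrable_indicator_ball[OF set])
        have "abs_L2 (u y) \<in> M" using IL[OF set[of y], of y n] unfolding I_def u_def .
        then have "abs_L2 (u y) + abs_L2 (\<lambda>x. \<Sum>y\<in>Y. u y x) \<in> M"
          using insert by (intro M_add) auto
        then show ?case
          using insert sq by (simp add: plus_L2.abs_eq square_integrable_add)
      qed
      ultimately show ?thesis using fin by simp
    qed
    moreover have "(\<lambda>n. abs_L2 (t n)) \<longlonglongrightarrow> abs_L2 g"
    proof (rule L2_dominated_convergence)
      show "t n \<in> borel_measurable lebesgue" for n unfolding t_def by measurable
      show "integrable lebesgue (\<lambda>x. 4 * (cmod (g x))\<^sup>2)"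
        using g by (simp add: square_integrable_def)
      show "(cmod (t n x))\<^sup>2 \<le> 4 * (cmod (g x))\<^sup>2" for n x
      proof -
        have "cmod (t n x) \<le> 2 * cmod (g x)"
          using s(3)[of n x] by (simp add: t_def indicator_def)
        then have "(cmod (t n x))\<^sup>2 \<le> (2 * cmod (g x))\<^sup>2" by (rule power_mono) simp
        then show ?thesis by (simp add: power_mult_distrib)
      qed
      show "(\<lambda>n. t n x) \<longlonglongrightarrow> g x" for x
      proof -
        obtain m :: nat where m: "norm x < real m" using reals_Archimedean2 by blast
        have "eventually (\<lambda>n. s n x = t n x) sequentially"
          using eventually_ge_at_top[of m] by eventually_elim (use m in \<open>auto simp: t_def\<close>)
        then show ?thesis by (rule Lim_transform_eventually[OF s(2)])
      qed
    qed measurable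
    ultimately show ?thesis unfolding g(2) by (rule M_lim)
  qed
  have "closure S = UNIV"
    unfolding M_def[symmetric] by (rule UNIV_eq_I[symmetric]) (rule all_M)
  then show ?thesis by (rule that[OF \<open>countable S\<close>])
qed

instance L2 :: (euclidean_space) second_countable_topology
proof
  obtain S :: "'a L2 set" where S: "countable S" "closure S = UNIV"
    by (rule L2_separable)
  define B where "B = (\<lambda>(s, n::nat). ball s (1 / real (Suc n))) ` (S \<times> UNIV)"
  have "topological_basis B"
  proof (rule topological_basisI)
    fix U :: "'a L2 set" and x assume "open U" "x \<in> U"
    then obtain e where e: "e > 0" "ball x e \<subseteq> U" by (meson open_contains_ball)
    then obtain n where n: "1 / real (Suc n) < e / 2"
      using reals_Archimedean[of "e/2"] by (auto simp: inverse_eq_divide)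
    have "x \<in> closure S" using S by simp
    then obtain s where s: "s \<in> S" "dist s x < 1 / real (Suc n)"
      unfolding closure_approachable by (meson of_nat_0_less_iff zero_less_Suc zero_less_divide_1_iff)
    have "ball s (1 / real (Suc n)) \<subseteq> ball x e"
    proof
      fix y assume "y \<in> ball s (1 / real (Suc n))"
      then show "y \<in> ball x e"
        using s n dist_triangle[of x y s] by (simp add: dist_commute)
    qed
    moreover have "ball s (1 / real (Suc n)) \<in> B" unfolding B_def using s by auto
    ultimately show "\<exists>b\<in>B. x \<in> b \<and> b \<subseteq> U" using s e by (intro bexI[of _ "ball s (1 / real (Suc n))"]) auto
  qed (auto simp: B_def)
  moreover have "countable B" unfolding B_def using S by (intro countable_image) auto
  ultimately show "\<exists>B::'a L2 set set. countable B \<and> open = generate_topology B"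
    using topological_basis_imp_subbasis by blast
qed

definition closed_subspace :: "'a::euclidean_space L2 set \<Rightarrow> bool"
  where "closed_subspace M \<longleftrightarrow> closed M \<and> 0 \<in> M \<and> (\<forall>f\<in>M. \<forall>g\<in>M. f + g \<in> M) \<and>
    (\<forall>c. \<forall>f\<in>M. c *\<^sub>C f \<in> M)"

definition orth_proj :: "'a::euclidean_space L2 set \<Rightarrow> 'a L2 \<Rightarrow> 'a L2"
  where "orth_proj M f = (THE p. p \<in> M \<and> (\<forall>m\<in>M. cinner m (f - p) = 0))"


section \<open>Unbounded operators\<close>

text \<open>An operator in a subspace \<open>M\<close> is identified with its graph, so that its domain is the
  \<^const>\<open>Domain\<close> of the relation and equality of operators includes equality of domains.\<close>

type_synonym 'a operator = "('a L2 \<times> 'a L2) set"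

definition linear_operator_in :: "'a::euclidean_space L2 set \<Rightarrow> 'a operator \<Rightarrow> bool"
  where "linear_operator_in M A \<longleftrightarrow> A \<subseteq> M \<times> M \<and> single_valued A \<and> (0, 0) \<in> A \<and>
    (\<forall>f f' g g'. (f, f') \<in> A \<longrightarrow> (g, g') \<in> A \<longrightarrow> (f + g, f' + g') \<in> A) \<and>
    (\<forall>c f f'. (f, f') \<in> A \<longrightarrow> (c *\<^sub>C f, c *\<^sub>C f') \<in> A)"

definition adjoint_in :: "'a::euclidean_space L2 set \<Rightarrow> 'a operator \<Rightarrow> 'a operator"
  where "adjoint_in M A =
    {(g, g') \<in> M \<times> M. \<forall>f f'. (f, f') \<in> A \<longrightarrow> cinner g f' = cinner g' f}"

definition selfadjoint_in :: "'a::euclidean_space L2 set \<Rightarrow> 'a operator \<Rightarrow> bool"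
  where "selfadjoint_in M A \<longleftrightarrow>
    linear_operator_in M A \<and> closure (Domain A) = M \<and> adjoint_in M A = A"

text \<open>\<open>S = H\<^bsup>1/2\<^esup>\<close>, the nonnegative selfadjoint operator with \<open>S\<^sup>2 = H\<close>. For nonnegative selfadjoint
  \<open>H\<close> there is exactly one such \<open>S\<close>; otherwise there is none.\<close>

definition sqrt_operator :: "'a::euclidean_space L2 set \<Rightarrow> 'a operator \<Rightarrow> 'a operator \<Rightarrow> bool"
  where "sqrt_operator M H S \<longleftrightarrow> selfadjoint_in M S \<and>
    (\<forall>f f'. (f, f') \<in> S \<longrightarrow> 0 \<le> Re (cinner f f')) \<and> S O S = H"

definition semigroup_generated_by ::
    "'a::euclidean_space L2 set \<Rightarrow> 'a operator \<Rightarrow> (real \<Rightarrow> 'a L2 \<Rightarrow> 'a L2) \<Rightarrow> bool"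
  where "semigroup_generated_by M G E \<longleftrightarrow>
    (\<forall>t\<ge>0. (\<forall>f\<in>M. E t f \<in> M) \<and>
      (\<forall>f\<in>M. \<forall>g\<in>M. E t (f + g) = E t f + E t g) \<and>
      (\<forall>c. \<forall>f\<in>M. E t (c *\<^sub>C f) = c *\<^sub>C E t f) \<and>
      (\<exists>C. \<forall>f\<in>M. norm (E t f) \<le> C * norm f)) \<and>
    (\<forall>f\<in>M. E 0 f = f) \<and>
    (\<forall>s\<ge>0. \<forall>t\<ge>0. \<forall>f\<in>M. E (s + t) f = E s (E t f)) \<and>
    (\<forall>f\<in>M. ((\<lambda>t. E t f) \<longlongrightarrow> f) (at_right 0)) \<and>
    G = {(f, f') \<in> M \<times> M. ((\<lambda>t. (E t f - f) /\<^sub>R t) \<longlongrightarrow> f') (at_right 0)}"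

text \<open>\<open>exp_semigroup M H t f\<close> is \<open>e\<^bsup>-tH\<^esup> f\<close>. A strongly continuous semigroup on \<open>M\<close> is
  determined by its generator, so the choice only affects the irrelevant values for \<open>t < 0\<close> or
  \<open>f \<notin> M\<close>.\<close>

definition exp_semigroup ::
    "'a::euclidean_space L2 set \<Rightarrow> 'a operator \<Rightarrow> real \<Rightarrow> 'a L2 \<Rightarrow> 'a L2"
  where "exp_semigroup M H = (SOME E. semigroup_generated_by M {(f, - f') | f f'. (f, f') \<in> H} E)"


section \<open>The Sobolev space and lower bounds by the Laplacian\<close>

definition partial_deriv :: "'a::euclidean_space \<Rightarrow> ('a \<Rightarrow> real) \<Rightarrow> 'a \<Rightarrow> real"
  where "partial_deriv b \<phi> x = frechet_derivative \<phi> (at x) b"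

primrec C_k :: "nat \<Rightarrow> ('a::euclidean_space \<Rightarrow> real) \<Rightarrow> bool"
  where
    "C_k 0 \<phi> \<longleftrightarrow> continuous_on UNIV \<phi>"
  | "C_k (Suc k) \<phi> \<longleftrightarrow> (\<forall>x. \<phi> differentiable at x) \<and> (\<forall>b\<in>Basis. C_k k (partial_deriv b \<phi>))"

definition test_function :: "('a::euclidean_space \<Rightarrow> real) \<Rightarrow> bool"
  where "test_function \<phi> \<longleftrightarrow> (\<forall>k. C_k k \<phi>) \<and> (\<exists>K. compact K \<and> (\<forall>x. x \<notin> K \<longrightarrow> \<phi> x = 0))"

definition has_weak_partial :: "'a::euclidean_space \<Rightarrow> 'a L2 \<Rightarrow> 'a L2 \<Rightarrow> bool"
  where "has_weak_partial b u g \<longleftrightarrow> (\<forall>\<phi>. test_function \<phi> \<longrightarrow>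
    (LINT x|lebesgue. complex_of_real (partial_deriv b \<phi> x) * rep_L2 u x) =
    - (LINT x|lebesgue. complex_of_real (\<phi> x) * rep_L2 g x))"

definition W12 :: "'a::euclidean_space L2 set"
  where "W12 = {u. \<forall>b\<in>Basis. \<exists>g. has_weak_partial b u g}"

text \<open>Weak derivatives are unique as elements of \<open>L\<^sup>2\<close>.\<close>

definition weak_partial :: "'a::euclidean_space \<Rightarrow> 'a L2 \<Rightarrow> 'a L2"
  where "weak_partial b u = (SOME g. has_weak_partial b u g)"

definition dirichlet_energy :: "'a::euclidean_space L2 \<Rightarrow> real"
  where "dirichlet_energy u =
    (LINT x|lebesgue. (\<Sum>b\<in>Basis. (cmod (rep_L2 (weak_partial b u) x))\<^sup>2))"

text \<open>\<open>H \<ge> \<eta>(-\<Delta>)\<close> in the sense of forms, for \<open>H\<close> selfadjoint in \<open>M\<close>; the form domain is the domain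
  of \<open>H\<^bsup>1/2\<^esup>\<close>.\<close>

definition ge_laplacian :: "'a::euclidean_space L2 set \<Rightarrow> 'a operator \<Rightarrow> real \<Rightarrow> bool"
  where "ge_laplacian M H \<eta> \<longleftrightarrow> (\<exists>S. sqrt_operator M H S \<and> Domain S \<subseteq> W12 \<and>
    (\<forall>u v. (u, v) \<in> S \<longrightarrow> (norm v)\<^sup>2 \<ge> \<eta> * dirichlet_energy u))"


section \<open>The control problem\<close>

definition L_infinity :: "('a::euclidean_space \<Rightarrow> real) set"
  where "L_infinity = {V \<in> borel_measurable lebesgue. \<exists>C. AE x in lebesgue. \<bar>V x\<bar> \<le> C}"

definition thick :: "real \<Rightarrow> real \<Rightarrow> ('a::euclidean_space \<Rightarrow> real) \<Rightarrow> bool"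
  where "thick R \<rho> V \<longleftrightarrow>
    (\<forall>y::'a. 1 / R ^ DIM('a) * (LINT x:box y (y + R *\<^sub>R One)|lebesgue. V x) \<ge> \<rho>)"

text \<open>For \<open>V \<in> L\<^sup>\<infinity>\<close> the product is again square-integrable and independent of the representative.\<close>

definition mult_operator :: "('a::euclidean_space \<Rightarrow> real) \<Rightarrow> 'a L2 \<Rightarrow> 'a L2"
  where "mult_operator V g = abs_L2 (\<lambda>x. complex_of_real (V x) * rep_L2 g x)"

definition control_operator ::
    "'a::euclidean_space L2 set \<Rightarrow> ('a \<Rightarrow> real) \<Rightarrow> 'a L2 \<Rightarrow> 'a L2"
  where "control_operator M V g = orth_proj M (mult_operator V g)"

text \<open>The Bochner space \<open>L\<^sup>r((0,T);M)\<close> of \<open>M\<close>-valued functions. As \<open>L\<^sup>2\<close> is separable,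
  Borel measurability is strong measurability.\<close>

definition Lr_space :: "ereal \<Rightarrow> real \<Rightarrow> 'b::{banach, second_countable_topology} set \<Rightarrow> (real \<Rightarrow> 'b) set"
  where "Lr_space r T M = {u \<in> borel_measurable (lebesgue_on {0<..<T}).
    (\<forall>t\<in>{0<..<T}. u t \<in> M) \<and>
    (if r = \<infinity> then \<exists>C. AE t in lebesgue_on {0<..<T}. norm (u t) \<le> C
     else integrable (lebesgue_on {0<..<T}) (\<lambda>t. norm (u t) powr real_of_ereal r))}"

definition Lr_norm :: "ereal \<Rightarrow> real \<Rightarrow> (real \<Rightarrow> 'b::{banach, second_countable_topology}) \<Rightarrow> real"
  where "Lr_norm r T u =
    (if r = \<infinity> then Inf {C. 0 \<le> C \<and> (AE t in lebesgue_on {0<..<T}. norm (u t) \<le> C)}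
     else (LINT t|lebesgue_on {0<..<T}. norm (u t) powr real_of_ereal r) powr (1 / real_of_ereal r))"

definition solution ::
    "'a::euclidean_space L2 set \<Rightarrow> 'a operator \<Rightarrow> ('a \<Rightarrow> real) \<Rightarrow> 'a L2 \<Rightarrow> (real \<Rightarrow> 'a L2) \<Rightarrow> real \<Rightarrow> 'a L2"
  where "solution M H V f\<^sub>0 u t = exp_semigroup M H t f\<^sub>0 +
    (LINT s|lebesgue_on {0<..<t}. exp_semigroup M H (t - s) (control_operator M V (u s)))"

definition cost_uniformly_controllable ::
    "'a::euclidean_space L2 set \<Rightarrow> 'a operator \<Rightarrow> ('a \<Rightarrow> real) \<Rightarrow> real \<Rightarrow> real \<Rightarrow> ereal \<Rightarrow> real \<Rightarrow> bool"
  where "cost_uniformly_controllable M H V \<alpha> T r K \<longleftrightarrow>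
    (\<forall>f\<^sub>0\<in>M. \<exists>u\<in>Lr_space r T M.
      norm (solution M H V f\<^sub>0 u T) \<le> \<alpha> * norm f\<^sub>0 \<and> Lr_norm r T u \<le> K * norm f\<^sub>0)"

end

theory Submission
  imports Defs
begin

text \<open>The control is the feedback \<open>u(t) = - f(t)\<close> along the closed loop
  \<open>f(t) = e\<^bsup>-t(H + B)\<^esup> f\<^sub>0\<close>, where \<open>B\<close> is the control operator: by Duhamel's formula the solution
  of the control problem for this \<open>u\<close> is \<open>f\<close> itself. Since \<open>H + B \<ge> \<delta> > 0\<close>, both \<open>f\<close> and \<open>u\<close> decay
  like \<open>e\<^bsup>-\<delta>t\<^esup>\<close>, which bounds all \<open>L\<^sup>r\<close> norms of \<open>u\<close> independently of \<open>T\<close> and \<open>r\<close>.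

  The spectral gap comes from thickness by averaging over translations: replacing \<open>u(y)\<close> by
  \<open>u(y + h)\<close> costs at most \<open>\<bar>h\<bar> \<parallel>\<nabla>u\<parallel>\<close> in \<open>L\<^sup>2\<close>, and the mean of \<open>V(y + h)\<close> over \<open>h \<in> (0, R)\<^sup>d\<close> is at
  least \<open>\<rho>\<close>. Hence \<open>\<rho> \<parallel>u\<parallel>\<^sup>2 \<le> 2 \<integral> V \<bar>u\<bar>\<^sup>2 + 2 \<parallel>V\<parallel>\<^sub>\<infinity> R\<^sup>2 d \<parallel>\<nabla>u\<parallel>\<^sup>2\<close>, without Poincare inequalities on
  cubes. The semigroups of \<open>H\<close> and \<open>H + B\<close> are limits of implicit Euler steps.\<close>

section \<open>Resolvents of monotone operators in a real Hilbert space\<close>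

text \<open>Two obstacles shape the development. \<open>exp_semigroup\<close> is a choice among all
  semigroups generated by -H, so Duhamel's formula has to compare an arbitrary such semigroup with
  the Euler semigroup of H + B; both enter through their generators on the common domain of H, and
  the local bound required of the chosen one comes from uniform boundedness. Moreover, monotonicity
  and orthogonality are handled with the real part of the inner product, and complex scalars return
  later as continuous maps that preserve the graph and hence commute with resolvents and semigroups.
  The constants: let C bound V, let d be the dimension, D the Dirichlet energy of u and I = <u, V
  u>. Thickness gives \<rho> |u|^2 \<le> 2 I + 2 C R^2 d D, while the form of H + B is at least
  \<eta> D + I. Hence \<delta> = \<rho> / (2 + 2 C R^2 d / \<eta>). The time T_0 solves
  exp(-\<delta> T_0) = \<alpha>, and K = max 1 (1/\<delta>) dominates (1/\<delta>)^(1/r) for every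
  finite r, the value 1 serving r = \<infinity>.\<close>

lemma hilbert_projection_ex:
  fixes S :: "'b::{real_inner,banach} set"
  assumes "closed S" "subspace S"
  obtains p where "p \<in> S" "\<And>m. m \<in> S \<Longrightarrow> m \<bullet> (x - p) = 0"
proof -
  define d where "d = infdist x S"
  have "S \<noteq> {}" using subspace_0[OF assms(2)] by blast
  have d_le: "d \<le> norm (x - q)" if "q \<in> S" for q
    using infdist_le[OF that, of x] by (simp add: d_def dist_norm)
  have "d \<ge> 0" by (simp add: d_def infdist_nonneg)
  have "\<exists>q\<in>S. norm (x - q) < d + 1 / real (Suc n)" for n
  proof -
    have "\<exists>a\<in>S. dist x a < d + 1 / real (Suc n)"
      using cInf_lessD[of "dist x ` S" "d + 1 / real (Suc n)"] \<open>S \<noteq> {}\<close>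
      unfolding d_def infdist_def by auto
    then show ?thesis by (simp add: dist_norm)
  qed
  then obtain p where pS: "\<And>n. p n \<in> S" and pd: "\<And>n. norm (x - p n) < d + 1 / real (Suc n)"
    by metis
  have dlim: "(\<lambda>n. norm (x - p n)) \<longlonglongrightarrow> d"
  proof (rule tendsto_sandwich[OF _ _ tendsto_const])
    show "(\<lambda>n. d + 1 / real (Suc n)) \<longlonglongrightarrow> d"
      using tendsto_add[OF tendsto_const LIMSEQ_inverse_real_of_nat, of d] by (simp add: inverse_eq_divide)
  qed (use d_le pS pd in \<open>auto intro!: always_eventually less_imp_le\<close>)
  \<comment> \<open>Parallelogram law for \<open>x - p m\<close> and \<open>x - p n\<close>; their
    mean is \<open>x\<close> minus the midpoint, which lies in \<open>S\<close> and so has distance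
    at least \<open>d\<close> from \<open>x\<close>.\<close>
  have par: "(norm (p m - p n))\<^sup>2 \<le> 2 * ((norm (x - p m))\<^sup>2 - d\<^sup>2) + 2 * ((norm (x - p n))\<^sup>2 - d\<^sup>2)" for m n
  proof -
    have "(1/2) *\<^sub>R (p m + p n) \<in> S" using pS assms(2) by (intro subspace_scale subspace_add)
    then have "d\<^sup>2 \<le> (norm (x - (1/2) *\<^sub>R (p m + p n)))\<^sup>2"
      using d_le \<open>d \<ge> 0\<close> by (intro power_mono) auto
    moreover have "(norm (p m - p n))\<^sup>2 + 4 * (norm (x - (1/2) *\<^sub>R (p m + p n)))\<^sup>2
        = 2 * (norm (x - p m))\<^sup>2 + 2 * (norm (x - p n))\<^sup>2"
      unfolding power2_norm_eq_inner by (simp add: algebra_simps inner_commute)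
    ultimately show ?thesis unfolding right_diff_distrib by linarith
  qed
  have "Cauchy p"
  proof (rule metric_CauchyI)
    fix e :: real assume "e > 0"
    have "(\<lambda>n. (norm (x - p n))\<^sup>2) \<longlonglongrightarrow> d\<^sup>2" by (intro tendsto_intros dlim)
    then have "eventually (\<lambda>n. (norm (x - p n))\<^sup>2 < d\<^sup>2 + e\<^sup>2/4) sequentially"
      using \<open>e > 0\<close> by (intro order_tendstoD) auto
    then obtain N where N: "\<And>n. n \<ge> N \<Longrightarrow> (norm (x - p n))\<^sup>2 < d\<^sup>2 + e\<^sup>2/4"
      by (auto simp: eventually_sequentially)
    have "dist (p m) (p n) < e" if "m \<ge> N" "n \<ge> N" for m n
    proof -
      have "(norm (p m - p n))\<^sup>2 < e\<^sup>2" using par[of m n] N[OF that(1)] N[OF that(2)] by argo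
      then show ?thesis using \<open>e > 0\<close> by (simp add: dist_norm power_less_imp_less_base)
    qed
    then show "\<exists>N. \<forall>m\<ge>N. \<forall>n\<ge>N. dist (p m) (p n) < e" by blast
  qed
  then obtain q where q: "p \<longlonglongrightarrow> q" using Cauchy_convergent_iff convergent_def by blast
  have qS: "q \<in> S" using \<open>closed S\<close> pS q by (auto simp: closed_sequential_limits)
  have "(\<lambda>n. norm (x - p n)) \<longlonglongrightarrow> norm (x - q)" by (intro tendsto_intros q)
  then have qd: "norm (x - q) = d" using dlim LIMSEQ_unique by blast
  have "m \<bullet> (x - q) = 0" if m: "m \<in> S" for m
  proof (cases "m = 0")
    case False
    define c where "c = m \<bullet> (x - q)"
    \<comment> \<open>This \<open>t\<close> minimises the distance from \<open>x\<close> to the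
      points \<open>q + t *\<^sub>R m\<close>; there the squared distance drops by
      \<open>c\<^sup>2 / (norm m)\<^sup>2\<close>, which the minimality of \<open>q\<close> forbids
      unless \<open>c = 0\<close>.\<close>
    define t where "t = c / (norm m)\<^sup>2"
    have "q + t *\<^sub>R m \<in> S" using qS m assms(2) by (intro subspace_add subspace_scale)
    then have "(norm (x - q))\<^sup>2 \<le> (norm (x - (q + t *\<^sub>R m)))\<^sup>2"
      using d_le qd by (intro power_mono) auto
    also have "\<dots> = (norm (x - q))\<^sup>2 - 2 * t * c + t\<^sup>2 * (norm m)\<^sup>2"
      unfolding power2_norm_eq_inner c_def by (simp add: algebra_simps inner_commute power2_eq_square)
    also have "\<dots> = (norm (x - q))\<^sup>2 - c\<^sup>2 / (norm m)\<^sup>2"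
      using False by (simp add: t_def power2_eq_square field_simps)
    finally have "c\<^sup>2 / (norm m)\<^sup>2 \<le> 0" by simp
    then have "c = 0" using False by (simp add: divide_le_0_iff)
    then show ?thesis by (simp add: c_def)
  qed simp
  with qS show ?thesis by (rule that)
qed

text \<open>Minty's range condition in the self-adjoint case. The range of 1 + lA is closed because
  1 + lA is expansive and \<open>A\<close> is closed, and a vector q orthogonal to it satisfies A q
  = - q / l, which monotonicity rules out unless q = 0. Together \<open>sym\<close> and
  \<open>max\<close> say that \<open>A\<close> equals its adjoint with respect to the real inner
  product.\<close>

lemma maximal_monotone_if_selfadjoint:
  fixes M :: "'b::{real_inner,banach} set"
  assumes M: "closed M" "subspace M" and A: "A \<subseteq> M \<times> M" "subspace A"
    and sym: "\<And>f f' g g'. (f, f') \<in> A \<Longrightarrow> (g, g') \<in> A \<Longrightarrow> g \<bullet> f' = g' \<bullet> f"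
    and max: "\<And>g g'. g \<in> M \<Longrightarrow> g' \<in> M \<Longrightarrow> (\<And>f f'. (f, f') \<in> A \<Longrightarrow> g \<bullet> f' = g' \<bullet> f) \<Longrightarrow> (g, g') \<in> A"
    and mono: "\<And>f f'. (f, f') \<in> A \<Longrightarrow> 0 \<le> f \<bullet> f'"
    and l: "l > 0" and g: "g \<in> M"
  shows "\<exists>(f, f')\<in>A. f + l *\<^sub>R f' = g"
proof -
  define S where "S = (\<lambda>(f, f'). f + l *\<^sub>R f') ` A"
  have lin: "linear (\<lambda>(f, f'). f + l *\<^sub>R f' :: 'b)"
    by (rule linearI) (auto simp: algebra_simps)
  have subS: "subspace S" unfolding S_def by (rule linear_subspace_image[OF lin A(2)])
  have SM: "S \<subseteq> M" using A M by (auto simp: S_def intro!: subspace_add subspace_scale)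
  have bound: "norm f \<le> norm (f + l *\<^sub>R f')" if "(f, f') \<in> A" for f f'
  proof -
    have "norm f ^ 2 \<le> norm f ^ 2 + l * (f \<bullet> f')" using mono[OF that] l by simp
    also have "\<dots> = f \<bullet> (f + l *\<^sub>R f')" by (simp add: inner_add_right power2_norm_eq_inner)
    also have "\<dots> \<le> norm f * norm (f + l *\<^sub>R f')" by (rule norm_cauchy_schwarz)
    finally have "norm f * norm f \<le> norm f * norm (f + l *\<^sub>R f')" by (simp add: power2_eq_square)
    then show ?thesis by (cases "norm f = 0") auto
  qed
  have "closed S"
    unfolding closed_sequential_limits
  proof (intro allI impI, elim conjE)
    fix y z assume y: "\<forall>n. y n \<in> S" and yz: "y \<longlonglongrightarrow> z"
    then have "\<forall>n. \<exists>f f'. (f, f') \<in> A \<and> y n = f + l *\<^sub>R f'" by (force simp: S_def)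
    then obtain f f' where f: "\<And>n. (f n, f' n) \<in> A" "\<And>n. y n = f n + l *\<^sub>R f' n" by metis
    have "Cauchy f"
    proof (rule metric_CauchyI)
      fix e :: real assume "e > 0"
      then obtain N where N: "\<And>m n. m \<ge> N \<Longrightarrow> n \<ge> N \<Longrightarrow> dist (y m) (y n) < e"
        using metric_CauchyD[OF LIMSEQ_imp_Cauchy[OF yz]] by blast
      have "dist (f m) (f n) \<le> dist (y m) (y n)" for m n
      proof -
        have "(f m - f n, f' m - f' n) \<in> A" using subspace_diff[OF A(2) f(1)[of m] f(1)[of n]] by simp
        from bound[OF this] show ?thesis by (simp add: dist_norm f(2) algebra_simps)
      qed
      with N show "\<exists>N. \<forall>m\<ge>N. \<forall>n\<ge>N. dist (f m) (f n) < e" by (meson order_le_less_trans)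
    qed
    then obtain h where h: "f \<longlonglongrightarrow> h" using Cauchy_convergent_iff convergent_def by blast
    have "(\<lambda>n. (1/l) *\<^sub>R (y n - f n)) \<longlonglongrightarrow> (1/l) *\<^sub>R (z - h)" by (intro tendsto_intros yz h)
    then have h': "f' \<longlonglongrightarrow> (1/l) *\<^sub>R (z - h)" using l by (simp add: f(2))
    \<comment> \<open>Closedness of an adjoint: the identity tested against \<open>(g, g')\<close>
      survives the limit, so \<open>max\<close> places the limit pair in \<open>A\<close>.\<close>
    have "(h, (1/l) *\<^sub>R (z - h)) \<in> A"
    proof (rule max)
      show "h \<in> M" "(1/l) *\<^sub>R (z - h) \<in> M"
        using f(1) h h' A(1) \<open>closed M\<close> unfolding closed_sequential_limits by blast+
      fix g g' assume g: "(g, g') \<in> A"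
      have "(\<lambda>n. f n \<bullet> g') \<longlonglongrightarrow> h \<bullet> g'" "(\<lambda>n. f' n \<bullet> g) \<longlonglongrightarrow> ((1/l) *\<^sub>R (z - h)) \<bullet> g"
        by (intro tendsto_intros h h')+
      moreover have "f n \<bullet> g' = f' n \<bullet> g" for n using sym[OF g f(1)] .
      ultimately show "h \<bullet> g' = ((1/l) *\<^sub>R (z - h)) \<bullet> g" using LIMSEQ_unique by simp
    qed
    then show "z \<in> S" unfolding S_def using l by (intro image_eqI[of _ _ "(h, (1/l) *\<^sub>R (z - h))"]) auto
  qed
  obtain p where p: "p \<in> S" "\<And>m. m \<in> S \<Longrightarrow> m \<bullet> (g - p) = 0"
    using hilbert_projection_ex[OF \<open>closed S\<close> subS] by blast
  define q where "q = g - p"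
  have qM: "q \<in> M" using g p SM M by (auto simp: q_def intro: subspace_diff)
  \<comment> \<open>Orthogonality of \<open>q\<close> to every \<open>f + l *\<^sub>R f'\<close> is
    the adjoint identity for the pair (q, - q / l); monotonicity of this pair then forces
    \<open>q \<bullet> q \<le> 0\<close>.\<close>
  have "(q, - (1/l) *\<^sub>R q) \<in> A"
  proof (rule max)
    show "q \<in> M" by (rule qM)
    show "- (1/l) *\<^sub>R q \<in> M" using qM M by (simp only: subspace_scale)
    fix f f' assume "(f, f') \<in> A"
    then have "f + l *\<^sub>R f' \<in> S" by (force simp: S_def)
    from p(2)[OF this] have "l * (q \<bullet> f') = - (f \<bullet> q)"
      by (simp add: q_def[symmetric] inner_add_right inner_commute)
    then show "q \<bullet> f' = (- (1/l) *\<^sub>R q) \<bullet> f" using l by (simp add: field_simps inner_commute)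
  qed
  from mono[OF this] have "q \<bullet> q \<le> 0" using l by (simp add: mult_le_0_iff zero_le_mult_iff divide_le_0_iff)
  then have "q = 0" by (metis inner_gt_zero_iff not_less)
  then have "g \<in> S" using p(1) by (simp add: q_def)
  then show ?thesis by (auto simp: S_def)
qed

text \<open>One setting for both semigroups: it is used with \<open>\<delta> = 0\<close> for H and
  with the positive spectral gap for H + B. The range condition \<open>surj\<close> for all l > 0
  allows implicit Euler steps of any size.\<close>

locale maximal_monotone =
  fixes M :: "'b::{real_inner,banach} set" and A :: "('b \<times> 'b) set" and \<delta> :: real
  assumes closed_M: "closed M" and subspace_M: "subspace M"
    and A_sub: "A \<subseteq> M \<times> M" and subspace_A: "subspace A" and \<delta>_nonneg: "\<delta> \<ge> 0"
    and mono: "\<And>f f'. (f, f') \<in> A \<Longrightarrow> \<delta> * (norm f)\<^sup>2 \<le> f \<bullet> f'"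
    and dense: "M \<subseteq> closure (Domain A)"
    and surj: "\<And>l g. l > 0 \<Longrightarrow> g \<in> M \<Longrightarrow> \<exists>(f, f')\<in>A. f + l *\<^sub>R f' = g"
begin

lemma A_in: "(f, f') \<in> A \<Longrightarrow> f \<in> M" "(f, f') \<in> A \<Longrightarrow> f' \<in> M"
  using A_sub by auto

lemma A_add: "(f, f') \<in> A \<Longrightarrow> (g, g') \<in> A \<Longrightarrow> (f + g, f' + g') \<in> A"
  and A_diff: "(f, f') \<in> A \<Longrightarrow> (g, g') \<in> A \<Longrightarrow> (f - g, f' - g') \<in> A"
  and A_scaleR: "(f, f') \<in> A \<Longrightarrow> (c *\<^sub>R f, c *\<^sub>R f') \<in> A"
  using subspace_add[OF subspace_A] subspace_diff[OF subspace_A] subspace_scale[OF subspace_A]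
  by fastforce+

lemma M_add: "f \<in> M \<Longrightarrow> g \<in> M \<Longrightarrow> f + g \<in> M"
  and M_diff: "f \<in> M \<Longrightarrow> g \<in> M \<Longrightarrow> f - g \<in> M"
  and M_scaleR: "f \<in> M \<Longrightarrow> c *\<^sub>R f \<in> M"
  using subspace_M by (auto intro: subspace_add subspace_diff subspace_scale)

lemma M_lim: "(\<And>n. F n \<in> M) \<Longrightarrow> F \<longlonglongrightarrow> f \<Longrightarrow> f \<in> M"
  using closed_M by (auto simp: closed_sequential_limits)

text \<open>Cauchy-Schwarz applied to \<open>f \<bullet> (f + l *\<^sub>R f')\<close>. The estimate
  yields uniqueness in the resolvent equation and, through the factor
  \<open>1 + l * \<delta>\<close>, the decay of the semigroup.\<close>

lemma expansive:
  assumes "(f, f') \<in> A" "l \<ge> 0"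
  shows "(1 + l * \<delta>) * norm f \<le> norm (f + l *\<^sub>R f')"
proof -
  have "(1 + l * \<delta>) * norm f ^ 2 \<le> norm f ^ 2 + l * (f \<bullet> f')"
    using mult_left_mono[OF mono[OF assms(1)] assms(2)] by (simp add: algebra_simps)
  also have "\<dots> = f \<bullet> (f + l *\<^sub>R f')" by (simp add: inner_add_right power2_norm_eq_inner)
  also have "\<dots> \<le> norm f * norm (f + l *\<^sub>R f')" by (rule norm_cauchy_schwarz)
  finally have "norm f * ((1 + l * \<delta>) * norm f) \<le> norm f * norm (f + l *\<^sub>R f')"
    by (simp add: power2_eq_square mult_ac)
  then show ?thesis by (cases "norm f = 0") auto
qed

text \<open>\<open>J l = (1 + lA)\<^sup>-\<^sup>1\<close>; the convention \<open>J 0 = id\<close> removes the case distinction at time zero.\<close>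

definition J :: "real \<Rightarrow> 'b \<Rightarrow> 'b"
  where "J l g = (if l > 0 then SOME f. \<exists>f'. (f, f') \<in> A \<and> f + l *\<^sub>R f' = g else g)"

lemma J_0 [simp]: "J 0 g = g" by (simp add: J_def)

lemma J_unique:
  assumes "(f, f') \<in> A" "l \<ge> 0"
  shows "J l (f + l *\<^sub>R f') = f"
proof (cases "l = 0")
  case False
  then have l: "l > 0" using assms(2) by simp
  define h where "h = J l (f + l *\<^sub>R f')"
  have "\<exists>h'. (h, h') \<in> A \<and> h + l *\<^sub>R h' = f + l *\<^sub>R f'"
    unfolding h_def J_def using l by simp (rule someI[of _ f], use assms in blast)
  then obtain h' where h': "(h, h') \<in> A" "h + l *\<^sub>R h' = f + l *\<^sub>R f'" by blast
  have "(1 + l * \<delta>) * norm (h - f) \<le> norm (h - f + l *\<^sub>R (h' - f'))"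
    by (rule expansive[OF A_diff[OF h'(1) assms(1)] assms(2)])
  also have "h - f + l *\<^sub>R (h' - f') = 0" using h'(2) by (simp add: algebra_simps)
  finally have "(1 + l * \<delta>) * norm (h - f) \<le> 0" by simp
  moreover have "1 + l * \<delta> > 0" using l \<delta>_nonneg by (simp add: add_pos_nonneg)
  ultimately have "h = f" by (simp add: mult_le_0_iff)
  then show ?thesis by (simp add: h_def)
qed simp

lemma J_E:
  assumes "l > 0" "g \<in> M"
  obtains f' where "(J l g, f') \<in> A" "J l g + l *\<^sub>R f' = g"
proof -
  obtain f f' where f: "(f, f') \<in> A" "f + l *\<^sub>R f' = g" using surj[OF assms] by blast
  then have "J l g = f" using J_unique[of f f' l] assms by simp
  then show ?thesis using f that by blast
qed

lemma J_in: assumes "l \<ge> 0" "g \<in> M" shows "J l g \<in> M"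
proof (cases "l = 0")
  case False
  then show ?thesis using J_E[of l g] assms A_in by (metis order_less_le)
qed (use assms in simp)

lemma J_norm:
  assumes "l \<ge> 0" "g \<in> M" shows "norm (J l g) \<le> norm g / (1 + l * \<delta>)"
proof (cases "l = 0")
  case False
  then obtain f' where f': "(J l g, f') \<in> A" "J l g + l *\<^sub>R f' = g"
    using J_E[of l g] assms by (metis order_less_le)
  have "1 + l * \<delta> > 0" using assms \<delta>_nonneg by (simp add: add_pos_nonneg)
  then show ?thesis using expansive[OF f'(1) assms(1)] f'(2) by (simp add: field_simps)
qed simp

lemma J_contr:
  assumes "l \<ge> 0" "g \<in> M" shows "norm (J l g) \<le> norm g"
proof -
  have "norm g / (1 + l * \<delta>) \<le> norm g / 1"
    using assms \<delta>_nonneg by (intro divide_left_mono) (auto simp: add_pos_nonneg)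
  then show ?thesis using J_norm[OF assms] by simp
qed

text \<open>Applying \<open>U\<close> to the resolvent equation for \<open>g\<close> gives the one
  for \<open>U g\<close>, whose solution is unique. The role of \<open>U\<close> is played by real
  and complex scalars and by another resolvent.\<close>

lemma J_commute:
  assumes U: "\<And>f f' c. (f, f') \<in> A \<Longrightarrow> U (f + c *\<^sub>R f') = U f + c *\<^sub>R U f'"
    "\<And>f f'. (f, f') \<in> A \<Longrightarrow> (U f, U f') \<in> A"
    and l: "l \<ge> 0" and g: "g \<in> M"
  shows "J l (U g) = U (J l g)"
proof (cases "l = 0")
  case False
  then obtain f' where f': "(J l g, f') \<in> A" "J l g + l *\<^sub>R f' = g"
    using J_E[of l g] l g by (metis order_less_le)
  have "J l (U g) = J l (U (J l g) + l *\<^sub>R U f')" by (metis f' U(1))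
  also have "\<dots> = U (J l g)" by (rule J_unique[OF U(2)[OF f'(1)] l])
  finally show ?thesis .
qed simp

lemma J_add:
  assumes "l \<ge> 0" "g \<in> M" "h \<in> M" shows "J l (g + h) = J l g + J l h"
proof (cases "l = 0")
  case False
  then obtain g' h' where *: "(J l g, g') \<in> A" "J l g + l *\<^sub>R g' = g"
      "(J l h, h') \<in> A" "J l h + l *\<^sub>R h' = h"
    using J_E[of l] assms by (metis order_less_le)
  have "g + h = (J l g + l *\<^sub>R g') + (J l h + l *\<^sub>R h')" by (simp add: *)
  also have "\<dots> = J l g + J l h + l *\<^sub>R (g' + h')" by (simp add: algebra_simps)
  finally have "g + h = J l g + J l h + l *\<^sub>R (g' + h')" .
  then show ?thesis using J_unique[OF A_add[OF *(1,3)] assms(1)] by simp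
qed simp

lemma J_scaleR:
  assumes "l \<ge> 0" "g \<in> M" shows "J l (c *\<^sub>R g) = c *\<^sub>R J l g"
  by (rule J_commute[where U = "\<lambda>x. c *\<^sub>R x"]) (auto simp: algebra_simps A_scaleR assms)

lemma J_diff:
  assumes "l \<ge> 0" "g \<in> M" "h \<in> M" shows "J l (g - h) = J l g - J l h"
  using J_add[of l g "(-1) *\<^sub>R h"] J_scaleR[of l h "-1"] assms M_scaleR[of h "-1"] by simp

text \<open>Both A (J f) and J (A f) equal h' = (f - J f) / l: the former by the resolvent equation,
  the latter because \<open>h'\<close> together with (f' - h') / l solves the resolvent equation for
  \<open>f'\<close>.\<close>

lemma J_A:
  assumes "(f, f') \<in> A" "l \<ge> 0" shows "(J l f, J l f') \<in> A"
proof (cases "l = 0")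
  case False
  then have l: "l > 0" using assms by simp
  obtain h' where h: "(J l f, h') \<in> A" "J l f + l *\<^sub>R h' = f"
    using J_E[OF l] A_in assms by metis
  then have h': "h' = (1/l) *\<^sub>R (f - J l f)" 
  proof -
    have "f - J l f = l *\<^sub>R h'" by (metis h(2) add_diff_cancel_left')
    then show ?thesis using l by simp
  qed
  have "((1/l) *\<^sub>R (f - J l f), (1/l) *\<^sub>R (f' - h')) \<in> A"
    by (intro A_scaleR A_diff h assms)
  from J_unique[OF this, of l] have "J l f' = h'" using l by (simp flip: h')
  then show ?thesis using h by simp
qed (use assms in simp)

lemma J_J:
  assumes "a \<ge> 0" "b \<ge> 0" "g \<in> M" shows "J a (J b g) = J b (J a g)"
proof (rule J_commute[where U = "J b"])
  fix f f' c assume "(f, f') \<in> A"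
  then show "J b (f + c *\<^sub>R f') = J b f + c *\<^sub>R J b f'"
    using assms A_in M_scaleR by (metis J_add J_scaleR)
qed (use assms J_A in auto)

text \<open>The resolvent equation gives J f - f = - l J (A f), and J is a contraction. On the
  domain of A one Euler step thus moves by O(l).\<close>

lemma J_close:
  assumes "(f, f') \<in> A" "l \<ge> 0" shows "norm (J l f - f) \<le> l * norm f'"
proof -
  have *: "f = J l (f + l *\<^sub>R f')" using J_unique assms by simp
  have "J l f - f = - l *\<^sub>R J l f'"
    using J_add[of l f "l *\<^sub>R f'"] J_scaleR[of l f' l] assms A_in M_scaleR * by (simp add: algebra_simps)
  then show ?thesis using J_contr[of l f'] assms A_in by (simp add: mult_left_mono)
qed

text \<open>\<open>J a J b - J (a + b) = - ab J a J b J (a + b) A\<^sup>2\<close>, because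
  \<open>(1 + aA) (1 + bA) = 1 + (a + b) A + ab A\<^sup>2\<close>.\<close>

lemma J_split_error:
  assumes x: "(x, x1) \<in> A" "(x1, x2) \<in> A" and ab: "a \<ge> 0" "b \<ge> 0"
  shows "norm (J a (J b x) - J (a + b) x) \<le> a * b * norm x2"
proof -
  have M: "x \<in> M" "x1 \<in> M" "x2 \<in> M" using x A_in by auto
  define y where "y = J (a + b) x"
  define y1 where "y1 = J (a + b) x1"
  define y2 where "y2 = J (a + b) x2"
  have y: "(y, y1) \<in> A" "(y1, y2) \<in> A" unfolding y_def y1_def y2_def using x ab by (auto intro!: J_A)
  have yM: "y \<in> M" "y1 \<in> M" "y2 \<in> M" using y A_in by auto
  \<comment> \<open>The resolvent equation for \<open>y\<close>, where A y = \<open>y1\<close>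
    because the resolvent commutes with A.\<close>
  have "x = y + (a + b) *\<^sub>R y1"
  proof (cases "a + b = 0")
    case False
    then obtain h where h: "(J (a + b) x, h) \<in> A" "J (a + b) x + (a + b) *\<^sub>R h = x"
      using J_E[of "a + b" x] ab M by (metis add_nonneg_nonneg order_less_le)
    have "y1 = h"
    proof -
      have "J (a + b) (x + (a + b) *\<^sub>R x1) = x" using J_unique[OF x(1)] ab by simp
      then have "y + (a + b) *\<^sub>R y1 = x"
        unfolding y_def y1_def using J_add[of "a + b" x "(a + b) *\<^sub>R x1"] J_scaleR[of "a + b" x1 "a + b"] ab M M_scaleR
        by simp
      then show ?thesis using h(2) False unfolding y_def by (metis add_left_cancel real_vector.scale_left_imp_eq)
    qed
    then show ?thesis using h by (simp add: y_def)
  qed (simp add: y_def)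
  \<comment> \<open>The argument is (1 + bA)(1 + aA) y, so \<open>J b\<close> and then
    \<open>J a\<close> undo the two factors. By the previous equation it equals
    \<open>x + (a * b) *\<^sub>R y2\<close>, from which the error is read off.\<close>
  moreover have "J a (J b (y + (a + b) *\<^sub>R y1 + (a * b) *\<^sub>R y2)) = y"
  proof -
    have "y + (a + b) *\<^sub>R y1 + (a * b) *\<^sub>R y2 = (y + a *\<^sub>R y1) + b *\<^sub>R (y1 + a *\<^sub>R y2)"
      by (simp add: algebra_simps)
    moreover have "(y + a *\<^sub>R y1, y1 + a *\<^sub>R y2) \<in> A" by (intro A_add A_scaleR y)
    ultimately have "J b (y + (a + b) *\<^sub>R y1 + (a * b) *\<^sub>R y2) = y + a *\<^sub>R y1"
      using J_unique[of "y + a *\<^sub>R y1" "y1 + a *\<^sub>R y2" b] ab by (simp only:)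
    then show ?thesis using J_unique[OF y(1) ab(1)] by simp
  qed
  ultimately have "y = J a (J b (x + (a * b) *\<^sub>R y2))" by metis
  then have "y = J a (J b x) + (a * b) *\<^sub>R J a (J b y2)"
    using ab M yM M_scaleR J_in by (simp add: J_add J_scaleR)
  then have "J a (J b x) - J (a + b) x = - (a * b) *\<^sub>R J a (J b y2)"
    unfolding y_def by (simp add: algebra_simps)
  then have "norm (J a (J b x) - J (a + b) x) = a * b * norm (J a (J b y2))" using ab by simp
  also have "norm (J a (J b y2)) \<le> norm x2"
    using J_contr[OF ab(1) J_in[OF ab(2) yM(3)]] J_contr[OF ab(2) yM(3)] J_contr[of "a + b" x2] ab M
    by (simp add: y2_def)
  finally show ?thesis using ab by (simp add: mult_left_mono)
qed

section \<open>Powers of the resolvent\<close>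

lemma J_pow_in: "l \<ge> 0 \<Longrightarrow> g \<in> M \<Longrightarrow> (J l ^^ n) g \<in> M"
  by (induction n) (auto intro: J_in)

lemma J_pow_norm: "l \<ge> 0 \<Longrightarrow> g \<in> M \<Longrightarrow> norm ((J l ^^ n) g) \<le> norm g / (1 + l * \<delta>) ^ n"
proof (induction n)
  case (Suc n)
  have p: "1 + l * \<delta> > 0" using Suc.prems \<delta>_nonneg by (simp add: add_pos_nonneg)
  have "norm ((J l ^^ Suc n) g) \<le> norm ((J l ^^ n) g) / (1 + l * \<delta>)"
    using J_norm[OF Suc.prems(1) J_pow_in[OF Suc.prems]] by simp
  also have "\<dots> \<le> norm g / (1 + l * \<delta>) ^ n / (1 + l * \<delta>)"
    using Suc p by (intro divide_right_mono) auto
  finally show ?case by (simp add: mult.commute)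
qed simp

lemma J_pow_contr: "l \<ge> 0 \<Longrightarrow> g \<in> M \<Longrightarrow> norm ((J l ^^ n) g) \<le> norm g"
  by (induction n) (auto intro: order_trans[OF J_contr] J_pow_in)

lemma J_pow_add: "l \<ge> 0 \<Longrightarrow> g \<in> M \<Longrightarrow> h \<in> M \<Longrightarrow> (J l ^^ n) (g + h) = (J l ^^ n) g + (J l ^^ n) h"
  by (induction n) (simp_all add: J_add J_pow_in)

lemma J_pow_scaleR: "l \<ge> 0 \<Longrightarrow> g \<in> M \<Longrightarrow> (J l ^^ n) (c *\<^sub>R g) = c *\<^sub>R (J l ^^ n) g"
  by (induction n) (simp_all add: J_scaleR J_pow_in)

lemma J_pow_diff: "l \<ge> 0 \<Longrightarrow> g \<in> M \<Longrightarrow> h \<in> M \<Longrightarrow> (J l ^^ n) (g - h) = (J l ^^ n) g - (J l ^^ n) h"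
  by (induction n) (simp_all add: J_diff J_pow_in)

lemma J_pow_J: "a \<ge> 0 \<Longrightarrow> b \<ge> 0 \<Longrightarrow> g \<in> M \<Longrightarrow> (J a ^^ n) (J b g) = J b ((J a ^^ n) g)"
  by (induction n) (simp_all add: J_J J_pow_in)

text \<open>Telescoping: each further step adds one deviation \<open>J l f - f\<close> to an earlier
  error that is propagated by a contraction, so the total is linear in the elapsed time n l.\<close>

lemma J_pow_close:
  assumes "(f, f') \<in> A" "l \<ge> 0" shows "norm ((J l ^^ n) f - f) \<le> real n * l * norm f'"
proof (induction n)
  case (Suc n)
  have "(J l ^^ Suc n) f - f = J l ((J l ^^ n) f - f) + (J l f - f)"
    using assms A_in J_pow_in by (simp add: J_diff)
  then have "norm ((J l ^^ Suc n) f - f) \<le> norm (J l ((J l ^^ n) f - f)) + norm (J l f - f)"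
    using norm_triangle_ineq by metis
  also have "\<dots> \<le> norm ((J l ^^ n) f - f) + l * norm f'"
    using assms by (intro add_mono J_contr J_close M_diff J_pow_in) (auto dest: A_in)
  also have "\<dots> \<le> real (Suc n) * l * norm f'" using Suc by (simp add: algebra_simps)
  finally show ?case .
qed simp

text \<open>Commuting contractions: the \<open>n\<close>-step error is at most \<open>n\<close> times the one-step error.\<close>

lemma J_split_error_pow:
  assumes x: "(x, x1) \<in> A" "(x1, x2) \<in> A" and ab: "a \<ge> 0" "b \<ge> 0"
  shows "norm ((J a ^^ n) ((J b ^^ n) x) - (J (a + b) ^^ n) x) \<le> real n * (a * b * norm x2)"
  using x
proof (induction n arbitrary: x x1 x2)
  case (Suc n)
  have M: "x \<in> M" "x1 \<in> M" "x2 \<in> M" using Suc.prems A_in by auto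
  define Q where "Q = J (a + b)"
  have Q: "(Q x, Q x1) \<in> A" "(Q x1, Q x2) \<in> A" using Suc.prems ab by (auto simp: Q_def intro!: J_A)
  have QM: "Q x \<in> M" using Q A_in by blast
  have "(J a ^^ Suc n) ((J b ^^ Suc n) x) = (J a ^^ n) ((J b ^^ n) (J a (J b x)))"
    using ab M by (simp add: J_pow_J J_pow_in J_in flip: funpow_swap1)
  moreover have "(J (a + b) ^^ Suc n) x = (Q ^^ n) (Q x)" by (simp add: Q_def funpow_swap1)
  \<comment> \<open>One pair \<open>J a\<close>, \<open>J b\<close> is replaced by
    \<open>Q = J (a + b)\<close> at a time. The first summand is a one-step error under
    contractions; the second is the induction hypothesis at \<open>Q x\<close>, where
    \<open>Q x2\<close> is no longer than \<open>x2\<close>.\<close>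
  ultimately have "(J a ^^ Suc n) ((J b ^^ Suc n) x) - (J (a + b) ^^ Suc n) x
     = (J a ^^ n) ((J b ^^ n) (J a (J b x) - Q x)) + ((J a ^^ n) ((J b ^^ n) (Q x)) - (Q ^^ n) (Q x))"
    using ab M QM by (simp add: J_pow_diff J_pow_in J_in)
  also have "norm \<dots> \<le> norm ((J a ^^ n) ((J b ^^ n) (J a (J b x) - Q x)))
      + norm ((J a ^^ n) ((J b ^^ n) (Q x)) - (Q ^^ n) (Q x))" by (rule norm_triangle_ineq)
  also have "\<dots> \<le> a * b * norm x2 + real n * (a * b * norm x2)"
  proof (rule add_mono)
    have dM: "J a (J b x) - Q x \<in> M" using ab M QM by (intro M_diff J_in)
    have "norm ((J a ^^ n) ((J b ^^ n) (J a (J b x) - Q x))) \<le> norm ((J b ^^ n) (J a (J b x) - Q x))"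
      using ab dM by (intro J_pow_contr J_pow_in)
    also have "\<dots> \<le> norm (J a (J b x) - Q x)" using ab dM by (intro J_pow_contr)
    also have "\<dots> \<le> a * b * norm x2" unfolding Q_def by (rule J_split_error[OF Suc.prems ab])
    finally show "norm ((J a ^^ n) ((J b ^^ n) (J a (J b x) - Q x))) \<le> a * b * norm x2" .
    have "norm ((J a ^^ n) ((J b ^^ n) (Q x)) - (Q ^^ n) (Q x)) \<le> real n * (a * b * norm (Q x2))"
      unfolding Q_def by (rule Suc.IH) (use Q Q_def in auto)
    also have "\<dots> \<le> real n * (a * b * norm x2)"
      using ab M J_contr[of "a + b" x2] by (intro mult_left_mono) (auto simp: Q_def)
    finally show "norm ((J a ^^ n) ((J b ^^ n) (Q x)) - (Q ^^ n) (Q x)) \<le> real n * (a * b * norm x2)" .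
  qed
  finally show ?case by (simp add: algebra_simps)
qed simp

end

section \<open>The contraction semigroup as a limit of implicit Euler steps\<close>

context maximal_monotone
begin

text \<open>Halving the step size changes the result by \<open>O(2\<^bsup>-n\<^esup>)\<close> on the domain of \<open>A\<^sup>2\<close>, so along
  dyadic steps the Euler scheme converges geometrically there, hence everywhere by density.\<close>

definition euler :: "nat \<Rightarrow> real \<Rightarrow> 'b \<Rightarrow> 'b"
  where "euler n t = J (t / 2 ^ n) ^^ (2 ^ n)"

definition E :: "real \<Rightarrow> 'b \<Rightarrow> 'b"
  where "E t x = lim (\<lambda>n. euler n t x)"

definition D2 :: "'b set"
  where "D2 = {x. \<exists>x1 x2. (x, x1) \<in> A \<and> (x1, x2) \<in> A}"

text \<open>For \<open>x\<close> outside the domain the linear estimate is borrowed from a nearby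
  \<open>y\<close>; the detour costs twice the distance \<open>norm (x - y)\<close>. The bound has
  the shape that \<open>tendsto_0_if_close\<close> consumes.\<close>

lemma J_pow_close_M:
  assumes "x \<in> M" "(y, y') \<in> A" "l \<ge> 0"
  shows "norm ((J l ^^ n) x - x) \<le> 2 * norm (x - y) + real n * l * norm y'"
proof -
  have M: "y \<in> M" "x - y \<in> M" using assms A_in M_diff by auto
  have "(J l ^^ n) x - x = (J l ^^ n) (x - y) - (x - y) + ((J l ^^ n) y - y)"
    using J_pow_diff[OF assms(3,1) M(1)] by simp
  also have "norm \<dots> \<le> norm ((J l ^^ n) (x - y)) + norm (x - y) + norm ((J l ^^ n) y - y)"
    by (intro order_trans[OF norm_triangle_ineq] add_right_mono norm_triangle_ineq4)
  finally show ?thesis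
    using J_pow_contr[OF assms(3) M(2), of n] J_pow_close[OF assms(2,3), of n] by simp
qed

text \<open>The order of choices is what counts: \<open>y\<close> in the dense domain makes
  \<open>2 * norm (x - y)\<close> small, and then \<open>t\<close> is chosen against the fixed
  \<open>norm y'\<close>. This serves resolvents, orbits and difference quotients alike.\<close>

lemma tendsto_0_if_close:
  fixes f :: "real \<Rightarrow> 'b"
  assumes "x \<in> M" and f: "\<And>y y' t. (y, y') \<in> A \<Longrightarrow> t > 0 \<Longrightarrow> norm (f t) \<le> 2 * norm (x - y) + t * norm y'"
  shows "(f \<longlongrightarrow> 0) (at_right 0)"
proof (rule tendstoI)
  fix e :: real assume e: "e > 0"
  then obtain y y' where y: "(y, y') \<in> A" "dist y x < e / 4"
    using closure_approachable[of x "Domain A"] dense assms(1)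
    by (metis Domain.cases divide_pos_pos subsetD zero_less_numeral)
  have "((\<lambda>t. t * norm y') \<longlongrightarrow> 0 * norm y') (at_right 0)" by (intro tendsto_intros)
  then have "\<forall>\<^sub>F t in at_right 0. t * norm y' < e / 2" using e by (intro order_tendstoD) auto
  then show "\<forall>\<^sub>F t in at_right 0. dist (f t) 0 < e"
    using eventually_at_right_less[of "0::real"]
  proof eventually_elim
    case (elim t)
    then show ?case using f[OF y(1), of t] y(2) by (simp add: dist_norm norm_minus_commute)
  qed
qed

text \<open>\<open>J l\<close> sends the domain of A into the domain of A^2, and
  \<open>J l y\<close> tends to \<open>y\<close> as l decreases to 0.\<close>

lemma D2_dense:
  assumes "x \<in> M" "e > 0" obtains y where "y \<in> D2" "dist y x < e"
proof -
  obtain y y' where y: "(y, y') \<in> A" "dist y x < e / 2"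
    using closure_approachable[of x "Domain A"] dense assms
    by (metis Domain.cases half_gt_zero subsetD)
  have "((\<lambda>l. J l y - y) \<longlongrightarrow> 0) (at_right 0)"
    using J_pow_close_M[of y _ _ _ 1] A_in[OF y(1)] by (intro tendsto_0_if_close) auto
  then have "\<forall>\<^sub>F l in at_right 0. dist (J l y - y) 0 < e / 2" using assms(2) by (intro tendstoD) auto
  then have "\<forall>\<^sub>F l in at_right 0. l > 0 \<and> dist (J l y - y) 0 < e / 2"
    using eventually_at_right_less[of "0::real"] by eventually_elim simp
  then obtain l where l: "l > 0" "dist (J l y - y) 0 < e / 2"
    using eventually_happens trivial_limit_at_right_real by blast
  obtain z where "(J l y', z) \<in> A" using J_E[OF l(1)] A_in[OF y(1)] by blast
  then have "J l y \<in> D2" using J_A[OF y(1)] l(1) unfolding D2_def by (auto intro: less_imp_le)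
  moreover have "dist (J l y) x < e"
    using l(2) y(2) dist_triangle[of "J l y" x y] by (simp add: dist_norm)
  ultimately show ?thesis by (rule that)
qed

lemma D2_M: "D2 \<subseteq> M" unfolding D2_def using A_in by blast

lemma euler_in: "t \<ge> 0 \<Longrightarrow> x \<in> M \<Longrightarrow> euler n t x \<in> M"
  and euler_contr: "t \<ge> 0 \<Longrightarrow> x \<in> M \<Longrightarrow> norm (euler n t x) \<le> norm x"
  and euler_add: "t \<ge> 0 \<Longrightarrow> x \<in> M \<Longrightarrow> y \<in> M \<Longrightarrow> euler n t (x + y) = euler n t x + euler n t y"
  and euler_diff: "t \<ge> 0 \<Longrightarrow> x \<in> M \<Longrightarrow> y \<in> M \<Longrightarrow> euler n t (x - y) = euler n t x - euler n t y"
  by (simp_all add: euler_def J_pow_in J_pow_contr J_pow_add J_pow_diff)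

text \<open>A step of size t / 2^n is compared with two half steps, that is, a = b = t / 2^(n+1) in
  the splitting estimate. Over 2^n steps the error is 2^n (t / 2^(n+1))^2 |A^2 x|, which is
  geometric in n.\<close>

lemma euler_step:
  assumes "(x, x1) \<in> A" "(x1, x2) \<in> A" "t \<ge> 0"
  shows "norm (euler (Suc n) t x - euler n t x) \<le> t\<^sup>2 * norm x2 / 4 * (1/2) ^ n"
proof -
  let ?h = "t / 2 ^ Suc n"
  have h: "?h \<ge> 0" "?h + ?h = t / 2 ^ n" using assms by auto
  have e1: "euler (Suc n) t x = (J ?h ^^ 2 ^ n) ((J ?h ^^ 2 ^ n) x)"
    unfolding euler_def power_Suc mult_2 funpow_add by simp
  have e2: "euler n t x = (J (?h + ?h) ^^ 2 ^ n) x" unfolding h(2) euler_def ..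
  have "norm (euler (Suc n) t x - euler n t x) \<le> real (2 ^ n) * (?h * ?h * norm x2)"
    unfolding e1 e2 by (rule J_split_error_pow[OF assms(1,2) h(1) h(1)])
  also have "\<dots> = t\<^sup>2 * norm x2 / 4 * (1/2) ^ n"
    by (simp add: field_simps power2_eq_square power_one_over)
  finally show ?thesis .
qed

lemma convergent_if_summable_steps:
  fixes f :: "nat \<Rightarrow> 'c::banach"
  assumes "\<And>n. norm (f (Suc n) - f n) \<le> c * (1/2) ^ n"
  shows "convergent f"
proof -
  have "summable (\<lambda>n. c * (1/2) ^ n)" by (intro summable_mult summable_geometric) simp
  then have "summable (\<lambda>n. f (Suc n) - f n)"
    by (rule summable_comparison_test[rotated]) (use assms in blast)
  then have "convergent (\<lambda>n. f n - f 0)"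
    by (simp add: summable_iff_convergent sum_lessThan_telescope)
  then show ?thesis
    using convergent_add[OF _ convergent_const[of "f 0"]] by fastforce
qed

text \<open>On \<open>D2\<close> the halving errors are summable. For general \<open>x\<close>
  contractivity makes the error of replacing \<open>x\<close> by a nearby \<open>y\<close> uniform
  in \<open>n\<close>, so the Cauchy property passes to the closure.\<close>

lemma euler_convergent:
  assumes "x \<in> M" "t \<ge> 0" shows "(\<lambda>n. euler n t x) \<longlonglongrightarrow> E t x"
proof -
  have "Cauchy (\<lambda>n. euler n t x)"
  proof (rule metric_CauchyI)
    fix e :: real assume e: "e > 0"
    obtain y where y: "y \<in> D2" "dist y x < e / 3" using D2_dense[OF assms(1), of "e/3"] e by auto
    then obtain y1 y2 where yA: "(y, y1) \<in> A" "(y1, y2) \<in> A" by (auto simp: D2_def)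
    have yM: "y \<in> M" using y D2_M by blast
    have "convergent (\<lambda>n. euler n t y)"
      by (rule convergent_if_summable_steps) (rule euler_step[OF yA assms(2)])
    then obtain N where N: "\<And>m n. m \<ge> N \<Longrightarrow> n \<ge> N \<Longrightarrow> dist (euler m t y) (euler n t y) < e / 3"
      using metric_CauchyD[of "\<lambda>n. euler n t y" "e/3"] e by (auto simp: Cauchy_convergent_iff)
    have d: "dist (euler n t x) (euler n t y) < e / 3" for n
      using euler_contr[OF assms(2) M_diff[OF assms(1) yM], of n] y(2)
      by (simp add: dist_norm euler_diff assms yM norm_minus_commute)
    have "dist (euler m t x) (euler n t x) < e" if "m \<ge> N" "n \<ge> N" for m n
      using d[of m] d[of n] N[OF that] dist_triangle[of "euler m t x" "euler n t x" "euler m t y"]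
        dist_triangle[of "euler m t y" "euler n t x" "euler n t y"] by (simp add: dist_commute)
    then show "\<exists>N. \<forall>m\<ge>N. \<forall>n\<ge>N. dist (euler m t x) (euler n t x) < e" by blast
  qed
  then show ?thesis unfolding E_def by (simp add: Cauchy_convergent_iff convergent_LIMSEQ_iff)
qed

section \<open>The limit semigroup: linearity, decay and the semigroup law\<close>

lemma E_in: "t \<ge> 0 \<Longrightarrow> x \<in> M \<Longrightarrow> E t x \<in> M"
  by (rule M_lim[OF euler_in euler_convergent])

lemma E_add:
  assumes "t \<ge> 0" "x \<in> M" "y \<in> M" shows "E t (x + y) = E t x + E t y"
proof (rule LIMSEQ_unique)
  show "(\<lambda>n. euler n t (x + y)) \<longlonglongrightarrow> E t (x + y)" using assms by (intro euler_convergent M_add)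
  show "(\<lambda>n. euler n t (x + y)) \<longlonglongrightarrow> E t x + E t y"
    using assms by (simp add: euler_add tendsto_add euler_convergent)
qed

lemma euler_commute:
  assumes U: "\<And>f f' c. f \<in> M \<Longrightarrow> f' \<in> M \<Longrightarrow> U (f + c *\<^sub>R f') = U f + c *\<^sub>R U f'"
    "\<And>f f'. (f, f') \<in> A \<Longrightarrow> (U f, U f') \<in> A" and t: "t \<ge> 0" and x: "x \<in> M"
  shows "euler n t (U x) = U (euler n t x)"
proof -
  have "J l (U g) = U (J l g)" if "l \<ge> 0" "g \<in> M" for l g
    using J_commute[of U l g] U A_in that by blast
  then have "(J l ^^ k) (U g) = U ((J l ^^ k) g)" if "l \<ge> 0" "g \<in> M" for l g k
    using that by (induction k) (auto simp: J_pow_in)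
  then show ?thesis unfolding euler_def using t x by simp
qed

text \<open>Commutation with the Euler iterates passes to the limit by continuity of
  \<open>U\<close>. It is how complex homogeneity is recovered later, since only the real structure
  is visible in this locale.\<close>

lemma E_commute:
  assumes U: "\<And>f f' c. f \<in> M \<Longrightarrow> f' \<in> M \<Longrightarrow> U (f + c *\<^sub>R f') = U f + c *\<^sub>R U f'"
    "\<And>f f'. (f, f') \<in> A \<Longrightarrow> (U f, U f') \<in> A" and cont: "continuous_on UNIV U"
    and UM: "\<And>f. f \<in> M \<Longrightarrow> U f \<in> M" and t: "t \<ge> 0" and x: "x \<in> M"
  shows "E t (U x) = U (E t x)"
proof (rule LIMSEQ_unique)
  show "(\<lambda>n. euler n t (U x)) \<longlonglongrightarrow> E t (U x)" using assms by (intro euler_convergent) auto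
  have "(\<lambda>n. U (euler n t x)) \<longlonglongrightarrow> U (E t x)"
    by (rule continuous_on_tendsto_compose[OF cont euler_convergent[OF x t]]) auto
  then show "(\<lambda>n. euler n t (U x)) \<longlonglongrightarrow> U (E t x)"
    using euler_commute[OF U t x] by simp
qed

lemma E_scaleR: "t \<ge> 0 \<Longrightarrow> x \<in> M \<Longrightarrow> E t (c *\<^sub>R x) = c *\<^sub>R E t x"
  by (rule E_commute[where U = "\<lambda>x. c *\<^sub>R x"])
    (auto simp: algebra_simps A_scaleR M_scaleR intro!: continuous_intros)

lemma E_diff: "t \<ge> 0 \<Longrightarrow> x \<in> M \<Longrightarrow> y \<in> M \<Longrightarrow> E t (x - y) = E t x - E t y"
  using E_add[of t x "(-1) *\<^sub>R y"] E_scaleR[of t y "-1"] M_scaleR[of y "-1"] by simp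

lemma E_0: "x \<in> M \<Longrightarrow> E 0 x = x"
proof -
  have "(J 0 ^^ n) x = x" for n by (induction n) auto
  then have "(\<lambda>n. euler n 0 x) = (\<lambda>n. x)" by (simp add: euler_def)
  then show ?thesis by (simp add: E_def)
qed

lemma E_norm:
  assumes "t \<ge> 0" "x \<in> M" shows "norm (E t x) \<le> exp (- \<delta> * t) * norm x"
proof (rule LIMSEQ_le)
  show "(\<lambda>n. norm (euler n t x)) \<longlonglongrightarrow> norm (E t x)"
    using assms by (intro tendsto_norm euler_convergent)
  have "filterlim (\<lambda>n. (2::nat) ^ n) at_top sequentially"
    by (rule filterlim_at_top_mono[OF filterlim_ident]) (auto intro!: always_eventually less_imp_le)
  \<comment> \<open>Euler's limit for the exponential along the subsequence N = 2^n: the bound (1 +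
    t \<delta> / N)^(-N) for N resolvent steps becomes exp(-\<delta> t).\<close>
  then have "(\<lambda>n. (1 + (t * \<delta>) / real (2 ^ n)) ^ 2 ^ n) \<longlonglongrightarrow> exp (t * \<delta>)"
    by (rule filterlim_compose[OF tendsto_exp_limit_sequentially])
  then have "(\<lambda>n. norm x / (1 + (t * \<delta>) / real (2 ^ n)) ^ 2 ^ n) \<longlonglongrightarrow> norm x / exp (t * \<delta>)"
    by (intro tendsto_intros) auto
  moreover have "t * \<delta> / real (2 ^ n) = t / 2 ^ n * \<delta>" for n :: nat by simp
  moreover have "norm x / exp (t * \<delta>) = exp (- \<delta> * t) * norm x"
    by (simp add: exp_minus mult.commute divide_inverse)
  ultimately show "(\<lambda>n. norm x / (1 + (t / 2 ^ n) * \<delta>) ^ 2 ^ n) \<longlonglongrightarrow> exp (- \<delta> * t) * norm x"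
    by (simp only:)
  show "\<exists>N. \<forall>n\<ge>N. norm (euler n t x) \<le> norm x / (1 + t / 2 ^ n * \<delta>) ^ 2 ^ n"
    unfolding euler_def using assms by (intro exI allI impI J_pow_norm) auto
qed

lemma E_contr: assumes "t \<ge> 0" "x \<in> M" shows "norm (E t x) \<le> norm x"
proof -
  have "exp (- \<delta> * t) * norm x \<le> 1 * norm x"
    using assms \<delta>_nonneg by (intro mult_right_mono) auto
  then show ?thesis using E_norm[OF assms] by simp
qed

lemma eq_on_M_if_eq_on_D2:
  assumes P: "\<And>x y. x \<in> M \<Longrightarrow> y \<in> M \<Longrightarrow> norm (P x - P y) \<le> norm (x - y)"
    and Q: "\<And>x y. x \<in> M \<Longrightarrow> y \<in> M \<Longrightarrow> norm (Q x - Q y) \<le> norm (x - y)"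
    and eq: "\<And>x. x \<in> D2 \<Longrightarrow> P x = (Q x :: 'b)" and x: "x \<in> M"
  shows "P x = Q x"
proof (rule ccontr)
  assume "P x \<noteq> Q x"
  then have "dist (P x) (Q x) / 2 > 0" by simp
  then obtain y where y: "y \<in> D2" "dist y x < dist (P x) (Q x) / 2" using D2_dense[OF x] by blast
  then have yM: "y \<in> M" using D2_M by blast
  have "norm (P x - Q x) \<le> norm (P x - P y) + norm (Q x - Q y)"
    using eq[OF y(1)] norm_triangle_ineq4[of "P x - P y" "Q x - Q y"] by simp
  then show False using P[OF x yM] Q[OF x yM] y(2) by (simp add: dist_norm norm_minus_commute)
qed

text \<open>Steps a = s / 2^n and b = t / 2^n in the splitting estimate compare
  \<open>euler n s\<close> after \<open>euler n t\<close> with \<open>euler n (s + t)\<close>; the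
  error 2^n a b |A^2 x| = s t |A^2 x| / 2^n vanishes on \<open>D2\<close>. Both sides are
  1-Lipschitz in \<open>x\<close>, so equality extends to \<open>M\<close>.\<close>

lemma E_semigroup:
  assumes s: "s \<ge> 0" and t: "t \<ge> 0" and x: "x \<in> M" shows "E (s + t) x = E s (E t x)"
proof (rule eq_on_M_if_eq_on_D2[OF _ _ _ x])
  fix x y assume xy: "x \<in> M" "y \<in> M"
  show "norm (E (s + t) x - E (s + t) y) \<le> norm (x - y)"
    using E_contr[of "s + t" "x - y"] E_diff[of "s + t" x y] xy s t M_diff by simp
  have "norm (E s (E t x) - E s (E t y)) = norm (E s (E t (x - y)))"
    using s t xy by (simp add: E_diff E_in)
  also have "\<dots> \<le> norm (E t (x - y))" using s t xy by (intro E_contr E_in M_diff)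
  also have "\<dots> \<le> norm (x - y)" using t xy by (intro E_contr M_diff)
  finally show "norm (E s (E t x) - E s (E t y)) \<le> norm (x - y)" .
next
  fix x assume "x \<in> D2"
  then obtain x1 x2 where x: "(x, x1) \<in> A" "(x1, x2) \<in> A" by (auto simp: D2_def)
  have M: "x \<in> M" using x A_in by blast
  have lim: "(\<lambda>n. euler n s (euler n t x) - euler n (s + t) x) \<longlonglongrightarrow> 0"
  proof (rule Lim_null_comparison)
    have "norm (euler n s (euler n t x) - euler n (s + t) x) \<le> (s * t * norm x2) * (1/2) ^ n" for n
    proof -
      have "norm (euler n s (euler n t x) - euler n (s + t) x)
          \<le> real (2 ^ n) * ((s / 2 ^ n) * (t / 2 ^ n) * norm x2)"
        unfolding euler_def add_divide_distrib
        using s t by (intro J_split_error_pow[OF x]) auto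
      also have "\<dots> = (s * t * norm x2) * (1/2) ^ n" by (simp add: field_simps power_one_over)
      finally show ?thesis .
    qed
    then show "\<forall>\<^sub>F n in sequentially. norm (euler n s (euler n t x) - euler n (s + t) x) \<le> (s * t * norm x2) * (1/2) ^ n"
      by (intro always_eventually allI)
    show "(\<lambda>n. (s * t * norm x2) * (1/2) ^ n) \<longlonglongrightarrow> 0"
      by (intro tendsto_mult_right_zero LIMSEQ_power_zero) simp
  qed
  \<comment> \<open>The inner iterate may be replaced by its limit because every
    \<open>euler n s\<close> is a contraction.\<close>
  have "(\<lambda>n. euler n s (euler n t x) - euler n s (E t x)) \<longlonglongrightarrow> 0"
  proof (rule Lim_null_comparison)
    show "\<forall>\<^sub>F n in sequentially. norm (euler n s (euler n t x) - euler n s (E t x)) \<le> norm (euler n t x - E t x)"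
      using s t M by (intro always_eventually allI)
        (simp add: euler_in E_in M_diff euler_contr flip: euler_diff)
    show "(\<lambda>n. norm (euler n t x - E t x)) \<longlonglongrightarrow> 0"
      using euler_convergent[OF M t] by (intro tendsto_norm_zero LIM_zero)
  qed
  from tendsto_add[OF tendsto_diff[OF lim this] euler_convergent[of x "s + t"]]
  have "(\<lambda>n. euler n s (E t x)) \<longlonglongrightarrow> E (s + t) x" using s t M by simp
  with euler_convergent[of "E t x" s] show "E (s + t) x = E s (E t x)"
    using s t M LIMSEQ_unique E_in by blast
qed

section \<open>Behaviour at time zero and the generator\<close>

lemma E_tendsto: assumes "x \<in> M" shows "((\<lambda>t. E t x) \<longlongrightarrow> x) (at_right 0)"
proof (rule LIM_zero_cancel, rule tendsto_0_if_close[OF assms])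
  fix y y' and t :: real assume y: "(y, y') \<in> A" and t: "t > 0"
  have "(\<lambda>n. norm (euler n t x - x)) \<longlonglongrightarrow> norm (E t x - x)"
    using assms t by (intro tendsto_intros euler_convergent) auto
  moreover have "norm (euler n t x - x) \<le> 2 * norm (x - y) + t * norm y'" for n
    using J_pow_close_M[OF assms y, of "t / 2 ^ n" "2 ^ n"] t unfolding euler_def by simp
  ultimately show "norm (E t x - x) \<le> 2 * norm (x - y) + t * norm y'"
    by (intro LIMSEQ_le_const2) auto
qed

text \<open>A first order Taylor estimate for Euler steps: since J x = x - l J x', the remainder is
  - l times the sum of J^k x' - x' over k = 1, ..., n, and each term is controlled through an
  auxiliary \<open>y\<close> near \<open>x'\<close>.\<close>

lemma J_pow_deriv_error:
  assumes x: "(x, x') \<in> A" and y: "(y, y') \<in> A" and l: "l \<ge> 0"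
  shows "norm ((J l ^^ n) x - x + (real n * l) *\<^sub>R x') \<le> real n * l * (2 * norm (x' - y) + real n * l * norm y')"
proof (induction n)
  case (Suc n)
  have M: "x \<in> M" "x' \<in> M" using A_in[OF x] .
  let ?b = "2 * norm (x' - y) + real (Suc n) * l * norm y'"
  have "x = J l (x + l *\<^sub>R x')" using J_unique[OF x l] by simp
  then have "x - l *\<^sub>R J l x' = J l x" using l M M_scaleR by (simp add: J_add J_scaleR algebra_simps)
  then have "(J l ^^ Suc n) x = (J l ^^ n) (x - l *\<^sub>R J l x')" by (simp add: funpow_swap1)
  also have "\<dots> = (J l ^^ n) x - l *\<^sub>R (J l ^^ Suc n) x'"
    using l M by (simp add: J_pow_diff J_pow_scaleR J_in M_scaleR funpow_swap1)
  finally have "(J l ^^ Suc n) x - x + (real (Suc n) * l) *\<^sub>R x'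
      = ((J l ^^ n) x - x + (real n * l) *\<^sub>R x') - l *\<^sub>R ((J l ^^ Suc n) x' - x')"
    by (simp add: algebra_simps)
  also have "norm \<dots> \<le> norm ((J l ^^ n) x - x + (real n * l) *\<^sub>R x') + l * norm ((J l ^^ Suc n) x' - x')"
    using norm_triangle_ineq4[of _ "l *\<^sub>R ((J l ^^ Suc n) x' - x')"] l by simp
  also have "\<dots> \<le> real n * l * (2 * norm (x' - y) + real n * l * norm y') + l * ?b"
    by (intro add_mono Suc.IH mult_left_mono J_pow_close_M M y l)
  also have "\<dots> \<le> real n * l * ?b + l * ?b"
    using l by (intro add_right_mono mult_left_mono add_left_mono mult_right_mono) auto
  also have "\<dots> = real (Suc n) * l * ?b" by (simp add: algebra_simps)
  finally show ?case .
qed simp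

lemma E_deriv_0:
  assumes x: "(x, x') \<in> A"
  shows "((\<lambda>t. (E t x - x) /\<^sub>R t) \<longlongrightarrow> - x') (at_right 0)"
proof -
  have M: "x \<in> M" "x' \<in> M" using A_in[OF x] .
  have "((\<lambda>t. (E t x - x) /\<^sub>R t + x') \<longlongrightarrow> 0) (at_right 0)"
  proof (rule tendsto_0_if_close[OF M(2)])
    fix y y' and t :: real assume y: "(y, y') \<in> A" and t: "t > 0"
    have "norm (E t x - x + t *\<^sub>R x') \<le> t * (2 * norm (x' - y) + t * norm y')"
    proof (rule LIMSEQ_le_const2)
      show "(\<lambda>n. norm (euler n t x - x + t *\<^sub>R x')) \<longlonglongrightarrow> norm (E t x - x + t *\<^sub>R x')"
        using M t by (intro tendsto_intros euler_convergent) auto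
      have "norm (euler n t x - x + t *\<^sub>R x') \<le> t * (2 * norm (x' - y) + t * norm y')" for n
        using J_pow_deriv_error[OF x y, of "t / 2 ^ n" "2 ^ n"] t unfolding euler_def by simp
      then show "\<exists>N. \<forall>n\<ge>N. norm (euler n t x - x + t *\<^sub>R x') \<le> t * (2 * norm (x' - y) + t * norm y')"
        by blast
    qed
    then have "norm (E t x - x + t *\<^sub>R x') / t \<le> 2 * norm (x' - y) + t * norm y'"
      using t by (simp add: pos_divide_le_eq mult.commute)
    moreover have "(E t x - x) /\<^sub>R t + x' = (E t x - x + t *\<^sub>R x') /\<^sub>R t"
      using t by (simp add: scaleR_add_right)
    ultimately show "norm ((E t x - x) /\<^sub>R t + x') \<le> 2 * norm (x' - y) + t * norm y'"
      using t by (simp add: divide_inverse_commute)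
  qed
  from tendsto_diff[OF this tendsto_const[of x']] show ?thesis by simp
qed

text \<open>The derivative at zero shows that the generator extends -A. Conversely, a generator pair
  (f, f') is compared with the y solving y + A y = f - f': the orbit of w = f - y has derivative w
  at zero, whereas a contraction semigroup satisfies <w, E t w - w> \<le> 0, so w = 0.\<close>

lemma generator_eq:
  "{(f, f') \<in> M \<times> M. ((\<lambda>t. (E t f - f) /\<^sub>R t) \<longlongrightarrow> f') (at_right 0)} = {(f, - f') | f f'. (f, f') \<in> A}"
proof (intro equalityI subsetI)
  fix p assume "p \<in> {(f, - f') | f f'. (f, f') \<in> A}"
  then show "p \<in> {(f, f') \<in> M \<times> M. ((\<lambda>t. (E t f - f) /\<^sub>R t) \<longlongrightarrow> f') (at_right 0)}"
    using E_deriv_0 A_in M_scaleR[of _ "-1"] by auto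
next
  fix p assume p: "p \<in> {(f, f') \<in> M \<times> M. ((\<lambda>t. (E t f - f) /\<^sub>R t) \<longlongrightarrow> f') (at_right 0)}"
  then obtain f f' where f: "p = (f, f')" "f \<in> M" "f' \<in> M"
    "((\<lambda>t. (E t f - f) /\<^sub>R t) \<longlongrightarrow> f') (at_right 0)" by auto
  \<comment> \<open>If \<open>f'\<close> is to be - A f, then \<open>f - f'\<close> must be (1 + A)
    f; solving this equation in the domain of A produces the candidate \<open>y\<close> for
    \<open>f\<close>.\<close>
  obtain y y' where y: "(y, y') \<in> A" "y + y' = f - f'"
    using surj[of 1 "f - f'"] M_diff[OF f(2,3)] by auto
  have yM: "y \<in> M" using y A_in by blast
  define w where "w = f - y"
  have wM: "w \<in> M" using f yM M_diff by (simp add: w_def)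
  have "((\<lambda>t. (E t f - f) /\<^sub>R t - (E t y - y) /\<^sub>R t) \<longlongrightarrow> f' - (- y')) (at_right 0)"
    by (intro tendsto_diff f E_deriv_0[OF y(1)])
  moreover have "f' - (- y') = w" 
  proof -
    have "f = y + y' + f'" using y(2) by (simp add: eq_diff_eq)
    then show ?thesis by (simp add: w_def)
  qed
  ultimately have "((\<lambda>t. (E t f - f) /\<^sub>R t - (E t y - y) /\<^sub>R t) \<longlongrightarrow> w) (at_right 0)"
    by (simp only:)
  then have "((\<lambda>t. w \<bullet> ((E t f - f) /\<^sub>R t - (E t y - y) /\<^sub>R t)) \<longlongrightarrow> w \<bullet> w) (at_right 0)"
    by (intro tendsto_intros)
  moreover have "\<forall>\<^sub>F t in at_right 0. w \<bullet> ((E t f - f) /\<^sub>R t - (E t y - y) /\<^sub>R t) \<le> 0"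
    using eventually_at_right_less[of "0::real"]
  proof eventually_elim
    case (elim t)
    then have t: "t \<ge> 0" by simp
    have "(E t f - f) /\<^sub>R t - (E t y - y) /\<^sub>R t = (E t w - w) /\<^sub>R t"
      unfolding w_def E_diff[OF t f(2) yM] by (simp add: scaleR_diff_right)
    moreover have "w \<bullet> E t w \<le> w \<bullet> w"
    proof -
      have "w \<bullet> E t w \<le> norm w * norm (E t w)" by (rule norm_cauchy_schwarz)
      also have "\<dots> \<le> norm w * norm w" by (intro mult_left_mono E_contr t wM) simp
      also have "\<dots> = w \<bullet> w" by (simp only: power2_norm_eq_inner flip: power2_eq_square)
      finally show ?thesis .
    qed
    ultimately show ?case using elim by (simp add: inner_diff_right mult_le_0_iff)
  qed
  ultimately have "w \<bullet> w \<le> 0" by (intro tendsto_upperbound) auto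
  then have "w = 0" by (metis inner_gt_zero_iff not_less)
  then have fy: "f = y" unfolding w_def by (rule eq_iff_diff_eq_0[THEN iffD2])
  have "y + y' = y - f'" using y(2) unfolding fy .
  then have "y + y' = y + - f'" by (simp only: diff_conv_add_uminus)
  then have "f' = - y'" by (simp only: add_left_cancel minus_minus)
  with fy f(1) have "p = (y, - y')" by simp
  with y(1) show "p \<in> {(f, - f') | f f'. (f, f') \<in> A}" by blast
qed

end

section \<open>Strongly continuous semigroups and Duhamel's formula\<close>

text \<open>Banach-Steinhaus for maps that are linear only on the closed subspace \<open>M\<close>.
  The Baire argument therefore runs in the relative topology of \<open>M\<close>, with the sublevel
  sets \<open>F k\<close> as closed cover.\<close>

lemma uniform_boundedness_on:
  fixes T :: "nat \<Rightarrow> 'b::banach \<Rightarrow> 'c::real_normed_vector"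
  assumes M: "closed M" "subspace M"
    and add: "\<And>n x y. x \<in> M \<Longrightarrow> y \<in> M \<Longrightarrow> T n (x + y) = T n x + T n y"
    and scale: "\<And>n c x. x \<in> M \<Longrightarrow> T n (c *\<^sub>R x) = c *\<^sub>R T n x"
    and bdd: "\<And>n. \<exists>C. \<forall>x\<in>M. norm (T n x) \<le> C * norm x"
    and pw: "\<And>x. x \<in> M \<Longrightarrow> \<exists>C. \<forall>n. norm (T n x) \<le> C"
  obtains C where "\<And>n x. x \<in> M \<Longrightarrow> norm (T n x) \<le> C * norm x"
proof -
  let ?X = "top_of_set M"
  define F where "F k = {x \<in> M. \<forall>n. norm (T n x) \<le> real k}" for k
  have diff: "T n (x - y) = T n x - T n y" if "x \<in> M" "y \<in> M" for n x y
    using add[of "x - y" y n] that M(2) by (simp add: subspace_diff)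
  have cont: "continuous_on M (T n)" for n
  proof -
    obtain C where C: "\<And>x. x \<in> M \<Longrightarrow> norm (T n x) \<le> C * norm x" using bdd by blast
    have "dist (T n x) (T n y) \<le> \<bar>C\<bar> * dist x y" if "x \<in> M" "y \<in> M" for x y
    proof -
      have "norm (T n (x - y)) \<le> C * norm (x - y)" using that M by (intro C subspace_diff)
      also have "\<dots> \<le> \<bar>C\<bar> * norm (x - y)" by (intro mult_right_mono) auto
      finally show ?thesis using that by (simp add: dist_norm diff)
    qed
    then have "\<bar>C\<bar>-lipschitz_on M (T n)" by (intro lipschitz_onI) auto
    then show ?thesis by (rule lipschitz_on_continuous_on)
  qed
  have Fcl: "closedin ?X (F k)" for k
  proof -
    have "closedin ?X (M \<inter> (\<Inter>n. {x \<in> M. norm (T n x) \<in> {..real k}}))"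
      by (intro closedin_Int closedin_INT closedin_subtopology_refl[THEN iffD2]
           continuous_closedin_preimage[unfolded vimage_def Int_def, simplified] continuous_on_norm cont) auto
    also have "(M \<inter> (\<Inter>n. {x \<in> M. norm (T n x) \<in> {..real k}})) = F k" by (auto simp: F_def)
    finally show ?thesis .
  qed
  have "(\<Union>k. F k) = M"
  proof
    show "M \<subseteq> (\<Union>k. F k)"
    proof
      fix x assume x: "x \<in> M"
      then obtain C where "\<And>n. norm (T n x) \<le> C" using pw by blast
      moreover obtain k where "C \<le> real k" using real_arch_simple by blast
      ultimately have "x \<in> F k" using x unfolding F_def by (auto intro: order_trans)
      then show "x \<in> (\<Union>k. F k)" by blast
    qed
  qed (auto simp: F_def)
  have "\<exists>k. ?X interior_of F k \<noteq> {}"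
  proof (rule ccontr)
    assume "\<not> ?thesis"
    then have "?X interior_of \<Union>(range F) = {}"
      using M(1) Fcl
      by (intro Baire_category_alt disjI1 completely_metrizable_space_closedin[where X = euclidean]
          completely_metrizable_space_euclidean) auto
    then have "?X interior_of topspace ?X = {}" using \<open>(\<Union>k. F k) = M\<close> by simp
    then show False using subspace_0[OF M(2)] by (simp only: interior_of_topspace) auto
  qed
  then obtain k x where x: "x \<in> ?X interior_of F k" by blast
  then obtain U where U: "openin ?X U" "x \<in> U" "U \<subseteq> F k" by (auto simp: interior_of_def)
  then obtain r where r: "r > 0" "ball x r \<inter> M \<subseteq> U" by (auto simp: openin_contains_ball)
  have xM: "x \<in> M" using U by (auto simp: F_def)
  have "norm (T n y) \<le> (4 * real k / r) * norm y" if y: "y \<in> M" for n y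
  proof (cases "y = 0")
    case True
    then show ?thesis using scale[of 0 n 0] subspace_0[OF M(2)] by simp
  next
    case False
    \<comment> \<open>Half the radius: \<open>x + c *\<^sub>R y\<close> stays in the ball on which
      all \<open>T n\<close> are bounded by \<open>k\<close>, and subtracting \<open>T n x\<close>
      leads to the constant 4 k / r.\<close>
    define c where "c = r / (2 * norm y)"
    have c: "c > 0" using r False by (simp add: c_def)
    have "norm (c *\<^sub>R y) < r" using r False by (simp add: c_def)
    then have "x + c *\<^sub>R y \<in> F k" "x \<in> F k"
      using r U y xM M(2) by (auto simp: dist_norm subspace_add subspace_scale subset_iff)
    then have "norm (T n (x + c *\<^sub>R y)) \<le> real k" "norm (T n x) \<le> real k" by (auto simp: F_def)
    then have "norm (T n (x + c *\<^sub>R y) - T n x) \<le> real k + real k"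
      using norm_triangle_ineq4 order_trans add_mono by meson
    then have "c * norm (T n y) \<le> 2 * real k"
      using xM y M(2) c by (simp add: add scale subspace_scale)
    then have "norm (T n y) \<le> 2 * real k / c" using c by (simp add: field_simps)
    also have "\<dots> = (4 * real k / r) * norm y" by (simp add: c_def)
    finally show ?thesis .
  qed
  then show ?thesis by (rule that)
qed

text \<open>Together with \<open>increment\<close> it turns limits at 0 from the right into limits
  at \<open>t\<close> from both sides at once.\<close>

lemma filterlim_abs_diff_at_right:
  "filterlim (\<lambda>s. \<bar>s - t\<bar>) (at_right 0) (at (t::real) within S)"
  unfolding filterlim_at
proof
  show "((\<lambda>s. \<bar>s - t\<bar>) \<longlongrightarrow> 0) (at t within S)"
    by (rule tendsto_eq_intros refl | simp)+
qed (auto simp: eventually_at intro!: exI[of _ 1])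

section \<open>Strongly continuous semigroups on a closed subspace\<close>

locale c0_semigroup =
  fixes M :: "'b::banach set" and E :: "real \<Rightarrow> 'b \<Rightarrow> 'b"
  assumes closed: "closed M" and subspace: "subspace M"
    and map: "t \<ge> 0 \<Longrightarrow> x \<in> M \<Longrightarrow> E t x \<in> M"
    and add: "t \<ge> 0 \<Longrightarrow> x \<in> M \<Longrightarrow> y \<in> M \<Longrightarrow> E t (x + y) = E t x + E t y"
    and scaleR: "t \<ge> 0 \<Longrightarrow> x \<in> M \<Longrightarrow> E t (c *\<^sub>R x) = c *\<^sub>R E t x"
    and bounded: "t \<ge> 0 \<Longrightarrow> \<exists>C. \<forall>x\<in>M. norm (E t x) \<le> C * norm x"
    and zero: "x \<in> M \<Longrightarrow> E 0 x = x"
    and semigroup: "s \<ge> 0 \<Longrightarrow> t \<ge> 0 \<Longrightarrow> x \<in> M \<Longrightarrow> E (s + t) x = E s (E t x)"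
    and tendsto: "x \<in> M \<Longrightarrow> ((\<lambda>t. E t x) \<longlongrightarrow> x) (at_right 0)"
begin

lemma diff: "t \<ge> 0 \<Longrightarrow> x \<in> M \<Longrightarrow> y \<in> M \<Longrightarrow> E t (x - y) = E t x - E t y"
  using add[of t "x - y" y] subspace by (simp add: subspace_diff)

text \<open>Boundedness is only assumed for each operator separately: about the semigroup chosen by
  \<^const>\<open>exp_semigroup\<close> nothing else is known.\<close>

lemma bounded_near_0:
  obtains \<epsilon> C where "\<epsilon> > 0" "C \<ge> 1" "\<And>t x. 0 \<le> t \<Longrightarrow> t \<le> \<epsilon> \<Longrightarrow> x \<in> M \<Longrightarrow> norm (E t x) \<le> C * norm x"
proof -
  have "\<exists>n. \<forall>t x. 0 \<le> t \<longrightarrow> t \<le> inverse (real (Suc n)) \<longrightarrow> x \<in> M \<longrightarrow> norm (E t x) \<le> real n * norm x"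
  proof (rule ccontr)
    assume "\<not> ?thesis"
    then have "\<forall>n. \<exists>t x. 0 \<le> t \<and> t \<le> inverse (real (Suc n)) \<and> x \<in> M \<and> real n * norm x < norm (E t x)"
      by (simp add: not_le)
    then obtain t x where t: "\<And>n. 0 \<le> t n" "\<And>n. t n \<le> inverse (real (Suc n))"
      and x: "\<And>n. x n \<in> M" "\<And>n. real n * norm (x n) < norm (E (t n) (x n))" by metis
    have t0: "t \<longlonglongrightarrow> 0"
      by (rule tendsto_sandwich[OF _ _ tendsto_const LIMSEQ_inverse_real_of_nat]) (use t in auto)
    \<comment> \<open>Along the times \<open>t n\<close>, which tend to 0, every orbit converges and
      hence is bounded; taking the limit within \<open>{0..}\<close> covers indices with
      \<open>t n = 0\<close>. Uniform boundedness then contradicts the growth built into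
      \<open>x n\<close>.\<close>
    have "\<exists>C. \<forall>n. norm (E (t n) y) \<le> C" if y: "y \<in> M" for y
    proof -
      have "((\<lambda>s. E s y) \<longlongrightarrow> E 0 y) (at 0 within {0..})"
        using tendsto[OF y] zero[OF y] by (simp add: at_within_Ici_at_right)
      then have "continuous (at 0 within {0..}) (\<lambda>s. E s y)" by (simp add: continuous_within)
      then have "(\<lambda>n. E (t n) y) \<longlonglongrightarrow> E 0 y"
        using t(1) t0 by (auto simp: continuous_within_sequentially o_def)
      then have "Bseq (\<lambda>n. E (t n) y)" by (intro convergent_imp_Bseq) (auto simp: convergent_def)
      then show ?thesis by (auto simp: Bseq_def)
    qed
    from uniform_boundedness_on[OF closed subspace add[OF t(1)] scaleR[OF t(1)] bounded[OF t(1)] this]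
    obtain C where C: "\<And>n y. y \<in> M \<Longrightarrow> norm (E (t n) y) \<le> C * norm y" by metis
    obtain n where "C \<le> real n" using real_arch_simple by blast
    then have "norm (E (t n) (x n)) \<le> real n * norm (x n)"
      using C[OF x(1)] by (meson mult_right_mono norm_ge_zero order_trans)
    then show False using x(2)[of n] by simp
  qed
  then obtain n where n: "\<And>t x. 0 \<le> t \<Longrightarrow> t \<le> inverse (real (Suc n)) \<Longrightarrow> x \<in> M \<Longrightarrow> norm (E t x) \<le> real n * norm x"
    by blast
  show ?thesis
  proof
    \<comment> \<open>The extra 1 secures the bound C \<ge> 1.\<close>
    show "norm (E t x) \<le> (real n + 1) * norm x" if "0 \<le> t" "t \<le> inverse (real (Suc n))" "x \<in> M" for t x
      using n[OF that] by (simp add: algebra_simps add_increasing)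
  qed auto
qed

text \<open>The semigroup law cuts [0, T] into pieces of length at most \<epsilon>, each
  contributing a factor C; because C \<ge> 1, shorter times share the largest power.\<close>

lemma locally_bounded:
  obtains C where "C \<ge> 1" "\<And>t x. 0 \<le> t \<Longrightarrow> t \<le> T \<Longrightarrow> x \<in> M \<Longrightarrow> norm (E t x) \<le> C * norm x"
proof -
  obtain \<epsilon> C where C: "\<epsilon> > 0" "C \<ge> 1" "\<And>t x. 0 \<le> t \<Longrightarrow> t \<le> \<epsilon> \<Longrightarrow> x \<in> M \<Longrightarrow> norm (E t x) \<le> C * norm x"
    using bounded_near_0 by metis
  have *: "norm (E t x) \<le> C ^ Suc n * norm x" if "0 \<le> t" "t \<le> real (Suc n) * \<epsilon>" "x \<in> M" for n t x
    using that
  proof (induction n arbitrary: t)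
    case 0
    then show ?case using C(3) by simp
  next
    case (Suc n)
    show ?case
    proof (cases "t \<le> \<epsilon>")
      case True
      have "norm (E t x) \<le> C * norm x" using C(3) Suc.prems True by simp
      also have "\<dots> \<le> C ^ Suc (Suc n) * norm x"
        using power_increasing[of 1 "Suc (Suc n)" C] C(2) by (intro mult_right_mono) auto
      finally show ?thesis .
    next
      case False
      have "E t x = E \<epsilon> (E (t - \<epsilon>) x)" using semigroup[of \<epsilon> "t - \<epsilon>" x] C(1) False Suc.prems by simp
      also have "norm \<dots> \<le> C * norm (E (t - \<epsilon>) x)" using C(1) False Suc.prems by (intro C(3) map) auto
      also have "\<dots> \<le> C * (C ^ Suc n * norm x)"
        using C(2) False Suc.prems by (intro mult_left_mono Suc.IH) (auto simp: algebra_simps)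
      finally show ?thesis by (simp add: mult_ac)
    qed
  qed
  obtain n where "T / \<epsilon> \<le> real n" using real_arch_simple by blast
  then have n: "T \<le> real (Suc n) * \<epsilon>" using C(1) by (simp add: field_simps)
  show ?thesis
  proof
    show "C ^ Suc n \<ge> 1" using C(2) by (rule one_le_power)
    show "norm (E t x) \<le> C ^ Suc n * norm x" if "0 \<le> t" "t \<le> T" "x \<in> M" for t x
      using *[of t n x] that n by simp
  qed
qed

text \<open>Factoring out the orbit up to the earlier time leaves a quotient based at 0. Numerator
  and denominator change sign together, so one formula covers s < t and s > t.\<close>

lemma increment:
  assumes "0 \<le> s" "0 \<le> t" "x \<in> M" "s \<noteq> t"
  shows "(E s x - E t x) /\<^sub>R (s - t) = E (min s t) ((E \<bar>s - t\<bar> x - x) /\<^sub>R \<bar>s - t\<bar>)"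
proof -
  have *: "(E s x - E t x) /\<^sub>R (s - t) = E t ((E (s - t) x - x) /\<^sub>R (s - t))" if "0 \<le> t" "t < s" for s t
    using semigroup[of t "s - t" x] that assms(3) subspace
    by (simp add: scaleR diff map subspace_diff)
  show ?thesis
  proof (cases "t < s")
    case True
    then show ?thesis using *[of t s] assms by simp
  next
    case False
    have "(E s x - E t x) /\<^sub>R (s - t) = (E t x - E s x) /\<^sub>R (t - s)"
      by (metis inverse_minus_eq minus_diff_eq scaleR_minus_left scaleR_minus_right)
    then show ?thesis using *[of s t] False assms by simp
  qed
qed

text \<open>By \<open>increment\<close> the oscillation between s and t is at most C times
  \<open>norm (E \<bar>s - t\<bar> x - x)\<close>, so right continuity at 0 yields continuity at
  \<open>t\<close> from the left as well.\<close>

lemma continuous_on_orbit: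
  assumes x: "x \<in> M" shows "continuous_on {0..} (\<lambda>t. E t x)"
  unfolding continuous_on_def
proof
  fix t :: real assume t: "t \<in> {0..}"
  obtain C where C: "C \<ge> 1" "\<And>s x. 0 \<le> s \<Longrightarrow> s \<le> t + 1 \<Longrightarrow> x \<in> M \<Longrightarrow> norm (E s x) \<le> C * norm x"
    using locally_bounded by metis
  have bound: "norm (E s x - E t x) \<le> C * norm (E \<bar>s - t\<bar> x - x)" if "0 \<le> s" "s < t + 1" for s
  proof (cases "s = t")
    case False
    have M: "(E \<bar>s - t\<bar> x - x) \<in> M" using map x subspace by (intro subspace_diff) auto
    have "E s x - E t x = (s - t) *\<^sub>R ((E s x - E t x) /\<^sub>R (s - t))" using False by simp
    also have "\<dots> = (s - t) *\<^sub>R (E (min s t) (E \<bar>s - t\<bar> x - x) /\<^sub>R \<bar>s - t\<bar>)"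
      using increment[of s t x] that t x False M by (simp add: scaleR)
    also have "norm \<dots> = norm (E (min s t) (E \<bar>s - t\<bar> x - x))" using False by (simp add: abs_mult)
    also have "\<dots> \<le> C * norm (E \<bar>s - t\<bar> x - x)" using that t M by (intro C) auto
    finally show ?thesis .
  qed (use C(1) in simp)
  show "((\<lambda>s. E s x) \<longlongrightarrow> E t x) (at t within {0..})"
  proof (rule LIM_zero_cancel, rule Lim_null_comparison)
    show "\<forall>\<^sub>F s in at t within {0..}. norm (E s x - E t x) \<le> C * norm (E \<bar>s - t\<bar> x - x)"
      unfolding eventually_at by (intro exI[of _ 1]) (auto simp: dist_real_def intro!: bound)
    from filterlim_compose[OF tendsto[OF x] filterlim_abs_diff_at_right]
    show "((\<lambda>s. C * norm (E \<bar>s - t\<bar> x - x)) \<longlongrightarrow> 0) (at t within {0..})"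
      by (intro tendsto_mult_right_zero tendsto_norm_zero LIM_zero)
  qed
qed

text \<open>From the left the outer factor \<open>E (min s t)\<close> varies with s; this is why
  local boundedness and the continuity of the orbit of \<open>g\<close> enter.\<close>

lemma orbit_deriv:
  assumes x: "x \<in> M" and g: "g \<in> M" "((\<lambda>t. (E t x - x) /\<^sub>R t) \<longlongrightarrow> g) (at_right 0)" and t: "t \<ge> 0"
  shows "((\<lambda>s. (E s x - E t x) /\<^sub>R (s - t)) \<longlongrightarrow> E t g) (at t within {0..})"
proof -
  obtain C where C: "C \<ge> 1" "\<And>s x. 0 \<le> s \<Longrightarrow> s \<le> t + 1 \<Longrightarrow> x \<in> M \<Longrightarrow> norm (E s x) \<le> C * norm x"
    using locally_bounded by metis
  have "((\<lambda>s. (E s x - E t x) /\<^sub>R (s - t) - E t g) \<longlongrightarrow> 0) (at t within {0..})"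
  proof (rule Lim_null_comparison)
    let ?b = "\<lambda>s. C * norm ((E \<bar>s - t\<bar> x - x) /\<^sub>R \<bar>s - t\<bar> - g) + norm (E (min s t) g - E t g)"
    have "norm ((E s x - E t x) /\<^sub>R (s - t) - E t g) \<le> ?b s" if s: "0 \<le> s" "s \<noteq> t" "s < t + 1" for s
    proof -
      let ?q = "(E \<bar>s - t\<bar> x - x) /\<^sub>R \<bar>s - t\<bar>"
      have q: "?q \<in> M" using map x subspace by (intro subspace_scale subspace_diff) auto
      have "(E s x - E t x) /\<^sub>R (s - t) - E t g = E (min s t) ?q - E t g"
        using increment[OF s(1) t x s(2)] by simp
      also have "\<dots> = E (min s t) (?q - g) + (E (min s t) g - E t g)"
        using s t q g by (simp add: diff)
      also have "norm \<dots> \<le> norm (E (min s t) (?q - g)) + norm (E (min s t) g - E t g)"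
        by (rule norm_triangle_ineq)
      also have "norm (E (min s t) (?q - g)) \<le> C * norm (?q - g)"
        using s t q g subspace by (intro C subspace_diff) auto
      finally show ?thesis by simp
    qed
    then show "\<forall>\<^sub>F s in at t within {0..}. norm ((E s x - E t x) /\<^sub>R (s - t) - E t g) \<le> ?b s"
      unfolding eventually_at by (intro exI[of _ 1]) (auto simp: dist_real_def)
    from filterlim_compose[OF g(2) filterlim_abs_diff_at_right]
    have "((\<lambda>s. C * norm ((E \<bar>s - t\<bar> x - x) /\<^sub>R \<bar>s - t\<bar> - g)) \<longlongrightarrow> 0) (at t within {0..})"
      by (intro tendsto_mult_right_zero tendsto_norm_zero LIM_zero)
    moreover have "((\<lambda>s. E (min s t) g) \<longlongrightarrow> E t g) (at t within {0..})"
    proof -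
      have "((\<lambda>s. min s t) \<longlongrightarrow> min t t) (at t within {0..})" by (intro tendsto_intros)
      then show ?thesis
        using t by (intro continuous_on_tendsto_compose[OF continuous_on_orbit[OF g(1)]])
          (auto simp: eventually_at intro!: exI[of _ 1])
    qed
    ultimately show "(?b \<longlongrightarrow> 0) (at t within {0..})"
      by (intro tendsto_add_zero tendsto_norm_zero LIM_zero)
  qed
  then show ?thesis by (rule LIM_zero_cancel)
qed

text \<open>\<open>E t\<close> commutes with \<open>E h\<close> and is bounded, so it passes through
  the difference quotient. This places \<open>E t x\<close> in the domain of the generator.\<close>

lemma generator_invariant:
  assumes x: "x \<in> M" and g: "g \<in> M" "((\<lambda>t. (E t x - x) /\<^sub>R t) \<longlongrightarrow> g) (at_right 0)" and t: "t \<ge> 0"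
  shows "((\<lambda>h. (E h (E t x) - E t x) /\<^sub>R h) \<longlongrightarrow> E t g) (at_right 0)"
proof -
  obtain C where C: "\<And>y. y \<in> M \<Longrightarrow> norm (E t y) \<le> C * norm y" using bounded[OF t] by blast
  have "((\<lambda>h. (E h (E t x) - E t x) /\<^sub>R h - E t g) \<longlongrightarrow> 0) (at_right 0)"
  proof (rule Lim_null_comparison)
    show "\<forall>\<^sub>F h in at_right 0. norm ((E h (E t x) - E t x) /\<^sub>R h - E t g) \<le> C * norm ((E h x - x) /\<^sub>R h - g)"
      using eventually_at_right_less[of "0::real"]
    proof eventually_elim
      case (elim h)
      have M: "E h x \<in> M" "(E h x - x) /\<^sub>R h \<in> M"
        using elim map x subspace by (auto intro!: subspace_scale subspace_diff)
      have "E h (E t x) = E t (E h x)" using semigroup[of h t x] semigroup[of t h x] elim t x by (simp add: add.commute)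
      then have "(E h (E t x) - E t x) /\<^sub>R h - E t g = E t ((E h x - x) /\<^sub>R h - g)"
        using M x g t subspace by (simp add: diff scaleR subspace_diff)
      also have "norm \<dots> \<le> C * norm ((E h x - x) /\<^sub>R h - g)"
        using M g subspace by (intro C subspace_diff)
      finally show ?case .
    qed
    show "((\<lambda>h. C * norm ((E h x - x) /\<^sub>R h - g)) \<longlongrightarrow> 0) (at_right 0)"
      by (intro tendsto_mult_right_zero tendsto_norm_zero LIM_zero g)
  qed
  then show ?thesis by (rule LIM_zero_cancel)
qed

text \<open>Local boundedness controls the change of the argument \<open>c s\<close>, strong
  continuity the change of time; together they give the limit of a moving operator at a moving
  vector.\<close>

lemma mild_tendsto:
  assumes t: "t \<in> {0..T}" and c: "(c \<longlongrightarrow> c0) (at t within {0..T})" "c0 \<in> M"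
    "\<And>s. s \<in> {0..T} \<Longrightarrow> c s \<in> M"
  shows "((\<lambda>s. E (T - s) (c s)) \<longlongrightarrow> E (T - t) c0) (at t within {0..T})"
proof -
  obtain C where C: "C \<ge> 1" "\<And>s x. 0 \<le> s \<Longrightarrow> s \<le> T \<Longrightarrow> x \<in> M \<Longrightarrow> norm (E s x) \<le> C * norm x"
    using locally_bounded by metis
  have "((\<lambda>s. E (T - s) (c s) - E (T - s) c0) \<longlongrightarrow> 0) (at t within {0..T})"
  proof (rule Lim_null_comparison)
    show "\<forall>\<^sub>F s in at t within {0..T}. norm (E (T - s) (c s) - E (T - s) c0) \<le> C * norm (c s - c0)"
      using C(2) c t subspace
      by (auto simp: eventually_at subspace_diff simp flip: diff intro!: exI[of _ 1])
    show "((\<lambda>s. C * norm (c s - c0)) \<longlongrightarrow> 0) (at t within {0..T})"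
      using c(1) by (intro tendsto_mult_right_zero tendsto_norm_zero LIM_zero)
  qed
  moreover have "((\<lambda>s. E (T - s) c0) \<longlongrightarrow> E (T - t) c0) (at t within {0..T})"
    using t
    by (intro continuous_on_tendsto_compose[OF continuous_on_orbit[OF c(2)]] tendsto_intros)
       (auto simp: eventually_at intro!: exI[of _ 1])
  ultimately show ?thesis using tendsto_add by fastforce
qed

lemma continuous_on_mild:
  assumes c: "continuous_on {0..T} c" "\<And>s. s \<in> {0..T} \<Longrightarrow> c s \<in> M"
  shows "continuous_on {0..T} (\<lambda>s. E (T - s) (c s))"
  unfolding continuous_on_def using c by (auto intro!: mild_tendsto simp: continuous_on_def)

end

context maximal_monotone
begin

sublocale semigroup: c0_semigroup M E
proof
  show "\<exists>C. \<forall>x\<in>M. norm (E t x) \<le> C * norm x" if "t \<ge> 0" for t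
    using E_contr[OF that] by (intro exI[of _ 1]) simp
qed (use closed_M subspace_M in \<open>auto simp: E_in E_add E_scaleR E_0 E_semigroup E_tendsto\<close>)

end

lemma integrable_continuous_on_Ioo:
  fixes k :: "real \<Rightarrow> 'b::{banach,second_countable_topology}"
  assumes "continuous_on {0..T} k" shows "integrable (lebesgue_on {0<..<T}) k"
proof -
  have fin: "finite_measure (lebesgue_on {0<..<T})" by (intro finite_measure_lebesgue_on) simp
  have "compact (k ` {0..T})" by (intro compact_continuous_image assms) simp
  then have "bounded (k ` {0..T})" by (rule compact_imp_bounded)
  then obtain B where B: "\<And>s. s \<in> {0..T} \<Longrightarrow> norm (k s) \<le> B"
    unfolding bounded_iff by blast
  have "k \<in> borel_measurable (lebesgue_on {0<..<T})"
    by (intro continuous_imp_measurable_on_sets_lebesgue continuous_on_subset[OF assms]) auto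
  then show ?thesis
    by (rule finite_measure.integrable_const_bound[OF fin, of _ B, rotated]) (auto intro!: AE_I2 B)
qed

section \<open>Duhamel's formula for a bounded perturbation\<close>

context
  fixes M :: "'b::{real_inner,banach,second_countable_topology} set"
    and E F :: "real \<Rightarrow> 'b \<Rightarrow> 'b" and B :: "'b \<Rightarrow> 'b" and D :: "'b set" and C\<^sub>B :: real
  assumes E: "c0_semigroup M E" and F: "c0_semigroup M F"
    and B: "\<And>x. x \<in> M \<Longrightarrow> B x \<in> M"
      "\<And>x y. x \<in> M \<Longrightarrow> y \<in> M \<Longrightarrow> norm (B x - B y) \<le> C\<^sub>B * norm (x - y)"
      "C\<^sub>B \<ge> 0"
    and D: "D \<subseteq> M" "M \<subseteq> closure D"
    and gen: "\<And>x. x \<in> D \<Longrightarrow> \<exists>g\<in>M. ((\<lambda>t. (E t x - x) /\<^sub>R t) \<longlongrightarrow> g) (at_right 0) \<and>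
      ((\<lambda>t. (F t x - x) /\<^sub>R t) \<longlongrightarrow> g - B x) (at_right 0)"
    and inv: "\<And>x s. x \<in> D \<Longrightarrow> s \<ge> 0 \<Longrightarrow> F s x \<in> D"
begin

interpretation E: c0_semigroup M E by (rule E)
interpretation F: c0_semigroup M F by (rule F)

lemma continuous_on_perturbation: "continuous_on M B"
proof -
  have "C\<^sub>B-lipschitz_on M B" using B by (intro lipschitz_onI) (auto simp: dist_norm)
  then show ?thesis by (rule lipschitz_on_continuous_on)
qed

lemma continuous_on_duhamel_integrand:
  assumes "x \<in> M" shows "continuous_on {0..T} (\<lambda>s. E (T - s) (B (F s x)))"
proof (rule E.continuous_on_mild)
  show "continuous_on {0..T} (\<lambda>s. B (F s x))"
    by (rule continuous_on_compose2[OF continuous_on_perturbation])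
       (use assms in \<open>auto intro!: continuous_on_subset[OF F.continuous_on_orbit] F.map\<close>)
qed (use assms B F.map in auto)

text \<open>The product rule for s \<mapsto> E (T - s) (F s x). The contributions of the generator
  of E from the two factors have opposite signs and cancel, so that only the perturbation
  remains.\<close>

lemma duhamel_deriv:
  assumes x: "x \<in> D" and t: "t \<in> {0..T}"
  shows "((\<lambda>s. (E (T - s) (F s x) - E (T - t) (F t x)) /\<^sub>R (s - t)) \<longlongrightarrow> - E (T - t) (B (F t x)))
    (at t within {0..T})"
proof -
  define y where "y = F t x"
  have xM: "x \<in> M" using x D by blast
  have yD: "y \<in> D" using inv x t by (simp add: y_def)
  then have yM: "y \<in> M" using D by blast
  obtain g where g: "g \<in> M" "((\<lambda>t. (E t y - y) /\<^sub>R t) \<longlongrightarrow> g) (at_right 0)"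
    "((\<lambda>t. (F t y - y) /\<^sub>R t) \<longlongrightarrow> g - B y) (at_right 0)" using gen[OF yD] by blast
  obtain g' where g': "g' \<in> M" "((\<lambda>t. (F t x - x) /\<^sub>R t) \<longlongrightarrow> g' - B x) (at_right 0)"
    using gen[OF x] by blast
  have g'M: "g' - B x \<in> M" using g' B xM F.subspace by (intro subspace_diff)
  have gM: "g - B y \<in> M" using g B yM F.subspace by (intro subspace_diff)
  have "((\<lambda>t. (F t y - y) /\<^sub>R t) \<longlongrightarrow> F t (g' - B x)) (at_right 0)"
    unfolding y_def using t by (intro F.generator_invariant xM g'M g') auto
  \<comment> \<open>The derivative of the F-orbit at time \<open>t\<close> computed twice: as
    \<open>F t\<close> applied to the derivative at time 0, and as the generator at
    \<open>y\<close>, which lies in \<open>D\<close> by \<open>inv\<close>.\<close>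
  then have "F t (g' - B x) = g - B y" using g(3) by (rule tendsto_unique[rotated]) simp
  then have "((\<lambda>s. (F s x - F t x) /\<^sub>R (s - t)) \<longlongrightarrow> g - B y) (at t within {0..})"
    using F.orbit_deriv[OF xM g'M g'(2), of t] t by simp
  then have q: "((\<lambda>s. (F s x - F t x) /\<^sub>R (s - t)) \<longlongrightarrow> g - B y) (at t within {0..T})"
    by (rule tendsto_within_subset) auto
  have 1: "((\<lambda>s. E (T - s) ((F s x - F t x) /\<^sub>R (s - t))) \<longlongrightarrow> E (T - t) (g - B y)) (at t within {0..T})"
    using t xM F.map F.subspace
    by (intro E.mild_tendsto q gM) (auto intro!: subspace_scale subspace_diff)
  have "((\<lambda>s. (E s y - E (T - t) y) /\<^sub>R (s - (T - t))) \<longlongrightarrow> E (T - t) g) (at (T - t) within {0..})"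
    using t by (intro E.orbit_deriv yM g) auto
  moreover have "filterlim (\<lambda>s. T - s) (at (T - t) within {0..}) (at t within {0..T})"
    unfolding filterlim_at
  proof
    show "((\<lambda>s. T - s) \<longlongrightarrow> T - t) (at t within {0..T})" by (intro tendsto_intros)
  qed (auto simp: eventually_at intro!: exI[of _ 1])
  ultimately have 2: "((\<lambda>s. (E (T - s) y - E (T - t) y) /\<^sub>R (T - s - (T - t))) \<longlongrightarrow> E (T - t) g) (at t within {0..T})"
    by (rule filterlim_compose)
  have "((\<lambda>s. (E (T - s) (F s x) - E (T - t) (F t x)) /\<^sub>R (s - t)) \<longlongrightarrow> E (T - t) (g - B y) - E (T - t) g)
    (at t within {0..T})"
  proof (rule Lim_transform_eventually[OF tendsto_diff[OF 1 2]])
    \<comment> \<open>The usual splitting of a product difference through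
      \<open>E (T - s) y\<close>; reversed time replaces \<open>s - t\<close> by its negative in the
      second quotient, hence the subtraction.\<close>
    have "E (T - s) ((F s x - F t x) /\<^sub>R (s - t)) - (E (T - s) y - E (T - t) y) /\<^sub>R (T - s - (T - t))
      = (E (T - s) (F s x) - E (T - t) (F t x)) /\<^sub>R (s - t)" if s: "s \<in> {0..T}" "s \<noteq> t" for s
    proof -
      have "E (T - s) ((F s x - F t x) /\<^sub>R (s - t)) = (E (T - s) (F s x) - E (T - s) y) /\<^sub>R (s - t)"
        using s t xM F.map F.subspace unfolding y_def
        by (subst E.scaleR) (auto simp: E.diff intro!: subspace_diff)
      moreover have "(E (T - s) y - E (T - t) y) /\<^sub>R (T - s - (T - t)) = - ((E (T - s) y - E (T - t) y) /\<^sub>R (s - t))"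
      proof -
        have "T - s - (T - t) = - (s - t)" by simp
        then show ?thesis by (simp only: inverse_minus_eq scaleR_minus_left)
      qed
      ultimately show ?thesis by (simp add: y_def scaleR_diff_right)
    qed
    then show "\<forall>\<^sub>F s in at t within {0..T}. E (T - s) ((F s x - F t x) /\<^sub>R (s - t)) - (E (T - s) y - E (T - t) y) /\<^sub>R (T - s - (T - t))
      = (E (T - s) (F s x) - E (T - t) (F t x)) /\<^sub>R (s - t)"
      unfolding eventually_at by (intro exI[of _ 1]) auto
  qed
  moreover have "E (T - t) (g - B y) - E (T - t) g = - E (T - t) (B y)"
    using t g B yM by (simp add: E.diff)
  ultimately show ?thesis by (simp add: y_def)
qed

text \<open>Each scalar function <z, E (T - s) (F s x)> obeys the fundamental theorem of calculus
  with end values given by \<open>E T x\<close> and \<open>F T x\<close>; as z is arbitrary, this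
  determines the Bochner integral.\<close>

lemma duhamel_on_domain:
  assumes x: "x \<in> D" and T: "T \<ge> 0"
  shows "(LINT s|lebesgue_on {0<..<T}. E (T - s) (B (F s x))) = E T x - F T x"
proof -
  have xM: "x \<in> M" using x D by blast
  define k where "k s = E (T - s) (B (F s x))" for s
  have int: "integrable (lebesgue_on {0<..<T}) k"
    unfolding k_def by (intro integrable_continuous_on_Ioo continuous_on_duhamel_integrand xM)
  have "z \<bullet> (LINT s|lebesgue_on {0<..<T}. k s) = z \<bullet> (E T x - F T x)" for z
  proof -
    have "((\<lambda>s. z \<bullet> E (T - s) (F s x)) has_vector_derivative - (z \<bullet> k t)) (at t within {0..T})"
      if t: "t \<in> {0..T}" for t
    proof -
      have "((\<lambda>s. z \<bullet> ((E (T - s) (F s x) - E (T - t) (F t x)) /\<^sub>R (s - t))) \<longlongrightarrow> z \<bullet> (- k t)) (at t within {0..T})"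
        unfolding k_def by (intro tendsto_intros duhamel_deriv x t)
      then have "((\<lambda>s. z \<bullet> E (T - s) (F s x)) has_field_derivative - (z \<bullet> k t)) (at t within {0..T})"
        unfolding has_field_derivative_iff
        by (simp add: inner_diff_right divide_inverse mult.commute)
      then show ?thesis by (simp add: has_real_derivative_iff_has_vector_derivative)
    qed
    then have "((\<lambda>s. - (z \<bullet> k s)) has_integral (z \<bullet> E (T - T) (F T x) - z \<bullet> E (T - 0) (F 0 x))) {0..T}"
      by (intro fundamental_theorem_of_calculus T)
    from has_integral_neg[OF this]
    have "((\<lambda>s. z \<bullet> k s) has_integral (z \<bullet> (E T x - F T x))) {0..T}"
      using xM T by (simp add: E.zero F.zero F.map inner_diff_right)
    then have 1: "((\<lambda>s. z \<bullet> k s) has_integral (z \<bullet> (E T x - F T x))) {0<..<T}"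
      by (simp add: has_integral_Icc_iff_Ioo)
    have "integrable (lebesgue_on {0<..<T}) (\<lambda>s. z \<bullet> k s)" using int by simp
    then have "((\<lambda>s. z \<bullet> k s) has_integral (LINT s|lebesgue_on {0<..<T}. z \<bullet> k s)) {0<..<T}"
      by (rule has_integral_integral_lebesgue_on) simp
    then have "(LINT s|lebesgue_on {0<..<T}. z \<bullet> k s) = z \<bullet> (E T x - F T x)"
      using 1 has_integral_unique by blast
    then show ?thesis using int by simp
  qed
  then have "(LINT s|lebesgue_on {0<..<T}. k s) = E T x - F T x"
    by (rule vector_eq_ldot[THEN iffD1, OF allI])
  then show ?thesis by (simp only: k_def)
qed

text \<open>Both sides are Lipschitz in \<open>x\<close>, the integrand with constant
  \<open>C * C\<^sub>B * C'\<close> uniformly in time, so the formula extends from the dense set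
  \<open>D\<close> to \<open>M\<close>.\<close>

lemma duhamel:
  assumes x: "x \<in> M" and T: "T \<ge> 0"
  shows "(LINT s|lebesgue_on {0<..<T}. E (T - s) (B (F s x))) = E T x - F T x"
proof -
  have "x \<in> closure D" using x D(2) by blast
  then obtain y where y: "\<And>n. y n \<in> D" "y \<longlonglongrightarrow> x"
    unfolding closure_sequential by blast
  have yM: "y n \<in> M" for n using y D by blast
  obtain C where C: "C \<ge> 1" "\<And>s x. 0 \<le> s \<Longrightarrow> s \<le> T \<Longrightarrow> x \<in> M \<Longrightarrow> norm (E s x) \<le> C * norm x"
    using E.locally_bounded by metis
  obtain C' where C': "C' \<ge> 1" "\<And>s x. 0 \<le> s \<Longrightarrow> s \<le> T \<Longrightarrow> x \<in> M \<Longrightarrow> norm (F s x) \<le> C' * norm x"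
    using F.locally_bounded by metis
  define k where "k x s = E (T - s) (B (F s x))" for x s
  have k_diff: "norm (k z s - k x s) \<le> C * (C\<^sub>B * (C' * norm (z - x)))"
    if "z \<in> M" "s \<in> {0..T}" for z s
  proof -
    have "norm (F s z - F s x) = norm (F s (z - x))" using that x by (simp add: F.diff)
    also have "\<dots> \<le> C' * norm (z - x)"
      using that x F.subspace by (intro C') (auto intro!: subspace_diff)
    finally have 1: "norm (F s z - F s x) \<le> C' * norm (z - x)" .
    have "norm (B (F s z) - B (F s x)) \<le> C\<^sub>B * norm (F s z - F s x)"
      using that x F.map by (intro B) auto
    also have "\<dots> \<le> C\<^sub>B * (C' * norm (z - x))" by (intro mult_left_mono 1 B)
    finally have 2: "norm (B (F s z) - B (F s x)) \<le> C\<^sub>B * (C' * norm (z - x))" .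
    have "norm (k z s - k x s) = norm (E (T - s) (B (F s z) - B (F s x)))"
      unfolding k_def using that x B F.map by (simp add: E.diff)
    also have "\<dots> \<le> C * norm (B (F s z) - B (F s x))"
      using that x B F.map F.subspace by (intro C) (auto intro!: subspace_diff)
    also have "\<dots> \<le> C * (C\<^sub>B * (C' * norm (z - x)))"
      using C(1) by (intro mult_left_mono 2) auto
    finally show ?thesis .
  qed
  have int: "integrable (lebesgue_on {0<..<T}) (k z)" if "z \<in> M" for z
    unfolding k_def by (intro integrable_continuous_on_Ioo continuous_on_duhamel_integrand that)
  have "(\<lambda>n. norm (LINT s|lebesgue_on {0<..<T}. k (y n) s - k x s)) \<longlonglongrightarrow> 0"
  proof (rule tendsto_sandwich[OF _ _ tendsto_const])
    have "norm (LINT s|lebesgue_on {0<..<T}. k (y n) s - k x s)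
        \<le> T * (C * (C\<^sub>B * (C' * norm (y n - x))))" for n
    proof -
      let ?c = "C * (C\<^sub>B * (C' * norm (y n - x)))"
      have fin: "finite_measure (lebesgue_on {0<..<T})" by (intro finite_measure_lebesgue_on) simp
      have "norm (LINT s|lebesgue_on {0<..<T}. k (y n) s - k x s)
          \<le> (LINT s|lebesgue_on {0<..<T}. norm (k (y n) s - k x s))"
        by (rule integral_norm_bound)
      also have "\<dots> \<le> (LINT s|lebesgue_on {0<..<T}. ?c)"
      proof (rule integral_mono)
        show "integrable (lebesgue_on {0<..<T}) (\<lambda>s. norm (k (y n) s - k x s))"
          using int[OF yM] int[OF x] by (intro integrable_norm Bochner_Integration.integrable_diff)
        show "integrable (lebesgue_on {0<..<T}) (\<lambda>s. ?c)"
          by (rule finite_measure.integrable_const[OF fin])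
        show "norm (k (y n) s - k x s) \<le> ?c" if "s \<in> space (lebesgue_on {0<..<T})" for s
          using that by (intro k_diff yM) auto
      qed
      also have "\<dots> = T * ?c" using T by (simp add: measure_restrict_space)
      finally show ?thesis .
    qed
    then show "\<forall>\<^sub>F n in sequentially. norm (LINT s|lebesgue_on {0<..<T}. k (y n) s - k x s)
        \<le> T * (C * (C\<^sub>B * (C' * norm (y n - x))))" by (intro always_eventually allI)
    show "(\<lambda>n. T * (C * (C\<^sub>B * (C' * norm (y n - x))))) \<longlonglongrightarrow> 0"
      by (intro tendsto_mult_right_zero tendsto_norm_zero LIM_zero y)
  qed simp
  then have "(\<lambda>n. (LINT s|lebesgue_on {0<..<T}. k (y n) s) - (LINT s|lebesgue_on {0<..<T}. k x s)) \<longlonglongrightarrow> 0"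
    using int x yM by (simp add: tendsto_norm_zero_iff)
  then have 1: "(\<lambda>n. E T (y n) - F T (y n)) \<longlonglongrightarrow> (LINT s|lebesgue_on {0<..<T}. k x s)"
    using duhamel_on_domain[OF y(1) T] unfolding k_def by (simp add: LIM_zero_iff)
  have "(\<lambda>n. E T (y n)) \<longlonglongrightarrow> E T x"
  proof (rule LIM_zero_cancel, rule Lim_null_comparison)
    show "\<forall>\<^sub>F n in sequentially. norm (E T (y n) - E T x) \<le> C * norm (y n - x)"
      using C(2)[of T] T x yM E.subspace by (intro always_eventually) (simp add: subspace_diff flip: E.diff)
    show "(\<lambda>n. C * norm (y n - x)) \<longlonglongrightarrow> 0"
      by (intro tendsto_mult_right_zero tendsto_norm_zero LIM_zero y)
  qed
  moreover have "(\<lambda>n. F T (y n)) \<longlonglongrightarrow> F T x"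
  proof (rule LIM_zero_cancel, rule Lim_null_comparison)
    show "\<forall>\<^sub>F n in sequentially. norm (F T (y n) - F T x) \<le> C' * norm (y n - x)"
      using C'(2)[of T] T x yM F.subspace by (intro always_eventually) (simp add: subspace_diff flip: F.diff)
    show "(\<lambda>n. C' * norm (y n - x)) \<longlonglongrightarrow> 0"
      by (intro tendsto_mult_right_zero tendsto_norm_zero LIM_zero y)
  qed
  ultimately have "(\<lambda>n. E T (y n) - F T (y n)) \<longlonglongrightarrow> E T x - F T x" by (rule tendsto_diff)
  from LIMSEQ_unique[OF 1 this] show ?thesis by (simp add: k_def)
qed

end

section \<open>Smooth bump functions\<close>

lemma partial_deriv_eq:
  "(\<phi> has_derivative D) (at x) \<Longrightarrow> partial_deriv b \<phi> x = D b"
  unfolding partial_deriv_def using frechet_derivative_at by metis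

lemma has_derivative_frechet:
  "\<phi> differentiable (at x) \<Longrightarrow> (\<phi> has_derivative frechet_derivative \<phi> (at x)) (at x)"
  by (simp add: frechet_derivative_works)

lemma C_k_Suc_imp: "C_k (Suc k) \<phi> \<Longrightarrow> C_k k \<phi>"
proof (induction k arbitrary: \<phi>)
  case 0
  then show ?case
    by (auto intro!: continuous_at_imp_continuous_on differentiable_imp_continuous_within)
qed auto

lemma C_k_continuous: "C_k k \<phi> \<Longrightarrow> continuous_on UNIV \<phi>"
proof (induction k)
  case (Suc k)
  then show ?case using C_k_Suc_imp by blast
qed simp

lemma C_k_const: "C_k k (\<lambda>x::'a::euclidean_space. c)"
proof (induction k arbitrary: c)
  case (Suc k)
  have "partial_deriv b (\<lambda>x::'a. c) = (\<lambda>x. 0)" for b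
    using partial_deriv_eq[OF has_derivative_const] by blast
  then show ?case using Suc by simp
qed simp

lemma C_k_add: "C_k k \<phi> \<Longrightarrow> C_k k \<psi> \<Longrightarrow> C_k k (\<lambda>x. \<phi> x + \<psi> x)"
proof (induction k arbitrary: \<phi> \<psi>)
  case (Suc k)
  have "partial_deriv b (\<lambda>x. \<phi> x + \<psi> x) = (\<lambda>x. partial_deriv b \<phi> x + partial_deriv b \<psi> x)" for b
  proof
    fix x
    have "((\<lambda>x. \<phi> x + \<psi> x) has_derivative
        (\<lambda>h. frechet_derivative \<phi> (at x) h + frechet_derivative \<psi> (at x) h)) (at x)"
      using Suc.prems by (intro has_derivative_add has_derivative_frechet) auto
    from partial_deriv_eq[OF this]
    show "partial_deriv b (\<lambda>x. \<phi> x + \<psi> x) x = partial_deriv b \<phi> x + partial_deriv b \<psi> x"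
      by (simp add: partial_deriv_def)
  qed
  then show ?case using Suc by (auto intro: differentiable_add)
qed (auto intro: continuous_on_add)

lemma C_k_mult: "C_k k \<phi> \<Longrightarrow> C_k k \<psi> \<Longrightarrow> C_k k (\<lambda>x. \<phi> x * \<psi> x)"
proof (induction k arbitrary: \<phi> \<psi>)
  case (Suc k)
  have "partial_deriv b (\<lambda>x. \<phi> x * \<psi> x) = (\<lambda>x. \<phi> x * partial_deriv b \<psi> x + partial_deriv b \<phi> x * \<psi> x)" for b
  proof
    fix x
    have "((\<lambda>x. \<phi> x * \<psi> x) has_derivative
        (\<lambda>h. \<phi> x * frechet_derivative \<psi> (at x) h + frechet_derivative \<phi> (at x) h * \<psi> x)) (at x)"
      using Suc.prems by (intro has_derivative_mult has_derivative_frechet) auto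
    from partial_deriv_eq[OF this]
    show "partial_deriv b (\<lambda>x. \<phi> x * \<psi> x) x = \<phi> x * partial_deriv b \<psi> x + partial_deriv b \<phi> x * \<psi> x"
      by (simp add: partial_deriv_def)
  qed
  then show ?case
    using Suc.prems C_k_Suc_imp[OF Suc.prems(1)] C_k_Suc_imp[OF Suc.prems(2)]
    by (auto intro!: C_k_add Suc.IH differentiable_mult)
qed (auto intro: continuous_on_mult)

lemma C_k_scale: "C_k k \<phi> \<Longrightarrow> C_k k (\<lambda>x. c * \<phi> x)"
  by (intro C_k_mult C_k_const)

lemma C_k_prod:
  assumes "finite I" "\<And>i. i \<in> I \<Longrightarrow> C_k k (\<phi> i)"
  shows "C_k k (\<lambda>x. \<Prod>i\<in>I. \<phi> i x)"
  using assms by (induction I) (auto intro!: C_k_mult C_k_const)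

text \<open>Each partial derivative is a constant times a function of the same form with
  \<open>h\<close> replaced by its derivative, so the induction runs over all \<open>h\<close> at
  once.\<close>

lemma C_k_affine_inner:
  fixes h :: "real \<Rightarrow> real" and i :: "'a::euclidean_space"
  shows "C_k k h \<Longrightarrow> C_k k (\<lambda>x::'a. h (a * (x \<bullet> i) + c))"
proof (induction k arbitrary: h)
  case 0
  then show ?case
    by (auto intro!: continuous_on_compose2[of UNIV h] continuous_intros)
next
  case (Suc k)
  have d: "((\<lambda>x. h (a * (x \<bullet> i) + c)) has_derivative
      (\<lambda>v. frechet_derivative h (at (a * (x \<bullet> i) + c)) (a * (v \<bullet> i)))) (at x)" for x
    by (rule has_derivative_compose[of "\<lambda>x. a * (x \<bullet> i) + c"])
      (use Suc.prems in \<open>auto intro!: derivative_eq_intros has_derivative_frechet\<close>)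
  have "partial_deriv b (\<lambda>x. h (a * (x \<bullet> i) + c)) =
      (\<lambda>x. (a * (b \<bullet> i)) * partial_deriv 1 h (a * (x \<bullet> i) + c))" for b
  proof
    fix x
    have "linear (frechet_derivative h (at (a * (x \<bullet> i) + c)))"
      using Suc.prems by (intro linear_frechet_derivative) auto
    from linear_scale[OF this, of "a * (b \<bullet> i)" 1]
    show "partial_deriv b (\<lambda>x. h (a * (x \<bullet> i) + c)) x = (a * (b \<bullet> i)) * partial_deriv 1 h (a * (x \<bullet> i) + c)"
      using partial_deriv_eq[OF d] by (simp add: partial_deriv_def)
  qed
  moreover have "(\<lambda>x. h (a * (x \<bullet> i) + c)) differentiable (at x)" for x
    using d differentiable_def by blast
  ultimately show ?case using Suc by (auto intro!: C_k_scale)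
qed

lemma C_k_translate:
  shows "C_k k \<phi> \<Longrightarrow> C_k k (\<lambda>x. \<phi> (x - c))"
    and partial_deriv_translate: "(\<And>x. \<phi> differentiable (at x)) \<Longrightarrow>
      partial_deriv b (\<lambda>x. \<phi> (x - c)) = (\<lambda>x. partial_deriv b \<phi> (x - c))"
proof -
  have d: "((\<lambda>x. \<phi> (x - c)) has_derivative frechet_derivative \<phi> (at (x - c))) (at x)"
    if "\<And>x. \<phi> differentiable (at x)" for x and \<phi> :: "'a \<Rightarrow> real"
    by (rule has_derivative_compose[of "\<lambda>x. x - c" "\<lambda>x. x", simplified])
      (use that in \<open>auto intro!: derivative_eq_intros has_derivative_frechet\<close>)
  show pd: "partial_deriv b (\<lambda>x. \<phi> (x - c)) = (\<lambda>x. partial_deriv b \<phi> (x - c))"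
    if "\<And>x. \<phi> differentiable (at x)" for b and \<phi> :: "'a \<Rightarrow> real"
    using partial_deriv_eq[OF d[OF that]] by (auto simp: partial_deriv_def)
  show "C_k k \<phi> \<Longrightarrow> C_k k (\<lambda>x. \<phi> (x - c))"
  proof (induction k arbitrary: \<phi>)
    case 0
    then show ?case by (auto intro!: continuous_on_compose2[of UNIV \<phi>] continuous_intros)
  next
    case (Suc k)
    then show ?case using d differentiable_def by (auto simp: pd) blast
  qed
qed

text \<open>\<open>bump_exp 0\<close> is the flat function exp(-1/x). The powers of 1/x are included
  because derivatives then stay in the linear span of the family, which makes smoothness a single
  induction over all \<open>n\<close>.\<close>

definition bump_exp :: "nat \<Rightarrow> real \<Rightarrow> real"
  where "bump_exp n x = (if x \<le> 0 then 0 else (1 / x) ^ n * exp (- (1 / x)))"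

lemma bump_exp_tendsto_0: "(bump_exp n \<longlongrightarrow> 0) (at 0)"
proof -
  have "(bump_exp n \<longlongrightarrow> 0) (at_left 0)"
    by (rule Lim_transform_eventually[OF tendsto_const])
      (auto simp: eventually_at bump_exp_def intro!: exI[of _ 1])
  moreover have "(bump_exp n \<longlongrightarrow> 0) (at_right 0)"
  proof (rule Lim_transform_eventually)
    show "((\<lambda>x. inverse x ^ n / exp (inverse x :: real)) \<longlongrightarrow> 0) (at_right 0)"
      by (rule filterlim_compose[OF tendsto_power_div_exp_0 filterlim_inverse_at_top_right])
    show "\<forall>\<^sub>F x in at_right 0. inverse x ^ n / exp (inverse x) = bump_exp n x"
      by (auto simp: eventually_at bump_exp_def exp_minus divide_inverse intro!: exI[of _ 1])
  qed
  ultimately show ?thesis by (rule filterlim_split_at_real)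
qed

lemma bump_exp_deriv:
  "(bump_exp n has_field_derivative (- real n * bump_exp (n + 1) x + bump_exp (n + 2) x)) (at x)"
proof -
  consider "x < 0" | "x > 0" | "x = 0" by linarith
  then show ?thesis
  proof cases
    case 1
    have "((\<lambda>x. 0) has_field_derivative (- real n * bump_exp (n + 1) x + bump_exp (n + 2) x)) (at x)"
      using 1 by (simp add: bump_exp_def)
    then show ?thesis
      by (rule has_field_derivative_transform_within_open[of _ _ _ "{..<0}"])
        (use 1 in \<open>auto simp: bump_exp_def\<close>)
  next
    case 2
    have p: "real n * (1 / x) ^ (n - 1) * (1 / x\<^sup>2) = real n * (1 / x) ^ (n + 1)"
      using 2 by (cases n) (auto simp: power2_eq_square)
    have "((\<lambda>x. (1 / x) ^ n * exp (- (1 / x))) has_field_derivative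
        - (real n * (1 / x) ^ (n - 1) * (1 / x\<^sup>2)) * exp (- (1 / x)) + (1 / x) ^ n * (exp (- (1 / x)) * (1 / x\<^sup>2))) (at x)"
      using 2 by (auto intro!: derivative_eq_intros simp: power2_eq_square)
    also have "- (real n * (1 / x) ^ (n - 1) * (1 / x\<^sup>2)) * exp (- (1 / x)) + (1 / x) ^ n * (exp (- (1 / x)) * (1 / x\<^sup>2))
       = - real n * bump_exp (n + 1) x + bump_exp (n + 2) x"
      unfolding p using 2 by (simp add: bump_exp_def power2_eq_square)
    finally show ?thesis
      by (rule has_field_derivative_transform_within_open[of _ _ _ "{0<..}"])
        (use 2 in \<open>auto simp: bump_exp_def\<close>)
  next
    case 3
    \<comment> \<open>Away from 0 this difference quotient is \<open>bump_exp (n + 1)\<close>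
      itself.\<close>
    have "((\<lambda>y. (bump_exp n y - bump_exp n 0) / (y - 0)) \<longlongrightarrow> 0) (at 0)"
      by (rule Lim_transform_eventually[OF bump_exp_tendsto_0[of "n + 1"]])
        (auto simp: eventually_at bump_exp_def intro!: exI[of _ 1])
    then show ?thesis using 3 by (simp add: has_field_derivative_iff bump_exp_def)
  qed
qed

lemma C_k_bump_exp: "C_k k (bump_exp n)"
proof (induction k arbitrary: n)
  case 0
  show ?case using DERIV_isCont[OF bump_exp_deriv]
    by (auto intro!: continuous_at_imp_continuous_on)
next
  case (Suc k)
  have "partial_deriv 1 (bump_exp n) = (\<lambda>x. - real n * bump_exp (n + 1) x + bump_exp (n + 2) x)"
    using partial_deriv_eq[OF bump_exp_deriv[unfolded has_field_derivative_def]] by auto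
  moreover have "C_k k (\<lambda>x. - real n * bump_exp (n + 1) x + bump_exp (n + 2) x)"
    by (intro C_k_add C_k_scale Suc)
  moreover have "bump_exp n differentiable (at x)" for x
    using bump_exp_deriv unfolding has_field_derivative_def differentiable_def by blast
  ultimately show ?case by simp
qed

text \<open>A larger \<open>m\<close> steepens the edges without moving the box, so the values tend
  to the indicator of \<open>box a b\<close>. The arguments are spelled out as
  \<open>m * (x \<bullet> i) + c\<close> to match \<open>C_k_affine_inner\<close>.\<close>

definition box_bump :: "'a::euclidean_space \<Rightarrow> 'a \<Rightarrow> real \<Rightarrow> 'a \<Rightarrow> real"
  where "box_bump a b m x =
    (\<Prod>i\<in>Basis. bump_exp 0 (m * (x \<bullet> i) + - m * (a \<bullet> i)) * bump_exp 0 (- m * (x \<bullet> i) + m * (b \<bullet> i)))"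

lemma bump_exp_0_bounds: "0 \<le> bump_exp 0 x" "bump_exp 0 x \<le> 1"
  by (auto simp: bump_exp_def)

lemma box_bump_bounds: "0 \<le> box_bump a b m x" "box_bump a b m x \<le> 1"
  unfolding box_bump_def
  by (auto intro!: prod_nonneg prod_le_1 mult_nonneg_nonneg mult_le_one bump_exp_0_bounds)

lemma box_bump_outside: assumes "m > 0" "x \<notin> box a b" shows "box_bump a b m x = 0"
proof -
  obtain i where i: "i \<in> Basis" "x \<bullet> i \<le> a \<bullet> i \<or> b \<bullet> i \<le> x \<bullet> i"
    using assms(2) by (force simp: mem_box)
  then have "m * (x \<bullet> i) + - m * (a \<bullet> i) \<le> 0 \<or> - m * (x \<bullet> i) + m * (b \<bullet> i) \<le> 0"
    using assms(1) by auto
  then show ?thesis unfolding box_bump_def using i(1)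
    by (intro prod_zero bexI[of _ i]) (auto simp: bump_exp_def)
qed

lemma test_function_box_bump: assumes "m > 0" shows "test_function (box_bump a b m)"
  unfolding test_function_def
proof
  show "\<forall>k. C_k k (box_bump a b m)"
    unfolding box_bump_def by (intro allI C_k_prod C_k_mult C_k_affine_inner C_k_bump_exp) auto
  show "\<exists>K. compact K \<and> (\<forall>x. x \<notin> K \<longrightarrow> box_bump a b m x = 0)"
    using box_bump_outside[OF assms] box_subset_cbox[of a b] by (intro exI[of _ "cbox a b"]) auto
qed

lemma bump_exp_0_scaled:
  assumes "x > 0" shows "(\<lambda>n. bump_exp 0 (real (Suc n) * x)) \<longlonglongrightarrow> 1"
proof -
  have "(\<lambda>n. exp (- (inverse (real (Suc n)) * (1 / x)))) \<longlonglongrightarrow> exp (- (0 * (1 / x)))"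
    by (intro tendsto_intros LIMSEQ_inverse_real_of_nat)
  moreover have "exp (- (inverse (real (Suc n)) * (1 / x))) = bump_exp 0 (real (Suc n) * x)" for n
  proof -
    have "\<not> real (Suc n) * x \<le> 0" using assms by (simp add: not_le)
    moreover have "inverse (real (Suc n)) * (1 / x) = 1 / (real (Suc n) * x)" by (simp only: inverse_eq_divide) simp
    ultimately show ?thesis by (simp only: bump_exp_def if_False) simp
  qed
  ultimately show ?thesis by simp
qed

lemma box_bump_tendsto: "(\<lambda>n. box_bump a b (real (Suc n)) x) \<longlonglongrightarrow> indicator (box a b) x"
proof (cases "x \<in> box a b")
  case True
  have "(\<lambda>n. box_bump a b (real (Suc n)) x) \<longlonglongrightarrow> (\<Prod>i\<in>(Basis::'a set). 1 * 1)"
    unfolding box_bump_def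
  proof (intro tendsto_prod tendsto_mult)
    fix i :: 'a assume i: "i \<in> Basis"
    have "(\<lambda>n. bump_exp 0 (real (Suc n) * (x \<bullet> i - a \<bullet> i))) \<longlonglongrightarrow> 1"
      "(\<lambda>n. bump_exp 0 (real (Suc n) * (b \<bullet> i - x \<bullet> i))) \<longlonglongrightarrow> 1"
      using True i by (intro bump_exp_0_scaled; simp add: mem_box)+
    then show "(\<lambda>n. bump_exp 0 (real (Suc n) * (x \<bullet> i) + - real (Suc n) * (a \<bullet> i))) \<longlonglongrightarrow> 1"
      "(\<lambda>n. bump_exp 0 (- real (Suc n) * (x \<bullet> i) + real (Suc n) * (b \<bullet> i))) \<longlonglongrightarrow> 1"
      by (simp_all add: right_diff_distrib del: of_nat_Suc)
  qed
  then show ?thesis using True by simp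
next
  case False
  then have "box_bump a b (real (Suc n)) x = 0" for n by (intro box_bump_outside) auto
  then show ?thesis using False by simp
qed

section \<open>The complex Hilbert space\<close>

lemma borel_measurable_lebesgue_if_borel:
  "f \<in> borel_measurable borel \<Longrightarrow> f \<in> borel_measurable lebesgue"
  by (simp add: measurable_completion)

lemma cinner_rep: "cinner f g = (LINT x|lebesgue. cnj (rep_L2 f x) * rep_L2 g x)"
  using cinner.abs_eq[of "rep_L2 f" "rep_L2 g"] by simp

lemma cinner_abs:
  "square_integrable f \<Longrightarrow> square_integrable g \<Longrightarrow>
    cinner (abs_L2 f) (abs_L2 g) = (LINT x|lebesgue. cnj (f x) * g x)"
  by (simp add: cinner.abs_eq)

lemma cinner_commute: "cinner g f = cnj (cinner f g)"
  unfolding cinner_rep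
  by (subst Bochner_Integration.integral_cnj[symmetric]) (simp add: mult.commute del: Bochner_Integration.integral_cnj)

lemma cinner_add_right: "cinner f (g + h) = cinner f g + cinner f h"
  by transfer (simp add: L2_rel_def integrable_cnj_mult distrib_left)

lemma cinner_scaleC_right: "cinner f (c *\<^sub>C g) = c * cinner f g"
  by transfer (simp add: mult.left_commute)

lemma cinner_scaleC_left: "cinner (c *\<^sub>C f) g = cnj c * cinner f g"
  by (subst (1 2) cinner_commute) (simp add: cinner_scaleC_right)

lemma cinner_add_left: "cinner (f + g) h = cinner f h + cinner g h"
  by (subst (1 2 3) cinner_commute) (simp add: cinner_add_right)

lemma cinner_diff_right: "cinner f (g - h) = cinner f g - cinner f h"
  using cinner_add_right[of f "g - h" h] by simp

lemma cinner_diff_left: "cinner (f - g) h = cinner f h - cinner g h"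
  using cinner_add_left[of "f - g" g h] by simp

lemma cinner_self: "cinner f f = complex_of_real ((norm f)\<^sup>2)"
proof -
  have "Im (cinner f f) = 0" using arg_cong[OF cinner_commute[of f f], of Im] by simp
  then show ?thesis by (simp add: complex_eq_iff power2_norm_eq_inner inner_L2_def)
qed

lemma scaleC_add_right: "c *\<^sub>C (f + g) = c *\<^sub>C f + c *\<^sub>C g"
  by transfer (auto simp: L2_rel_def distrib_left intro!: square_integrable_add square_integrable_scale)

lemma scaleC_scaleC: "c *\<^sub>C d *\<^sub>C f = (c * d) *\<^sub>C f"
  by transfer (auto simp: L2_rel_def mult.assoc intro!: square_integrable_scale)

lemma scaleC_scaleR: "c *\<^sub>C (r *\<^sub>R f) = r *\<^sub>R (c *\<^sub>C f)"
  by (simp add: scaleR_L2_def scaleC_scaleC mult.commute)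

lemma Im_cinner: "Im (cinner f g) = - (f \<bullet> (\<i> *\<^sub>C g))"
  by (simp add: inner_L2_def cinner_scaleC_right)

text \<open>Multiplication by this phase turns z into its modulus, which reduces complex estimates
  to estimates of real parts.\<close>

lemma cnj_sgn_mult_self: "cnj (sgn z) * z = complex_of_real (cmod z)"
proof (cases "z = 0")
  case False
  have "cnj z * z = complex_of_real (cmod z) * complex_of_real (cmod z)"
    by (simp add: mult.commute power2_eq_square flip: complex_norm_square)
  then show ?thesis using False unfolding sgn_eq by (simp add: field_simps)
qed simp

lemma norm_cinner_le: "cmod (cinner f g) \<le> norm f * norm g"
proof (cases "cinner f g = 0")
  case False
  define c where "c = cnj (sgn (cinner f g))"
  have "cmod c = 1" using False by (simp add: c_def norm_sgn)
  have "c * cinner f g = complex_of_real (cmod (cinner f g))"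
    unfolding c_def by (rule cnj_sgn_mult_self)
  then have "cmod (cinner f g) = Re (cinner f (c *\<^sub>C g))" by (simp add: cinner_scaleC_right)
  also have "\<dots> \<le> norm f * norm (c *\<^sub>C g)"
    using norm_cauchy_schwarz[of f "c *\<^sub>C g"] by (simp add: inner_L2_def)
  finally show ?thesis using \<open>cmod c = 1\<close> by (simp add: norm_scaleC)
qed simp

section \<open>Functions that vanish against all boxes or all test functions\<close>

lemma borel_representative:
  assumes "f \<in> borel_measurable lebesgue"
  obtains g :: "'a::euclidean_space \<Rightarrow> complex" where "g \<in> borel_measurable borel" "AE x in lebesgue. f x = g x"
proof -
  have "(\<lambda>x. Re (f x)) \<in> borel_measurable (completion lborel)"
    "(\<lambda>x. Im (f x)) \<in> borel_measurable (completion lborel)" using assms by simp_all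
  then obtain u v where uv: "u \<in> borel_measurable borel" "AE x in lborel. Re (f x) = u x"
     "v \<in> borel_measurable borel" "AE x in lborel. Im (f x) = v x"
    by (fastforce dest: completion_ex_borel_measurable_real)
  show ?thesis
  proof
    show "(\<lambda>x. complex_of_real (u x) + \<i> * complex_of_real (v x)) \<in> borel_measurable borel"
      using uv by measurable
    have "AE x in lborel. f x = complex_of_real (u x) + \<i> * complex_of_real (v x)"
      using uv(2,4) by eventually_elim (simp add: complex_eq_iff)
    then show "AE x in lebesgue. f x = complex_of_real (u x) + \<i> * complex_of_real (v x)"
      by (rule AE_completion)
  qed
qed

text \<open>Open boxes form an intersection-stable generator of the Borel sets, and the vanishing
  total integral handles complements. Testing with {f > 0} and {f < 0} then separates the
  signs.\<close>

lemma AE_zero_if_box_integrals_zero_real: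
  fixes f :: "'a::euclidean_space \<Rightarrow> real"
  assumes f: "integrable lborel f"
    and box: "\<And>a b. (LINT x|lborel. indicator (box a b) x * f x) = 0" and tot: "(LINT x|lborel. f x) = 0"
  shows "AE x in lborel. f x = 0"
proof -
  have int: "integrable lborel (\<lambda>x. indicator A x * f x)" if "A \<in> sets borel" for A
    using integrable_mult_indicator[OF _ f, of A] that by simp
  have *: "(LINT x|lborel. indicator A x * f x) = 0" if A: "A \<in> sets borel" for A
  proof -
    have "Int_stable (range (\<lambda>(a, b). box a b :: 'a set))"
      by (auto simp: Int_stable_def box_Int_box)
    moreover have "range (\<lambda>(a, b). box a b :: 'a set) \<subseteq> Pow UNIV" by simp
    moreover have "A \<in> sigma_sets UNIV (range (\<lambda>(a, b). box a b :: 'a set))"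
      using A unfolding borel_eq_box by simp
    ultimately show ?thesis
    proof (induction rule: sigma_sets_induct_disjoint)
      case (basic A)
      then show ?case using box by auto
    next
      case empty
      then show ?case by simp
    next
      case (compl A)
      then have A: "A \<in> sets borel" unfolding borel_eq_box by simp
      have "(LINT x|lborel. indicator (UNIV - A) x * f x) = (LINT x|lborel. f x - indicator A x * f x)"
        by (rule Bochner_Integration.integral_cong) (auto split: split_indicator)
      also have "\<dots> = 0" using compl int[OF A] f tot by simp
      finally show ?case .
    next
      case (union A)
      then have A: "A i \<in> sets borel" for i unfolding borel_eq_box by auto
      have "(\<lambda>n. LINT x|lborel. indicator (\<Union>i<n. A i) x * f x) \<longlonglongrightarrow> (LINT x|lborel. indicator (\<Union>i. A i) x * f x)"
      proof (rule integral_dominated_convergence[where w = "\<lambda>x. norm (f x)"])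
        show "AE x in lborel. (\<lambda>n. indicator (\<Union>i<n. A i) x * f x) \<longlonglongrightarrow> indicator (\<Union>i. A i) x * f x"
          by (intro AE_I2 tendsto_mult LIMSEQ_indicator_UN tendsto_const)
      qed (use f A in \<open>auto split: split_indicator\<close>)
      moreover have "(LINT x|lborel. indicator (\<Union>i<n. A i) x * f x) = 0" for n
      proof (induction n)
        case (Suc n)
        have "A i \<inter> A n = {}" if "i < n" for i
          using disjoint_family_onD[OF union(1), of i n] that by simp
        then have "(\<Union>i<n. A i) \<inter> A n = {}" by blast
        then have "(LINT x|lborel. indicator (\<Union>i<Suc n. A i) x * f x)
          = (LINT x|lborel. indicator (\<Union>i<n. A i) x * f x + indicator (A n) x * f x)"
          by (intro Bochner_Integration.integral_cong) (auto simp: lessThan_Suc split: split_indicator)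
        also have "\<dots> = 0"
          using Suc union(3)[of n] int[of "\<Union>i<n. A i"] int[OF A] A by simp
        finally show ?case .
      qed simp
      ultimately show ?case by (simp add: LIMSEQ_const_iff)
    qed
  qed
  have [measurable]: "f \<in> borel_measurable borel" using f by auto
  have "AE x in lborel. indicator {x. f x > 0} x * f x = 0"
    by (rule integral_nonneg_eq_0_iff_AE[THEN iffD1, OF int _ *]) (auto split: split_indicator)
  moreover have "AE x in lborel. - (indicator {x. f x < 0} x * f x) = 0"
    by (rule integral_nonneg_eq_0_iff_AE[THEN iffD1, OF Bochner_Integration.integrable_minus[OF int]])
      (use * in \<open>auto split: split_indicator\<close>)
  ultimately show ?thesis
    by eventually_elim (auto split: split_indicator_asm)
qed

lemma closure_subspace:
  fixes S :: "'b::real_normed_vector set"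
  assumes "subspace S" shows "subspace (closure S)"
  unfolding subspace_def
proof (intro conjI ballI allI)
  show "0 \<in> closure S" using subspace_0[OF assms] closure_subset by blast
  show "x + y \<in> closure S" if xy: "x \<in> closure S" "y \<in> closure S" for x y
  proof -
    obtain f g where "\<And>n. f n \<in> S" "f \<longlonglongrightarrow> x" "\<And>n. g n \<in> S" "g \<longlonglongrightarrow> y"
      using xy unfolding closure_sequential by blast
    then show ?thesis unfolding closure_sequential
      by (intro exI[of _ "\<lambda>n. f n + g n"]) (auto intro!: tendsto_add subspace_add assms)
  qed
  show "c *\<^sub>R x \<in> closure S" if xy: "x \<in> closure S" for x c
  proof -
    obtain f where "\<And>n. f n \<in> S" "f \<longlonglongrightarrow> x"
      using xy unfolding closure_sequential by blast
    then show ?thesis unfolding closure_sequential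
      by (intro exI[of _ "\<lambda>n. c *\<^sub>R f n"]) (auto intro!: tendsto_intros subspace_scale assms)
  qed
qed

abbreviation pairing :: "('a::euclidean_space \<Rightarrow> real) \<Rightarrow> 'a L2 \<Rightarrow> complex"
  where "pairing \<phi> w \<equiv> (LINT x|lebesgue. complex_of_real (\<phi> x) * rep_L2 w x)"

lemma square_integrable_indicator_box:
  "square_integrable (\<lambda>x::'a::euclidean_space. c * indicator (box a b) x)"
proof -
  obtain r where "box a b \<subseteq> ball 0 r" using bounded_subset_ballD[OF bounded_box] by metis
  then have "box a b \<inter> ball 0 r = box a b" by blast
  then show ?thesis using square_integrable_indicator_ball[of "box a b" c r] by simp
qed

lemma integrable_indicator_box_mult:
  fixes w :: "'a::euclidean_space L2"
  shows "integrable lebesgue (\<lambda>x. indicator (box a b) x * rep_L2 w x)"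
proof -
  have "cnj (1 * indicator (box a b) x) = indicator (box a b) x" for x by (simp split: split_indicator)
  then show ?thesis
    using integrable_cnj_mult[OF square_integrable_indicator_box[of 1 a b] square_integrable_rep[of w]]
    by (simp only:)
qed

lemma test_function_bounded:
  fixes \<phi> :: "'a::euclidean_space \<Rightarrow> real"
  assumes "continuous_on UNIV \<phi>" "compact K" "\<And>x. x \<notin> K \<Longrightarrow> \<phi> x = 0"
  obtains B r where "B \<ge> 0" "\<And>x. \<bar>\<phi> x\<bar> \<le> B * indicator (ball 0 r) x" "K \<subseteq> ball 0 r"
proof -
  have "compact (\<phi> ` K)" by (rule compact_continuous_image[OF continuous_on_subset[OF assms(1)] assms(2)]) simp
  then have "bounded (\<phi> ` K)" by (rule compact_imp_bounded)
  then obtain B where B: "\<And>x. x \<in> K \<Longrightarrow> \<bar>\<phi> x\<bar> \<le> B"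
    unfolding bounded_iff by auto
  obtain r where r: "K \<subseteq> ball 0 r" using bounded_subset_ballD[OF compact_imp_bounded[OF assms(2)]] by metis
  have "\<bar>\<phi> x\<bar> \<le> \<bar>B\<bar> * indicator (ball 0 r) x" for x
  proof (cases "x \<in> K")
    case True
    then show ?thesis using B[OF True] r by (auto split: split_indicator)
  next
    case False
    then show ?thesis using assms(3) by simp
  qed
  then show ?thesis using r that[of "\<bar>B\<bar>" r] by simp
qed

lemma test_function_continuous: "test_function \<phi> \<Longrightarrow> continuous_on UNIV \<phi>"
  unfolding test_function_def using C_k_continuous by blast

lemma test_function_differentiable: "test_function \<phi> \<Longrightarrow> \<phi> differentiable (at x)"
  unfolding test_function_def by (metis C_k.simps(2))

lemma square_integrable_test_function:
  assumes "test_function \<phi>" shows "square_integrable (\<lambda>x. complex_of_real (\<phi> x))"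
proof -
  obtain K where K: "compact K" "\<And>x. x \<notin> K \<Longrightarrow> \<phi> x = 0" using assms unfolding test_function_def by blast
  obtain B r where B: "B \<ge> 0" "\<And>x. \<bar>\<phi> x\<bar> \<le> B * indicator (ball 0 r) x"
    using test_function_bounded[OF test_function_continuous[OF assms] K] by metis
  show ?thesis
  proof (rule square_integrable_dominated)
    show "(\<lambda>x. complex_of_real (\<phi> x)) \<in> borel_measurable lebesgue"
      using test_function_continuous[OF assms]
      by (intro borel_measurable_lebesgue_if_borel borel_measurable_continuous_onI continuous_intros)
    show "integrable lebesgue (\<lambda>x::'a. B\<^sup>2 * indicator (ball 0 r) x)" by (rule integrable_indicator_ball)
    show "AE x in lebesgue. (cmod (complex_of_real (\<phi> x)))\<^sup>2 \<le> B\<^sup>2 * indicator (ball 0 r) x"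
    proof (intro AE_I2)
      fix x
      have "\<bar>\<phi> x\<bar>\<^sup>2 \<le> (B * indicator (ball 0 r) x)\<^sup>2" using B(2)[of x] by (intro power_mono) auto
      then show "(cmod (complex_of_real (\<phi> x)))\<^sup>2 \<le> B\<^sup>2 * indicator (ball 0 r) x"
        by (auto simp: indicator_def split: if_splits)
    qed
  qed
qed

text \<open>Box bumps tend to the indicator of the box and never exceed it, so dominated convergence
  applies with \<open>w\<close> cut off to the box as majorant, which is integrable by
  Cauchy-Schwarz although \<open>w\<close> itself need not be.\<close>

lemma box_integral_zero:
  fixes w :: "'a::euclidean_space L2"
  assumes "\<And>\<phi>. test_function \<phi> \<Longrightarrow> pairing \<phi> w = 0"
  shows "(LINT x|lebesgue. indicator (box a b) x * rep_L2 w x) = 0"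
proof -
  have w[measurable]: "rep_L2 w \<in> borel_measurable lebesgue"
    using square_integrable_rep[of w] unfolding square_integrable_def by blast
  have box: "box a b \<in> sets lebesgue" by (simp add: sets_completionI_sets)
  have int: "integrable lebesgue (\<lambda>x. indicator (box a b) x * rep_L2 w x)"
    by (rule integrable_indicator_box_mult)
  have "(\<lambda>n. LINT x|lebesgue. complex_of_real (box_bump a b (real (Suc n)) x) * rep_L2 w x)
     \<longlonglongrightarrow> (LINT x|lebesgue. indicator (box a b) x * rep_L2 w x)"
  proof (rule integral_dominated_convergence[where w = "\<lambda>x. norm (indicator (box a b) x * rep_L2 w x)"])
    show "integrable lebesgue (\<lambda>x. norm (indicator (box a b) x * rep_L2 w x))"
      using int by (rule integrable_norm)
    show "(\<lambda>x. complex_of_real (box_bump a b (real (Suc n)) x) * rep_L2 w x) \<in> borel_measurable lebesgue" for n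
      using square_integrable_test_function[OF test_function_box_bump[of "real (Suc n)" a b]]
      unfolding square_integrable_def by (intro borel_measurable_times w) auto
    show "AE x in lebesgue. (\<lambda>n. complex_of_real (box_bump a b (real (Suc n)) x) * rep_L2 w x)
        \<longlonglongrightarrow> indicator (box a b) x * rep_L2 w x"
    proof (intro AE_I2 tendsto_mult tendsto_const)
      fix x
      show "(\<lambda>n. complex_of_real (box_bump a b (real (Suc n)) x)) \<longlonglongrightarrow> indicator (box a b) x"
        using tendsto_of_real[OF box_bump_tendsto[of a b x], where 'a = complex]
        by (cases "x \<in> box a b") simp_all
    qed
    show "AE x in lebesgue. norm (complex_of_real (box_bump a b (real (Suc n)) x) * rep_L2 w x)
        \<le> norm (indicator (box a b) x * rep_L2 w x)" for n
    proof (intro AE_I2)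
      fix x
      show "norm (complex_of_real (box_bump a b (real (Suc n)) x) * rep_L2 w x)
        \<le> norm (indicator (box a b) x * rep_L2 w x)"
        using box_bump_bounds[of a b "real (Suc n)" x] box_bump_outside[of "real (Suc n)" x a b]
        by (cases "x \<in> box a b") (auto simp: norm_mult mult_left_le_one_le)
    qed
  qed (use int in auto)
  then show ?thesis using assms[OF test_function_box_bump] by (simp add: LIMSEQ_const_iff)
qed

lemma test_functions_total:
  fixes w :: "'a::euclidean_space L2"
  assumes "\<And>\<phi>. test_function \<phi> \<Longrightarrow> pairing \<phi> w = 0"
  shows "w = 0"
proof -
  have w: "rep_L2 w \<in> borel_measurable lebesgue"
    using square_integrable_rep[of w] unfolding square_integrable_def by blast
  \<comment> \<open>A Borel representative, because the argument with boxes concerns Borel sets and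
    \<open>lborel\<close>.\<close>
  obtain g where g[measurable]: "g \<in> borel_measurable borel" and wg: "AE x in lebesgue. rep_L2 w x = g x"
    using borel_representative[OF w] by blast
  have int: "integrable lborel (\<lambda>x. indicator (box a b) x * g x)" (is ?int)
    and zero: "(LINT x|lborel. indicator (box a b) x * g x) = 0" (is ?zero) for a b
  proof -
    have m: "(\<lambda>x. indicator (box a b) x * g x) \<in> borel_measurable lborel" by measurable
    have ae: "AE x in lebesgue. indicator (box a b) x * rep_L2 w x = indicator (box a b) x * g x"
      using wg by eventually_elim simp
    have "integrable lebesgue (\<lambda>x. indicator (box a b) x * rep_L2 w x)"
      by (rule integrable_indicator_box_mult)
    then have "integrable lebesgue (\<lambda>x. indicator (box a b) x * g x)"
      by (rule integrable_cong_AE_imp)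
        (use m ae in \<open>auto simp: measurable_completion elim: eventually_mono\<close>)
    then show ?int using m by (simp only: integrable_completion)
    have "(LINT x|lborel. indicator (box a b) x * g x) = (LINT x|lebesgue. indicator (box a b) x * g x)"
      using m by (simp only: integral_completion)
    also have "\<dots> = (LINT x|lebesgue. indicator (box a b) x * rep_L2 w x)"
      by (rule integral_cong_AE)
        (use m w ae in \<open>auto simp: measurable_completion sets_completionI_sets intro!: borel_measurable_times borel_measurable_indicator elim: eventually_mono\<close>)
    also have "\<dots> = 0" by (rule box_integral_zero[OF assms])
    finally show ?zero .
  qed
  \<comment> \<open>A square integrable function need not be integrable, so it is cut off to growing
    cubes; an intersection of boxes is a box, so the vanishing integrals survive the cut-off. The
    functional \<open>h\<close> stands for the real and for the imaginary part.\<close>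
  have key: "AE x in lborel. indicator (box (- real N *\<^sub>R One) (real N *\<^sub>R One)) x * h (g x) = 0"
    if h: "bounded_linear h" for N :: nat and h :: "complex \<Rightarrow> real"
  proof (rule AE_zero_if_box_integrals_zero_real)
    let ?Q = "box (- real N *\<^sub>R One) (real N *\<^sub>R One) :: 'a set"
    have h0: "h 0 = 0" using bounded_linear.linear[OF h] by (rule linear_0)
    have eq: "indicator (box a b) x * h (g x) = h (indicator (box a b) x * g x)" for a b x
      using h0 by (simp split: split_indicator)
    show "integrable lborel (\<lambda>x. indicator ?Q x * h (g x))"
      unfolding eq using int h by (rule integrable_bounded_linear[rotated])
    have *: "(LINT x|lborel. indicator (box a b) x * h (g x)) = 0" for a b
      unfolding eq by (subst integral_bounded_linear[OF h int]) (simp add: zero h0)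
    then show "(LINT x|lborel. indicator ?Q x * h (g x)) = 0" .
    fix a b
    have "(LINT x|lborel. indicator (box a b) x * (indicator ?Q x * h (g x)))
      = (LINT x|lborel. indicator (box a b \<inter> ?Q) x * h (g x))"
      by (rule Bochner_Integration.integral_cong) (auto split: split_indicator)
    also have "\<dots> = 0" unfolding box_Int_box by (rule *)
    finally show "(LINT x|lborel. indicator (box a b) x * (indicator ?Q x * h (g x))) = 0" .
  qed
  have "AE x in lborel. \<forall>N::nat. indicator (box (- real N *\<^sub>R One) (real N *\<^sub>R One)) x * Re (g x) = 0
      \<and> indicator (box (- real N *\<^sub>R One) (real N *\<^sub>R One)) x * Im (g x) = 0"
    unfolding AE_all_countable using key[OF bounded_linear_Re] key[OF bounded_linear_Im] by auto
  then have "AE x in lborel. g x = 0"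
  proof eventually_elim
    case (elim x)
    obtain N :: nat where N: "norm x < real N" using reals_Archimedean2 by blast
    have "x \<in> box (- real N *\<^sub>R One) (real N *\<^sub>R One)"
      unfolding mem_box
    proof
      fix i :: 'a assume "i \<in> Basis"
      then have "\<bar>x \<bullet> i\<bar> < real N" using Basis_le_norm[of i x] N by simp
      then show "(- real N *\<^sub>R One) \<bullet> i < x \<bullet> i \<and> x \<bullet> i < (real N *\<^sub>R One) \<bullet> i"
        using \<open>i \<in> Basis\<close> by (simp add: abs_less_iff)
    qed
    then show ?case using elim[rule_format, of N] by (simp add: complex_eq_iff)
  qed
  then have "AE x in lebesgue. g x = 0" by (rule AE_completion)
  with wg have "AE x in lebesgue. rep_L2 w x = 0" by eventually_elim simp
  then have "abs_L2 (rep_L2 w) = abs_L2 (\<lambda>x. 0)" by (intro abs_L2_eqI) auto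
  then show ?thesis by (simp add: zero_L2_def)
qed

lemma test_function_add: "test_function \<phi> \<Longrightarrow> test_function \<psi> \<Longrightarrow> test_function (\<lambda>x. \<phi> x + \<psi> x)"
  unfolding test_function_def
proof (intro conjI, blast intro: C_k_add, elim conjE exE)
  fix K K' assume "compact K" "\<forall>x. x \<notin> K \<longrightarrow> \<phi> x = 0" "compact K'" "\<forall>x. x \<notin> K' \<longrightarrow> \<psi> x = 0"
  then show "\<exists>K. compact K \<and> (\<forall>x. x \<notin> K \<longrightarrow> \<phi> x + \<psi> x = 0)"
    by (intro exI[of _ "K \<union> K'"]) (auto intro: compact_Un)
qed

lemma test_function_scale: "test_function \<phi> \<Longrightarrow> test_function (\<lambda>x. c * \<phi> x)"
  unfolding test_function_def using C_k_scale by fastforce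

lemma test_function_zero: "test_function (\<lambda>x. 0)"
  using C_k_const by (auto simp: test_function_def)

lemma test_function_translate:
  assumes "test_function \<phi>" shows "test_function (\<lambda>x. \<phi> (x - c))"
proof -
  obtain K where K: "compact K" "\<forall>x. x \<notin> K \<longrightarrow> \<phi> x = 0" using assms unfolding test_function_def by blast
  have "compact ((+) c ` K)" using K by (intro compact_translation)
  moreover have "\<phi> (x - c) = 0" if "x \<notin> (+) c ` K" for x
    using K that by (metis add.commute diff_add_cancel image_eqI)
  ultimately show ?thesis
    using assms C_k_translate unfolding test_function_def by blast
qed

text \<open>Test functions are real-valued; the combination \<phi> + i \<psi> provides a subspace
  that is dense in the complex space.\<close>

definition test_L2 :: "('a::euclidean_space \<Rightarrow> real) \<Rightarrow> ('a \<Rightarrow> real) \<Rightarrow> 'a L2"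
  where "test_L2 \<phi> \<psi> = abs_L2 (\<lambda>x. complex_of_real (\<phi> x) + \<i> * complex_of_real (\<psi> x))"

lemma square_integrable_test_L2:
  "test_function \<phi> \<Longrightarrow> test_function \<psi> \<Longrightarrow> square_integrable (\<lambda>x. complex_of_real (\<phi> x) + \<i> * complex_of_real (\<psi> x))"
  by (intro square_integrable_add square_integrable_scale square_integrable_test_function)

lemma cinner_test_L2:
  assumes "test_function \<phi>" "test_function \<psi>"
  shows "cinner (test_L2 \<phi> \<psi>) w = pairing \<phi> w
    - \<i> * pairing \<psi> w"
proof -
  have int: "integrable lebesgue (\<lambda>x. complex_of_real (\<phi> x) * rep_L2 w x)" if "test_function \<phi>" for \<phi>
    using integrable_cnj_mult[OF square_integrable_test_function[OF that] square_integrable_rep[of w]] by simp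
  have "cinner (test_L2 \<phi> \<psi>) (abs_L2 (rep_L2 w)) =
    (LINT x|lebesgue. cnj (complex_of_real (\<phi> x) + \<i> * complex_of_real (\<psi> x)) * rep_L2 w x)"
    unfolding test_L2_def by (rule cinner_abs) (use assms in \<open>auto intro: square_integrable_test_L2\<close>)
  also have "\<dots> = (LINT x|lebesgue. complex_of_real (\<phi> x) * rep_L2 w x - \<i> * (complex_of_real (\<psi> x) * rep_L2 w x))"
    by (rule Bochner_Integration.integral_cong) (auto simp: algebra_simps)
  also have "\<dots> = pairing \<phi> w
    - \<i> * pairing \<psi> w"
    using int[OF assms(1)] int[OF assms(2)] by simp
  finally show ?thesis by simp
qed

text \<open>Duality with a dense subspace: test functions approximate \<open>w\<close> itself, and
  in the limit the pairing becomes the square of \<open>norm w\<close>.\<close>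

lemma norm_le_if_test_bound:
  fixes w :: "'a::euclidean_space L2"
  assumes "C \<ge> 0" and bound: "\<And>\<phi> \<psi>. test_function \<phi> \<Longrightarrow> test_function \<psi> \<Longrightarrow> cmod (cinner (test_L2 \<phi> \<psi>) w) \<le> C * norm (test_L2 \<phi> \<psi>)"
  shows "norm w \<le> C"
proof -
  define S :: "'a L2 set" where "S = {test_L2 \<phi> \<psi> | \<phi> \<psi>. test_function \<phi> \<and> test_function \<psi>}"
  have subS: "subspace S"
    unfolding subspace_def
  proof (intro conjI ballI allI)
    show "0 \<in> S" unfolding S_def test_L2_def
      by (auto simp: zero_L2_def intro!: exI[of _ "\<lambda>x. 0"] test_function_zero)
    fix f assume f: "f \<in> S"
    then obtain \<phi> \<psi> where 1: "f = test_L2 \<phi> \<psi>" "test_function \<phi>" "test_function \<psi>" by (auto simp: S_def)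
    show "c *\<^sub>R f \<in> S" for c
    proof -
      have "c *\<^sub>R f = test_L2 (\<lambda>x. c * \<phi> x) (\<lambda>x. c * \<psi> x)"
        unfolding 1 test_L2_def scaleR_L2_def using 1
        by (subst scaleC.abs_eq) (auto simp: square_integrable_test_L2 algebra_simps)
      then show ?thesis using 1 test_function_scale unfolding S_def by blast
    qed
    fix g assume "g \<in> S"
    then obtain \<phi>' \<psi>' where 2: "g = test_L2 \<phi>' \<psi>'" "test_function \<phi>'" "test_function \<psi>'" by (auto simp: S_def)
    have "f + g = test_L2 (\<lambda>x. \<phi> x + \<phi>' x) (\<lambda>x. \<psi> x + \<psi>' x)"
      unfolding 1 2 test_L2_def using 1 2
      by (subst plus_L2.abs_eq) (auto simp: square_integrable_test_L2 algebra_simps)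
    then show "f + g \<in> S" using 1 2 test_function_add unfolding S_def by blast
  qed
  obtain p where p: "p \<in> closure S" "\<And>m. m \<in> closure S \<Longrightarrow> m \<bullet> (w - p) = 0"
    using hilbert_projection_ex[OF closed_closure closure_subspace[OF subS]] by blast
  \<comment> \<open>The remainder is orthogonal to \<phi> and to i \<phi> in the real inner product,
    which gives the real and the imaginary part of its pairing with \<phi>.\<close>
  have "w - p = 0"
  proof (rule test_functions_total)
    fix \<phi> :: "'a \<Rightarrow> real" assume \<phi>: "test_function \<phi>"
    have "test_L2 \<phi> (\<lambda>x. 0) \<in> closure S" "test_L2 (\<lambda>x. 0) \<phi> \<in> closure S"
      using \<phi> test_function_zero closure_subset[of S] unfolding S_def by blast+
    then have "test_L2 \<phi> (\<lambda>x. 0) \<bullet> (w - p) = 0" "test_L2 (\<lambda>x. 0) \<phi> \<bullet> (w - p) = 0" using p(2) by blast+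
    then show "pairing \<phi> (w - p) = 0"
      using cinner_test_L2[OF \<phi> test_function_zero, of "w - p"] cinner_test_L2[OF test_function_zero \<phi>, of "w - p"]
      by (simp add: inner_L2_def complex_eq_iff)
  qed
  then have "w \<in> closure S" using p by simp
  then obtain t where t: "\<And>n. t n \<in> S" "t \<longlonglongrightarrow> w" unfolding closure_sequential by blast
  have "(norm w)\<^sup>2 \<le> C * norm w"
  proof (rule LIMSEQ_le)
    show "(\<lambda>n. t n \<bullet> w) \<longlonglongrightarrow> (norm w)\<^sup>2"
      unfolding power2_norm_eq_inner by (intro tendsto_intros t)
    show "(\<lambda>n. C * norm (t n)) \<longlonglongrightarrow> C * norm w" by (intro tendsto_intros t)
    have "t n \<bullet> w \<le> C * norm (t n)" for n
    proof -
      obtain \<phi> \<psi> where *: "t n = test_L2 \<phi> \<psi>" "test_function \<phi>" "test_function \<psi>"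
        using t(1)[of n] by (auto simp: S_def)
      have "t n \<bullet> w \<le> cmod (cinner (t n) w)" unfolding inner_L2_def by (rule complex_Re_le_cmod)
      then show ?thesis using bound[OF *(2,3)] *(1) by simp
    qed
    then show "\<exists>N. \<forall>n\<ge>N. t n \<bullet> w \<le> C * norm (t n)" by blast
  qed
  then have *: "norm w * norm w \<le> C * norm w" by (simp add: power2_eq_square)
  show ?thesis
  proof (cases "w = 0")
    case True
    then show ?thesis using \<open>C \<ge> 0\<close> by simp
  next
    case False
    then show ?thesis using * by simp
  qed
qed

section \<open>Translations and weak derivatives\<close>

lemma distr_lebesgue_translation:
  fixes h :: "'a::euclidean_space"
  shows "(\<lambda>x. x + h) \<in> lebesgue \<rightarrow>\<^sub>M lebesgue" "distr lebesgue lebesgue (\<lambda>x. x + h) = lebesgue"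
proof -
  have eq: "(\<lambda>x. h + (\<Sum>j\<in>Basis. (1 * (x \<bullet> j)) *\<^sub>R j)) = (\<lambda>x. x + h)"
    by (simp add: euclidean_representation add.commute)
  show "(\<lambda>x. x + h) \<in> lebesgue \<rightarrow>\<^sub>M lebesgue"
    using lebesgue_affine_measurable[of "\<lambda>_. 1" h] unfolding eq by simp
  have "lebesgue = density (distr lebesgue lebesgue (\<lambda>x. x + h)) (\<lambda>_. \<Prod>j\<in>(Basis::'a set). \<bar>1::real\<bar>)"
    using lebesgue_affine_euclidean[of "\<lambda>_. 1" h] unfolding eq by simp
  then show "distr lebesgue lebesgue (\<lambda>x. x + h) = lebesgue" by (simp add: density_1)
qed

lemma AE_lebesgue_translation:
  "AE x in lebesgue. P x \<Longrightarrow> AE x in lebesgue. P (x + h :: 'a::euclidean_space)"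
  by (rule AE_distrD[OF distr_lebesgue_translation(1)]) (simp only: distr_lebesgue_translation(2))

lemma borel_measurable_lebesgue_translation:
  "f \<in> borel_measurable lebesgue \<Longrightarrow> (\<lambda>x. f (x + h :: 'a::euclidean_space)) \<in> borel_measurable lebesgue"
  by (rule measurable_compose[OF distr_lebesgue_translation(1)])

lemma integral_lebesgue_translation:
  fixes f :: "'a::euclidean_space \<Rightarrow> 'b::{banach,second_countable_topology}"
  assumes "f \<in> borel_measurable lebesgue"
  shows "(LINT x|lebesgue. f (x + h)) = (LINT x|lebesgue. f x)"
  using integral_distr[OF distr_lebesgue_translation(1), of f h] assms
  by (simp add: distr_lebesgue_translation(2))

lemma integrable_lebesgue_translation:
  fixes f :: "'a::euclidean_space \<Rightarrow> 'b::{banach,second_countable_topology}"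
  assumes "integrable lebesgue f" shows "integrable lebesgue (\<lambda>x. f (x + h))"
  using integrable_distr_eq[OF distr_lebesgue_translation(1), of f h] assms
  by (simp add: distr_lebesgue_translation(2))

lemma square_integrable_translation:
  "square_integrable f \<Longrightarrow> square_integrable (\<lambda>x. f (x + h))"
  unfolding square_integrable_def
  using borel_measurable_lebesgue_translation integrable_lebesgue_translation[of "\<lambda>x. (cmod (f x))\<^sup>2"] by blast

definition shift :: "'a::euclidean_space \<Rightarrow> 'a L2 \<Rightarrow> 'a L2"
  where "shift h f = abs_L2 (\<lambda>x. rep_L2 f (x + h))"

lemma shift_abs:
  assumes "square_integrable f" shows "shift h (abs_L2 f) = abs_L2 (\<lambda>x. f (x + h))"
  unfolding shift_def
  by (intro abs_L2_eqI square_integrable_translation square_integrable_rep assms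
      AE_lebesgue_translation rep_abs_L2)

lemma cinner_shift: "cinner (shift h f) (shift h g) = cinner f g"
proof -
  have "cinner (shift h f) (shift h g) = (LINT x|lebesgue. cnj (rep_L2 f (x + h)) * rep_L2 g (x + h))"
    unfolding shift_def by (intro cinner_abs square_integrable_translation square_integrable_rep)
  also have "\<dots> = cinner f g" unfolding cinner_rep
    by (rule integral_lebesgue_translation)
      (rule borel_measurable_integrable[OF integrable_cnj_mult[OF square_integrable_rep square_integrable_rep]])
  finally show ?thesis .
qed

lemma norm_shift: "norm (shift h f) = norm f"
  using cinner_shift[of h f f] by (simp add: norm_L2_def inner_L2_def)

lemma shift_diff: "shift h (f - g) = shift h f - shift h g"
proof -
  have "f - g = abs_L2 (\<lambda>x. rep_L2 f x - rep_L2 g x)"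
    using minus_L2.abs_eq[of "rep_L2 f" "rep_L2 g"] by simp
  then have "shift h (f - g) = abs_L2 (\<lambda>x. rep_L2 f (x + h) - rep_L2 g (x + h))"
    by (simp add: shift_abs square_integrable_diff)
  also have "\<dots> = shift h f - shift h g" unfolding shift_def
    by (subst minus_L2.abs_eq) (auto intro: square_integrable_translation)
  finally show ?thesis .
qed

lemma shift_shift: "shift h (shift k f) = shift (h + k) f"
proof -
  have "shift h (shift k f) = abs_L2 (\<lambda>x. rep_L2 f (x + h + k))"
    unfolding shift_def[of k] by (intro shift_abs square_integrable_translation square_integrable_rep)
  then show ?thesis by (simp add: shift_def add.assoc)
qed

lemma shift_0: "shift 0 f = f" by (simp add: shift_def)

section \<open>Weak derivatives and the cost of a translation\<close>

lemma test_function_partial_deriv: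
  assumes "test_function \<phi>" "b \<in> Basis" shows "test_function (partial_deriv b \<phi>)"
  unfolding test_function_def
proof
  show "\<forall>k. C_k k (partial_deriv b \<phi>)" using assms unfolding test_function_def by (metis C_k.simps(2))
  obtain K where K: "compact K" "\<And>x. x \<notin> K \<Longrightarrow> \<phi> x = 0" using assms unfolding test_function_def by blast
  have "partial_deriv b \<phi> x = 0" if x: "x \<notin> K" for x
  proof -
    have "(\<phi> has_derivative (\<lambda>h. 0)) (at x)"
      by (rule has_derivative_transform_within_open[of "\<lambda>x. 0" _ _ _ "- K"])
        (use K x compact_imp_closed in \<open>auto simp: open_Compl\<close>)
    then show ?thesis by (rule partial_deriv_eq)
  qed
  then show "\<exists>K. compact K \<and> (\<forall>x. x \<notin> K \<longrightarrow> partial_deriv b \<phi> x = 0)" using K by blast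
qed

lemma test_function_line_deriv:
  assumes "test_function \<phi>"
  shows "((\<lambda>t. \<phi> (y - t *\<^sub>R b)) has_field_derivative - partial_deriv b \<phi> (y - t *\<^sub>R b)) (at t)"
proof -
  let ?D = "frechet_derivative \<phi> (at (y - t *\<^sub>R b))"
  have d: "(\<phi> has_derivative ?D) (at (y - t *\<^sub>R b))"
    by (rule has_derivative_frechet[OF test_function_differentiable[OF assms]])
  have "((\<lambda>t. \<phi> (y - t *\<^sub>R b)) has_derivative (\<lambda>h. ?D (- h *\<^sub>R b))) (at t)"
    by (rule has_derivative_compose[of "\<lambda>t. y - t *\<^sub>R b", OF _ d]) (auto intro!: derivative_eq_intros)
  moreover have "(\<lambda>h. ?D (- h *\<^sub>R b)) = (*) (- partial_deriv b \<phi> (y - t *\<^sub>R b))"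
    using linear_scale[OF has_derivative_linear[OF d], of "- h" b for h]
    by (auto simp: partial_deriv_def fun_eq_iff)
  ultimately show ?thesis by (simp add: has_field_derivative_def)
qed

lemma test_function_line_lipschitz:
  assumes "test_function \<phi>" and L: "\<And>x. \<bar>partial_deriv b \<phi> x\<bar> \<le> L"
  shows "\<bar>\<phi> (y - s *\<^sub>R b) - \<phi> (y - t *\<^sub>R b)\<bar> \<le> L * \<bar>s - t\<bar>"
  using field_differentiable_bound[of UNIV "\<lambda>t. \<phi> (y - t *\<^sub>R b)" "\<lambda>t. - partial_deriv b \<phi> (y - t *\<^sub>R b)" L s t]
    test_function_line_deriv[OF assms(1)] L by (simp add: has_field_derivative_at_within)

text \<open>Differentiation under the integral moves the derivative onto the test function, with a
  minus sign from \<open>x - t *\<^sub>R b\<close>; the minus sign in the definition of the weak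
  derivative \<open>g\<close> cancels it.\<close>

lemma test_pairing_deriv:
  fixes u :: "'a::euclidean_space L2"
  assumes \<phi>: "test_function \<phi>" and b: "b \<in> Basis" and g: "has_weak_partial b u g"
  shows "((\<lambda>s. (pairing (\<lambda>x. \<phi> (x - s *\<^sub>R b)) u -
      pairing (\<lambda>x. \<phi> (x - t *\<^sub>R b)) u) /\<^sub>R (s - t))
    \<longlongrightarrow> pairing (\<lambda>x. \<phi> (x - t *\<^sub>R b)) g) (at t)"
  unfolding tendsto_at_iff_sequentially o_def
proof (intro allI impI)
  fix X :: "nat \<Rightarrow> real" assume X: "\<forall>i. X i \<in> UNIV - {t}" "X \<longlonglongrightarrow> t"
  obtain K where K: "compact K" "\<And>x. x \<notin> K \<Longrightarrow> \<phi> x = 0" using \<phi> unfolding test_function_def by blast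
  obtain r where r: "K \<subseteq> ball 0 r" using bounded_subset_ballD[OF compact_imp_bounded[OF K(1)]] by metis
  have \<phi>': "test_function (partial_deriv b \<phi>)" by (rule test_function_partial_deriv[OF \<phi> b])
  then obtain K' where K': "compact K'" "\<And>x. x \<notin> K' \<Longrightarrow> partial_deriv b \<phi> x = 0" unfolding test_function_def by blast
  obtain L r' where L: "L \<ge> 0" "\<And>x. \<bar>partial_deriv b \<phi> x\<bar> \<le> L * indicator (ball 0 r') x"
    using test_function_bounded[OF test_function_continuous[OF \<phi>'] K'] by metis
  have L': "\<bar>partial_deriv b \<phi> x\<bar> \<le> L" for x
    using order_trans[OF L(2)[of x]] L(1) by (auto simp: indicator_def split: if_splits)
  have "Bseq X" using X(2) by (intro convergent_imp_Bseq) (auto simp: convergent_def)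
  then obtain c where c: "\<And>n. \<bar>X n\<bar> \<le> c" by (auto simp: Bseq_def)
  have ct: "\<bar>t\<bar> \<le> c" using LIMSEQ_le_const2[OF tendsto_rabs[OF X(2)]] c by blast
  define q where "q n x = (\<phi> (x - X n *\<^sub>R b) - \<phi> (x - t *\<^sub>R b)) / (X n - t)" for n x
  have sq: "square_integrable (\<lambda>x. complex_of_real (\<phi> (x - s *\<^sub>R b)))" for s
    by (intro square_integrable_test_function test_function_translate \<phi>)
  have int: "integrable lebesgue (\<lambda>x. complex_of_real (\<phi> (x - s *\<^sub>R b)) * rep_L2 u x)" for s
    using integrable_cnj_mult[OF sq square_integrable_rep] by simp
  have eq: "(pairing (\<lambda>x. \<phi> (x - X n *\<^sub>R b)) u -
      pairing (\<lambda>x. \<phi> (x - t *\<^sub>R b)) u) /\<^sub>R (X n - t)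
    = (LINT x|lebesgue. complex_of_real (q n x) * rep_L2 u x)" for n
  proof -
    have "(LINT x|lebesgue. complex_of_real (q n x) * rep_L2 u x) =
      (LINT x|lebesgue. inverse (X n - t) *\<^sub>R (complex_of_real (\<phi> (x - X n *\<^sub>R b)) * rep_L2 u x - complex_of_real (\<phi> (x - t *\<^sub>R b)) * rep_L2 u x))"
      by (rule Bochner_Integration.integral_cong)
        (auto simp: q_def scaleR_conv_of_real divide_inverse algebra_simps)
    also have "\<dots> = inverse (X n - t) *\<^sub>R (LINT x|lebesgue. complex_of_real (\<phi> (x - X n *\<^sub>R b)) * rep_L2 u x - complex_of_real (\<phi> (x - t *\<^sub>R b)) * rep_L2 u x)"
      by (rule integral_scaleR_right)
    finally show ?thesis using int by simp
  qed
  \<comment> \<open>One ball that contains the supports of all translates of \<phi> by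
    \<open>s *\<^sub>R b\<close> with |s| \<le> c, hence those of all quotients \<open>q n\<close>.
    As \<open>u\<close> is square integrable, \<open>L\<close> times \<open>u\<close> on this ball
    is an integrable majorant.\<close>
  define S where "S = ball (0::'a) (r + c * norm b)"
  have q0: "\<bar>q n x\<bar> \<le> L * indicator S x" for n x
  proof (cases "x \<in> S")
    case True
    have "\<bar>\<phi> (x - X n *\<^sub>R b) - \<phi> (x - t *\<^sub>R b)\<bar> \<le> L * \<bar>X n - t\<bar>"
      by (rule test_function_line_lipschitz[OF \<phi> L'])
    moreover have "X n \<noteq> t" using X(1) by blast
    ultimately have "\<bar>q n x\<bar> \<le> L" by (simp add: q_def abs_divide pos_divide_le_eq)
    then show ?thesis using True by simp
  next
    case False
    have z: "\<phi> (x - s *\<^sub>R b) = 0" if "\<bar>s\<bar> \<le> c" for s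
    proof (rule K(2), rule notI)
      assume "x - s *\<^sub>R b \<in> K"
      then have "norm (x - s *\<^sub>R b) < r" using r by auto
      moreover have "norm (s *\<^sub>R b) \<le> c * norm b" using that by (simp add: mult_right_mono)
      moreover have "norm x \<le> norm (x - s *\<^sub>R b) + norm (s *\<^sub>R b)"
        using norm_triangle_ineq[of "x - s *\<^sub>R b" "s *\<^sub>R b"] by simp
      ultimately show False using False by (simp add: S_def)
    qed
    show ?thesis using z[OF c[of n]] z[OF ct] False by (simp add: q_def)
  qed
  have u: "rep_L2 u \<in> borel_measurable lebesgue"
    using square_integrable_rep[of u] unfolding square_integrable_def by blast
  have "(\<lambda>n. LINT x|lebesgue. complex_of_real (q n x) * rep_L2 u x)
    \<longlonglongrightarrow> (LINT x|lebesgue. complex_of_real (- partial_deriv b \<phi> (x - t *\<^sub>R b)) * rep_L2 u x)"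
  proof (rule integral_dominated_convergence[where w = "\<lambda>x. norm (cnj (complex_of_real L * indicator (UNIV \<inter> S) x) * rep_L2 u x)"])
    show "integrable lebesgue (\<lambda>x. norm (cnj (complex_of_real L * indicator (UNIV \<inter> S) x) * rep_L2 u x))"
      unfolding S_def by (intro integrable_norm integrable_cnj_mult square_integrable_rep square_integrable_indicator_ball) (simp add: sets_completionI_sets)
    show "(\<lambda>x. complex_of_real (q n x) * rep_L2 u x) \<in> borel_measurable lebesgue" for n
    proof (intro borel_measurable_times u)
      have "continuous_on UNIV (\<lambda>x. \<phi> (x - s *\<^sub>R b))" for s
        by (intro test_function_continuous test_function_translate \<phi>)
      then have "continuous_on UNIV (\<lambda>x. complex_of_real (q n x))"
        unfolding q_def using X(1) by (intro continuous_intros) auto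
      then show "(\<lambda>x. complex_of_real (q n x)) \<in> borel_measurable lebesgue"
        by (intro borel_measurable_lebesgue_if_borel borel_measurable_continuous_onI)
    qed
    have "continuous_on UNIV (\<lambda>x. complex_of_real (- partial_deriv b \<phi> (x - t *\<^sub>R b)))"
      by (intro continuous_intros test_function_continuous test_function_translate \<phi>')
    then show "(\<lambda>x. complex_of_real (- partial_deriv b \<phi> (x - t *\<^sub>R b)) * rep_L2 u x) \<in> borel_measurable lebesgue"
      by (intro borel_measurable_times u borel_measurable_lebesgue_if_borel borel_measurable_continuous_onI)
    show "AE x in lebesgue. (\<lambda>n. complex_of_real (q n x) * rep_L2 u x)
        \<longlonglongrightarrow> complex_of_real (- partial_deriv b \<phi> (x - t *\<^sub>R b)) * rep_L2 u x"
    proof (intro AE_I2 tendsto_mult tendsto_of_real tendsto_const)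
      fix x
      have "((\<lambda>s. (\<phi> (x - s *\<^sub>R b) - \<phi> (x - t *\<^sub>R b)) / (s - t)) \<longlongrightarrow> - partial_deriv b \<phi> (x - t *\<^sub>R b)) (at t)"
        using test_function_line_deriv[OF \<phi>] by (simp add: has_field_derivative_iff)
      then show "(\<lambda>n. q n x) \<longlonglongrightarrow> - partial_deriv b \<phi> (x - t *\<^sub>R b)"
        using X unfolding tendsto_at_iff_sequentially o_def q_def by blast
    qed
    show "AE x in lebesgue. norm (complex_of_real (q n x) * rep_L2 u x)
        \<le> norm (cnj (complex_of_real L * indicator (UNIV \<inter> S) x) * rep_L2 u x)" for n
    proof (intro AE_I2)
      fix x
      have "norm (complex_of_real (q n x)) \<le> norm (cnj (complex_of_real L * indicator (UNIV \<inter> S) x))"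
        using q0[of n x] L(1) by (cases "x \<in> S") (simp_all add: norm_mult)
      then show "norm (complex_of_real (q n x) * rep_L2 u x)
        \<le> norm (cnj (complex_of_real L * indicator (UNIV \<inter> S) x) * rep_L2 u x)"
        unfolding norm_mult by (intro mult_right_mono) auto
    qed
  qed
  moreover have "(LINT x|lebesgue. complex_of_real (- partial_deriv b \<phi> (x - t *\<^sub>R b)) * rep_L2 u x)
     = pairing (\<lambda>x. \<phi> (x - t *\<^sub>R b)) g"
  proof -
    have "(LINT x|lebesgue. complex_of_real (partial_deriv b (\<lambda>x. \<phi> (x - t *\<^sub>R b)) x) * rep_L2 u x)
      = - pairing (\<lambda>x. \<phi> (x - t *\<^sub>R b)) g"
      using g test_function_translate[OF \<phi>] unfolding has_weak_partial_def by blast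
    then show ?thesis
      by (simp add: partial_deriv_translate[OF test_function_differentiable[OF \<phi>]])
  qed
  ultimately show "(\<lambda>n. (pairing (\<lambda>x. \<phi> (x - X n *\<^sub>R b)) u -
      pairing (\<lambda>x. \<phi> (x - t *\<^sub>R b)) u) /\<^sub>R (X n - t))
    \<longlonglongrightarrow> pairing (\<lambda>x. \<phi> (x - t *\<^sub>R b)) g"
    unfolding eq by simp
qed

text \<open>Duality takes the place of smoothing \<open>u\<close>: the pairing of a translated test
  function with \<open>u\<close> has its pairing with \<open>g\<close> as derivative, which is at
  most \<open>norm g * norm P\<close>. The mean value bound gives the factor \<bar>s\<bar>, and the
  translation is then moved onto \<open>u\<close>.\<close>

lemma norm_shift_basis_le:
  fixes u :: "'a::euclidean_space L2"
  assumes b: "b \<in> Basis" and g: "has_weak_partial b u g"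
  shows "norm (shift (s *\<^sub>R b) u - u) \<le> \<bar>s\<bar> * norm g"
proof (rule norm_le_if_test_bound)
  fix \<phi> \<psi> :: "'a \<Rightarrow> real" assume \<phi>\<psi>: "test_function \<phi>" "test_function \<psi>"
  define P where "P = test_L2 \<phi> \<psi>"
  have shP: "shift (- t *\<^sub>R b) P = test_L2 (\<lambda>x. \<phi> (x - t *\<^sub>R b)) (\<lambda>x. \<psi> (x - t *\<^sub>R b))" for t
    unfolding P_def test_L2_def by (subst shift_abs) (auto simp: square_integrable_test_L2 \<phi>\<psi>)
  define N where "N v t = cinner (shift (- t *\<^sub>R b) P) v" for v t
  have N_eq: "N v t = pairing (\<lambda>x. \<phi> (x - t *\<^sub>R b)) v
    - \<i> * pairing (\<lambda>x. \<psi> (x - t *\<^sub>R b)) v" for v t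
    unfolding N_def shP by (intro cinner_test_L2 test_function_translate \<phi>\<psi>)
  have lim: "((\<lambda>s. (N u s - N u t) /\<^sub>R (s - t)) \<longlongrightarrow> N g t) (at t)" for t
  proof -
    note tendsto_diff[OF test_pairing_deriv[OF \<phi>\<psi>(1) b g, of t] tendsto_mult_left[OF test_pairing_deriv[OF \<phi>\<psi>(2) b g, of t], of \<i>]]
    then show ?thesis unfolding N_eq by (simp add: scaleR_diff_right algebra_simps)
  qed
  have N_le: "cmod (N g t) \<le> norm g * norm P" for t
    unfolding N_def using norm_cinner_le[of "shift (- t *\<^sub>R b) P" g] by (simp add: norm_shift mult.commute)
  \<comment> \<open>A fixed phase makes the increment of \<open>N u\<close> between 0 and
    \<open>s\<close> real and nonnegative, so that it is controlled by a real derivative.\<close>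
  define c where "c = cnj (sgn (N u s - N u 0))"
  have c1: "cmod c \<le> 1" by (simp add: c_def norm_sgn)
  define n where "n t = Re (c * N u t)" for t
  have "(n has_field_derivative Re (c * N g t)) (at t)" for t
  proof -
    have "((\<lambda>s. Re (c * ((N u s - N u t) /\<^sub>R (s - t)))) \<longlongrightarrow> Re (c * N g t)) (at t)"
      by (intro tendsto_intros lim)
    then show ?thesis unfolding has_field_derivative_iff n_def
      by (simp add: algebra_simps divide_inverse)
  qed
  moreover have "\<bar>Re (c * N g t)\<bar> \<le> norm g * norm P" for t
  proof -
    have "\<bar>Re (c * N g t)\<bar> \<le> cmod c * cmod (N g t)" using abs_Re_le_cmod[of "c * N g t"] by (simp add: norm_mult)
    also have "\<dots> \<le> 1 * (norm g * norm P)" by (intro mult_mono c1 N_le) auto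
    finally show ?thesis by simp
  qed
  ultimately have "\<bar>n s - n 0\<bar> \<le> norm g * norm P * \<bar>s - 0\<bar>"
    using field_differentiable_bound[of UNIV n "\<lambda>t. Re (c * N g t)" "norm g * norm P" s 0]
    by (simp add: has_field_derivative_at_within)
  moreover have "n s - n 0 = cmod (N u s - N u 0)"
  proof -
    have "c * (N u s - N u 0) = complex_of_real (cmod (N u s - N u 0))"
      unfolding c_def by (rule cnj_sgn_mult_self)
    then have "Re (c * (N u s - N u 0)) = cmod (N u s - N u 0)" by simp
    then show ?thesis by (simp add: n_def algebra_simps)
  qed
  moreover have "N u s = cinner P (shift (s *\<^sub>R b) u)"
    unfolding N_def using cinner_shift[of "s *\<^sub>R b" "shift (- s *\<^sub>R b) P" u] by (simp add: shift_shift shift_0)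
  moreover have "N u 0 = cinner P u" by (simp add: N_def shift_0)
  ultimately show "cmod (cinner (test_L2 \<phi> \<psi>) (shift (s *\<^sub>R b) u - u)) \<le> \<bar>s\<bar> * norm g * norm (test_L2 \<phi> \<psi>)"
    by (simp add: P_def cinner_diff_right algebra_simps)
qed simp

section \<open>The spectral gap\<close>

text \<open>The translation is carried out one coordinate direction after another; since
  translations are isometries, the costs add up.\<close>

lemma norm_shift_le:
  fixes u :: "'a::euclidean_space L2"
  assumes g: "\<And>b. b \<in> Basis \<Longrightarrow> has_weak_partial b u (g b)"
    and h: "\<And>b. b \<in> Basis \<Longrightarrow> \<bar>h \<bullet> b\<bar> \<le> R"
  shows "norm (shift h u - u) \<le> (\<Sum>b\<in>Basis. R * norm (g b))"
proof -
  have "norm (shift (\<Sum>b\<in>I. (h \<bullet> b) *\<^sub>R b) u - u) \<le> (\<Sum>b\<in>I. R * norm (g b))"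
    if "finite I" "I \<subseteq> Basis" for I
    using that
  proof (induction I)
    case empty
    then show ?case by (simp add: shift_0)
  next
    case (insert b I)
    let ?k = "\<Sum>b\<in>I. (h \<bullet> b) *\<^sub>R b" and ?l = "(h \<bullet> b) *\<^sub>R b"
    have "shift (\<Sum>b\<in>insert b I. (h \<bullet> b) *\<^sub>R b) u - u = shift ?k (shift ?l u - u) + (shift ?k u - u)"
      using insert by (simp add: shift_diff shift_shift add.commute)
    also have "norm \<dots> \<le> norm (shift ?k (shift ?l u - u)) + norm (shift ?k u - u)"
      by (rule norm_triangle_ineq)
    also have "\<dots> \<le> \<bar>h \<bullet> b\<bar> * norm (g b) + (\<Sum>b\<in>I. R * norm (g b))"
      unfolding norm_shift using insert by (intro add_mono norm_shift_basis_le g) auto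
    also have "\<dots> \<le> R * norm (g b) + (\<Sum>b\<in>I. R * norm (g b))"
      using insert by (intro add_mono mult_right_mono h) auto
    finally show ?case using insert by simp
  qed
  from this[of Basis] show ?thesis by (simp add: euclidean_representation)
qed

lemma has_weak_partial_weak_partial:
  "u \<in> W12 \<Longrightarrow> b \<in> Basis \<Longrightarrow> has_weak_partial b u (weak_partial b u)"
  unfolding W12_def weak_partial_def by (metis (mono_tags, lifting) mem_Collect_eq someI_ex)

lemma norm_L2_square: "(norm f)\<^sup>2 = (LINT x|lebesgue. (cmod (rep_L2 f x))\<^sup>2)"
  using norm_abs_L2[OF square_integrable_rep, of f] unfolding abs_rep_L2 .

lemma dirichlet_energy_eq: "dirichlet_energy u = (\<Sum>b\<in>Basis. (norm (weak_partial b u))\<^sup>2)"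
proof -
  have "dirichlet_energy u = (\<Sum>b\<in>Basis. LINT x|lebesgue. (cmod (rep_L2 (weak_partial b u) x))\<^sup>2)"
    unfolding dirichlet_energy_def
    by (rule Bochner_Integration.integral_sum) (use square_integrable_rep in \<open>auto simp: square_integrable_def\<close>)
  then show ?thesis by (simp only: norm_L2_square)
qed

lemma norm_shift_square_le:
  fixes u :: "'a::euclidean_space L2"
  assumes u: "u \<in> W12" and h: "\<And>b. b \<in> Basis \<Longrightarrow> \<bar>h \<bullet> b\<bar> \<le> R"
  shows "(norm (shift h u - u))\<^sup>2 \<le> R\<^sup>2 * real DIM('a) * dirichlet_energy u"
proof -
  have "(norm (shift h u - u))\<^sup>2 \<le> (\<Sum>b\<in>(Basis::'a set). R * norm (weak_partial b u))\<^sup>2"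
    by (intro power_mono norm_shift_le has_weak_partial_weak_partial u h) auto
  \<comment> \<open>Cauchy-Schwarz over the coordinate directions is the source of the factor
    \<open>DIM('a)\<close>.\<close>
  also have "\<dots> \<le> (\<Sum>b\<in>(Basis::'a set). R\<^sup>2) * (\<Sum>b\<in>Basis. (norm (weak_partial b u))\<^sup>2)"
    by (rule Cauchy_Schwarz_ineq_sum)
  finally show ?thesis by (simp add: dirichlet_energy_eq mult.commute)
qed

section \<open>Multiplication by a bounded potential and the thickness estimate\<close>

lemma L_infinityE:
  assumes "V \<in> L_infinity"
  obtains C where "C > 0" "AE x in lebesgue. \<bar>V x\<bar> \<le> C" "V \<in> borel_measurable lebesgue"
proof -
  obtain C where C: "AE x in lebesgue. \<bar>V x\<bar> \<le> C" "V \<in> borel_measurable lebesgue"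
    using assms unfolding L_infinity_def by blast
  have "AE x in lebesgue. \<bar>V x\<bar> \<le> max C 1" using C(1) by eventually_elim simp
  then show ?thesis using that[of "max C 1"] C(2) by simp
qed

lemma square_integrable_mult_bounded:
  assumes V: "V \<in> borel_measurable lebesgue" "AE x in lebesgue. \<bar>V x\<bar> \<le> C" and f: "square_integrable f"
  shows "square_integrable (\<lambda>x. complex_of_real (V x) * f x)"
proof (rule square_integrable_dominated)
  show "integrable lebesgue (\<lambda>x. C\<^sup>2 * (cmod (f x))\<^sup>2)" using f by (simp add: square_integrable_def)
  show "(\<lambda>x. complex_of_real (V x) * f x) \<in> borel_measurable lebesgue"
    using V f by (auto simp: square_integrable_def)
  show "AE x in lebesgue. (cmod (complex_of_real (V x) * f x))\<^sup>2 \<le> C\<^sup>2 * (cmod (f x))\<^sup>2"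
    using V(2)
  proof eventually_elim
    case (elim x)
    then have "\<bar>V x\<bar>\<^sup>2 \<le> C\<^sup>2" by (intro power_mono) auto
    then show ?case by (simp add: norm_mult power_mult_distrib mult_right_mono)
  qed
qed

lemma norm_mult_operator_le:
  assumes V: "V \<in> borel_measurable lebesgue" "AE x in lebesgue. \<bar>V x\<bar> \<le> C" and "C \<ge> 0"
  shows "norm (mult_operator V f) \<le> C * norm f"
proof -
  have sq: "square_integrable (\<lambda>x. complex_of_real (V x) * rep_L2 f x)"
    by (rule square_integrable_mult_bounded[OF V square_integrable_rep])
  have "(norm (mult_operator V f))\<^sup>2 = (LINT x|lebesgue. (cmod (complex_of_real (V x) * rep_L2 f x))\<^sup>2)"
    unfolding mult_operator_def by (rule norm_abs_L2[OF sq])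
  also have "\<dots> \<le> (LINT x|lebesgue. C\<^sup>2 * (cmod (rep_L2 f x))\<^sup>2)"
  proof (rule integral_mono_AE)
    show "integrable lebesgue (\<lambda>x. (cmod (complex_of_real (V x) * rep_L2 f x))\<^sup>2)"
      using sq by (simp add: square_integrable_def)
    show "integrable lebesgue (\<lambda>x. C\<^sup>2 * (cmod (rep_L2 f x))\<^sup>2)"
      using square_integrable_rep[of f] by (simp add: square_integrable_def)
    show "AE x in lebesgue. (cmod (complex_of_real (V x) * rep_L2 f x))\<^sup>2 \<le> C\<^sup>2 * (cmod (rep_L2 f x))\<^sup>2"
      using V(2)
    proof eventually_elim
      case (elim x)
      then have "\<bar>V x\<bar>\<^sup>2 \<le> C\<^sup>2" by (intro power_mono) auto
      then show ?case by (simp add: norm_mult power_mult_distrib mult_right_mono)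
    qed
  qed
  also have "\<dots> = (C * norm f)\<^sup>2"
    by (simp only: norm_L2_square power_mult_distrib integral_mult_right_zero)
  finally show ?thesis by (rule power2_le_imp_le) (use \<open>C \<ge> 0\<close> in simp)
qed

lemma inner_mult_operator:
  assumes V: "V \<in> borel_measurable lebesgue" "AE x in lebesgue. \<bar>V x\<bar> \<le> C"
  shows "integrable lebesgue (\<lambda>x. V x * (cmod (rep_L2 u x))\<^sup>2)"
    and "u \<bullet> mult_operator V u = (LINT x|lebesgue. V x * (cmod (rep_L2 u x))\<^sup>2)"
proof -
  let ?f = "\<lambda>x. cnj (rep_L2 u x) * (complex_of_real (V x) * rep_L2 u x)"
  have sqV: "square_integrable (\<lambda>x. complex_of_real (V x) * rep_L2 u x)"
    by (rule square_integrable_mult_bounded[OF V square_integrable_rep])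
  have int: "integrable lebesgue ?f" by (intro integrable_cnj_mult square_integrable_rep sqV)
  have Re: "Re (?f x) = V x * (cmod (rep_L2 u x))\<^sup>2" for x
    unfolding cmod_power2 by (simp add: algebra_simps power2_eq_square)
  show "integrable lebesgue (\<lambda>x. V x * (cmod (rep_L2 u x))\<^sup>2)" using integrable_Re[OF int] unfolding Re .
  have "cinner (abs_L2 (rep_L2 u)) (mult_operator V u) = (LINT x|lebesgue. ?f x)"
    unfolding mult_operator_def by (intro cinner_abs square_integrable_rep sqV)
  then show "u \<bullet> mult_operator V u = (LINT x|lebesgue. V x * (cmod (rep_L2 u x))\<^sup>2)"
    unfolding inner_L2_def Re[symmetric] integral_Re[OF int] by simp
qed

lemma inner_mult_operator_nonneg:
  assumes V: "V \<in> borel_measurable lebesgue" "AE x in lebesgue. \<bar>V x\<bar> \<le> C" "AE x in lebesgue. V x \<ge> 0"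
  shows "u \<bullet> mult_operator V u \<ge> 0"
  unfolding inner_mult_operator(2)[OF V(1,2)]
proof (rule integral_nonneg_AE)
  show "AE x in lebesgue. 0 \<le> V x * (cmod (rep_L2 u x))\<^sup>2" using V(3) by eventually_elim simp
qed

lemma nn_integral_translation:
  assumes "f \<in> borel_measurable borel"
  shows "(\<integral>\<^sup>+x. f (x + h) \<partial>lborel) = (\<integral>\<^sup>+x. f x \<partial>(lborel :: 'a::euclidean_space measure))"
proof -
  have "(\<integral>\<^sup>+x. f x \<partial>lborel) = (\<integral>\<^sup>+x. f x \<partial>distr lborel borel ((+) h))"
    by (simp add: lborel_distr_plus)
  also have "\<dots> = (\<integral>\<^sup>+x. f (x + h) \<partial>lborel)"
    using assms by (subst nn_integral_distr) (auto simp: add.commute)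
  finally show ?thesis by simp
qed

text \<open>The local mass of V is integrated against |u(y)|^2 over y and the order of integration
  is exchanged. Nonnegative integrals keep this exchange a matter of measurability, and the volume
  \<open>R ^ DIM('a)\<close> of the cube, which occurs on both sides, cancels.\<close>

lemma thick_inequality:
  fixes u :: "'a::euclidean_space L2"
  assumes V: "V \<in> borel_measurable lebesgue" "AE x in lebesgue. \<bar>V x\<bar> \<le> C" "AE x in lebesgue. V x \<ge> 0"
    and R: "R > 0" and \<rho>: "\<rho> > 0" and thick: "thick R \<rho> V" and C: "C \<ge> 0" and u: "u \<in> W12"
  shows "\<rho> * (norm u)\<^sup>2 \<le> 2 * (u \<bullet> mult_operator V u) + 2 * C * (R\<^sup>2 * real DIM('a) * dirichlet_energy u)"
proof -
  obtain v0 where v0: "v0 \<in> borel_measurable borel" "AE x in lborel. V x = v0 x"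
    using completion_ex_borel_measurable_real[OF V(1)] by auto
  \<comment> \<open>Borel and with values in [0, C] at every point, so that the pointwise bounds
    hold for all translates and the integrand is jointly measurable in \<open>y\<close> and
    \<open>h\<close>.\<close>
  define v where "v x = max 0 (min C (v0 x))" for x
  have v[measurable]: "v \<in> borel_measurable borel" unfolding v_def using v0(1) by measurable
  have v_bounds: "0 \<le> v x" "v x \<le> C" for x using C by (auto simp: v_def)
  have vV: "AE x in lebesgue. V x = v x"
    using AE_completion[OF v0(2)] V(2,3) by eventually_elim (auto simp: v_def)
  have ru: "rep_L2 u \<in> borel_measurable lebesgue"
    using square_integrable_rep[of u] unfolding square_integrable_def by blast
  obtain g where g[measurable]: "g \<in> borel_measurable borel" and ug: "AE x in lebesgue. rep_L2 u x = g x"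
    using borel_representative[OF ru] by blast
  have sqg: "square_integrable g"
  proof (rule square_integrable_dominated)
    show "integrable lebesgue (\<lambda>x. (cmod (rep_L2 u x))\<^sup>2)"
      using square_integrable_rep[of u] by (simp add: square_integrable_def)
    show "AE x in lebesgue. (cmod (g x))\<^sup>2 \<le> (cmod (rep_L2 u x))\<^sup>2" using ug by eventually_elim simp
  qed (rule borel_measurable_lebesgue_if_borel[OF g])
  have u_g: "u = abs_L2 g" using abs_L2_eqI[OF square_integrable_rep sqg ug] by simp
  define Q where "Q = box 0 (R *\<^sub>R (One::'a))"
  have Q[measurable]: "Q \<in> sets borel" by (simp add: Q_def)
  have mQ: "emeasure lborel Q = ennreal (R ^ DIM('a))"
    unfolding Q_def using R by (subst emeasure_lborel_box) (auto simp: prod_constant)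
  define I where "I = u \<bullet> mult_operator V u"
  define D where "D = R\<^sup>2 * real DIM('a) * dirichlet_energy u"
  have D: "D \<ge> 0" unfolding D_def dirichlet_energy_eq by (intro mult_nonneg_nonneg sum_nonneg) auto
  have nn: "(\<integral>\<^sup>+x. f x \<partial>lborel) = (\<integral>\<^sup>+x. f x \<partial>lebesgue)" if "f \<in> borel_measurable borel" for f :: "'a \<Rightarrow> ennreal"
    using that by (subst nn_integral_completion) auto
  have norm_u: "(\<integral>\<^sup>+x. ennreal ((cmod (g x))\<^sup>2) \<partial>lborel) = ennreal ((norm u)\<^sup>2)"
    unfolding u_g nn_integral_L2[OF sqg, symmetric] by (rule nn) measurable
  have I: "(\<integral>\<^sup>+x. ennreal (v x * (cmod (g x))\<^sup>2) \<partial>lborel) = ennreal I" and "I \<ge> 0"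
  proof -
    note I_int = inner_mult_operator[OF V(1,2), of u]
    have ae: "AE x in lebesgue. V x * (cmod (rep_L2 u x))\<^sup>2 = v x * (cmod (g x))\<^sup>2"
      using vV ug by eventually_elim simp
    have nonneg: "AE x in lebesgue. 0 \<le> V x * (cmod (rep_L2 u x))\<^sup>2"
      using V(3) by eventually_elim simp
    show "I \<ge> 0" unfolding I_def by (rule inner_mult_operator_nonneg[OF V])
    have "(\<integral>\<^sup>+x. ennreal (v x * (cmod (g x))\<^sup>2) \<partial>lborel) = (\<integral>\<^sup>+x. ennreal (v x * (cmod (g x))\<^sup>2) \<partial>lebesgue)"
      by (rule nn) measurable
    also have "\<dots> = (\<integral>\<^sup>+x. ennreal (V x * (cmod (rep_L2 u x))\<^sup>2) \<partial>lebesgue)"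
    proof (rule nn_integral_cong_AE)
      show "AE x in lebesgue. ennreal (v x * (cmod (g x))\<^sup>2) = ennreal (V x * (cmod (rep_L2 u x))\<^sup>2)"
        using ae by eventually_elim (simp only:)
    qed
    also have "\<dots> = ennreal I"
      unfolding I_def I_int(2) by (rule nn_integral_eq_integral[OF I_int(1) nonneg])
    finally show "(\<integral>\<^sup>+x. ennreal (v x * (cmod (g x))\<^sup>2) \<partial>lborel) = ennreal I" .
  qed
  \<comment> \<open>Thickness of the cube based at \<open>y\<close>, written over the fixed cube
    \<open>Q\<close> of displacements so that \<open>y\<close> and \<open>h\<close> become
    independent variables.\<close>
  have lower: "ennreal (\<rho> * R ^ DIM('a)) \<le> (\<integral>\<^sup>+h. indicator Q h * ennreal (v (y + h)) \<partial>lborel)" for y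
  proof -
    let ?B = "box y (y + R *\<^sub>R One)"
    have B: "?B = {x. x - y \<in> Q}" by (auto simp: Q_def mem_box algebra_simps)
    have B_leb: "?B \<in> sets lebesgue" by (simp add: sets_completionI_sets)
    have "\<rho> \<le> 1 / R ^ DIM('a) * (LINT x:?B|lebesgue. V x)" using thick unfolding thick_def by blast
    then have "\<rho> * R ^ DIM('a) \<le> (LINT x:?B|lebesgue. V x)" using R by (simp add: field_simps)
    also have "\<dots> = (LINT x|lebesgue. indicator ?B x * v x)"
      unfolding set_lebesgue_integral_def real_scaleR_def
      by (rule integral_cong_AE)
        (use vV V(1) B_leb borel_measurable_lebesgue_if_borel in \<open>auto intro!: borel_measurable_times borel_measurable_indicator elim: eventually_mono simp: measurable_completion\<close>)
    finally have 1: "\<rho> * R ^ DIM('a) \<le> (LINT x|lebesgue. indicator ?B x * v x)" .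
    have int: "integrable lborel (\<lambda>x. indicator ?B x * v x)"
    proof (rule Bochner_Integration.integrable_bound)
      show "integrable lborel (\<lambda>x. C * indicator ?B x)"
        using emeasure_bounded_finite[OF bounded_box, of y "y + R *\<^sub>R One"]
        by (intro integrable_mult_right integrable_real_indicator) auto
      show "AE x in lborel. norm (indicator ?B x * v x) \<le> norm (C * indicator ?B x)"
        using v_bounds C by (intro AE_I2) (auto split: split_indicator)
    qed measurable
    have "(LINT x|lebesgue. indicator ?B x * v x) = (LINT x|lborel. indicator ?B x * v x)"
      by (rule integral_completion) measurable
    with 1 have "ennreal (\<rho> * R ^ DIM('a)) \<le> ennreal (LINT x|lborel. indicator ?B x * v x)"
      by (intro ennreal_leI) simp
    also have "\<dots> = (\<integral>\<^sup>+x. ennreal (indicator ?B x * v x) \<partial>lborel)"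
      by (rule nn_integral_eq_integral[symmetric, OF int]) (auto simp: v_bounds)
    also have "\<dots> = (\<integral>\<^sup>+x. indicator ?B x * ennreal (v x) \<partial>lborel)"
      by (intro nn_integral_cong) (auto split: split_indicator)
    also have "\<dots> = (\<integral>\<^sup>+h. indicator ?B (h + y) * ennreal (v (h + y)) \<partial>lborel)"
      by (rule nn_integral_translation[symmetric]) measurable
    also have "\<dots> = (\<integral>\<^sup>+h. indicator Q h * ennreal (v (y + h)) \<partial>lborel)"
      unfolding B by (intro nn_integral_cong) (auto simp: add.commute split: split_indicator)
    finally show ?thesis .
  qed
  \<comment> \<open>Splitting g(y) into g(y + h) and the difference costs the factors 2. The first
    part carries the same translation as \<open>v\<close> and so integrates to \<open>I\<close>; in
    the second \<open>v\<close> is bounded by \<open>C\<close> and the translation estimate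
    applies.\<close>
  have upper: "(\<integral>\<^sup>+y. ennreal (v (y + h)) * ennreal ((cmod (g y))\<^sup>2) \<partial>lborel) \<le> ennreal (2 * I + 2 * C * D)"
    if h: "h \<in> Q" for h
  proof -
    have hb: "\<bar>h \<bullet> b\<bar> \<le> R" if "b \<in> Basis" for b
      using h that by (auto simp: Q_def mem_box)
    have sqd: "square_integrable (\<lambda>y. g (y + h) - g y)"
      by (intro square_integrable_diff square_integrable_translation sqg)
    have "shift h u - u = abs_L2 (\<lambda>y. g (y + h) - g y)"
      unfolding u_g shift_abs[OF sqg] by (subst minus_L2.abs_eq) (auto intro: square_integrable_translation sqg)
    then have "(\<integral>\<^sup>+y. ennreal ((cmod (g (y + h) - g y))\<^sup>2) \<partial>lborel) = ennreal ((norm (shift h u - u))\<^sup>2)"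
      using nn_integral_L2[OF sqd] by (simp add: nn)
    also have "\<dots> \<le> ennreal D" unfolding D_def by (intro ennreal_leI norm_shift_square_le u hb)
    finally have d: "(\<integral>\<^sup>+y. ennreal ((cmod (g (y + h) - g y))\<^sup>2) \<partial>lborel) \<le> ennreal D" .
    have "(\<integral>\<^sup>+y. ennreal (v (y + h)) * ennreal ((cmod (g y))\<^sup>2) \<partial>lborel)
      \<le> (\<integral>\<^sup>+y. 2 * ennreal (v (y + h) * (cmod (g (y + h)))\<^sup>2) + 2 * ennreal C * ennreal ((cmod (g (y + h) - g y))\<^sup>2) \<partial>lborel)"
    proof (rule nn_integral_mono)
      fix y
      have "v (y + h) * (cmod (g y))\<^sup>2 \<le> v (y + h) * (2 * (cmod (g (y + h)))\<^sup>2 + 2 * (cmod (g (y + h) - g y))\<^sup>2)"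
        using cmod_add_square_le[of "g (y + h)" "- (g (y + h) - g y)"] v_bounds
        by (intro mult_left_mono) (auto simp: norm_minus_commute)
      also have "\<dots> = 2 * (v (y + h) * (cmod (g (y + h)))\<^sup>2) + 2 * v (y + h) * (cmod (g (y + h) - g y))\<^sup>2"
        by (simp add: algebra_simps)
      also have "\<dots> \<le> 2 * (v (y + h) * (cmod (g (y + h)))\<^sup>2) + 2 * C * (cmod (g (y + h) - g y))\<^sup>2"
        using v_bounds by (intro add_left_mono mult_right_mono) auto
      finally have "ennreal (v (y + h) * (cmod (g y))\<^sup>2) \<le> ennreal (2 * (v (y + h) * (cmod (g (y + h)))\<^sup>2) + 2 * C * (cmod (g (y + h) - g y))\<^sup>2)"
        by (rule ennreal_leI)
      then show "ennreal (v (y + h)) * ennreal ((cmod (g y))\<^sup>2) \<le> 2 * ennreal (v (y + h) * (cmod (g (y + h)))\<^sup>2) + 2 * ennreal C * ennreal ((cmod (g (y + h) - g y))\<^sup>2)"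
        using v_bounds C by (simp add: ennreal_mult ennreal_plus)
    qed
    also have "\<dots> = 2 * (\<integral>\<^sup>+y. ennreal (v (y + h) * (cmod (g (y + h)))\<^sup>2) \<partial>lborel) + 2 * ennreal C * (\<integral>\<^sup>+y. ennreal ((cmod (g (y + h) - g y))\<^sup>2) \<partial>lborel)"
      by (subst nn_integral_add) (auto simp: nn_integral_cmult)
    also have "(\<integral>\<^sup>+y. ennreal (v (y + h) * (cmod (g (y + h)))\<^sup>2) \<partial>lborel) = ennreal I"
      unfolding I[symmetric] by (rule nn_integral_translation) measurable
    also have "2 * ennreal I + 2 * ennreal C * (\<integral>\<^sup>+y. ennreal ((cmod (g (y + h) - g y))\<^sup>2) \<partial>lborel) \<le> 2 * ennreal I + 2 * ennreal C * ennreal D"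
      by (intro add_left_mono mult_left_mono d) auto
    also have "\<dots> = ennreal (2 * I + 2 * C * D)"
      using \<open>I \<ge> 0\<close> C D by (simp add: ennreal_mult ennreal_plus)
    finally show ?thesis .
  qed
  have "ennreal (\<rho> * R ^ DIM('a)) * ennreal ((norm u)\<^sup>2) = (\<integral>\<^sup>+y. ennreal (\<rho> * R ^ DIM('a)) * ennreal ((cmod (g y))\<^sup>2) \<partial>lborel)"
    by (subst nn_integral_cmult) (auto simp: norm_u)
  also have "\<dots> \<le> (\<integral>\<^sup>+y. (\<integral>\<^sup>+h. indicator Q h * ennreal (v (y + h)) \<partial>lborel) * ennreal ((cmod (g y))\<^sup>2) \<partial>lborel)"
    by (intro nn_integral_mono mult_right_mono lower) auto
  also have "\<dots> = (\<integral>\<^sup>+y. (\<integral>\<^sup>+h. indicator Q h * ennreal (v (y + h)) * ennreal ((cmod (g y))\<^sup>2) \<partial>lborel) \<partial>lborel)"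
    by (subst nn_integral_multc) auto
  \<comment> \<open>After this exchange the displacement \<open>h\<close> is fixed in the inner
    integral, where \<open>upper\<close> applies.\<close>
  also have "\<dots> = (\<integral>\<^sup>+h. (\<integral>\<^sup>+y. indicator Q h * ennreal (v (y + h)) * ennreal ((cmod (g y))\<^sup>2) \<partial>lborel) \<partial>lborel)"
    by (rule lborel_pair.Fubini') measurable
  also have "\<dots> = (\<integral>\<^sup>+h. indicator Q h * (\<integral>\<^sup>+y. ennreal (v (y + h)) * ennreal ((cmod (g y))\<^sup>2) \<partial>lborel) \<partial>lborel)"
    by (subst nn_integral_cmult[symmetric]) (auto simp: mult.assoc)
  also have "\<dots> \<le> (\<integral>\<^sup>+h. indicator Q h * ennreal (2 * I + 2 * C * D) \<partial>lborel)"
    by (intro nn_integral_mono) (auto split: split_indicator intro: upper)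
  also have "\<dots> = ennreal (R ^ DIM('a)) * ennreal (2 * I + 2 * C * D)"
    by (subst nn_integral_multc) (auto simp: mQ)
  finally have "ennreal (\<rho> * R ^ DIM('a) * (norm u)\<^sup>2) \<le> ennreal (R ^ DIM('a) * (2 * I + 2 * C * D))"
    using \<rho> R \<open>I \<ge> 0\<close> C D by (simp add: ennreal_mult')
  then have "\<rho> * R ^ DIM('a) * (norm u)\<^sup>2 \<le> R ^ DIM('a) * (2 * I + 2 * C * D)"
    using R \<open>I \<ge> 0\<close> C D by (subst (asm) ennreal_le_iff) auto
  then have "R ^ DIM('a) * (\<rho> * (norm u)\<^sup>2) \<le> R ^ DIM('a) * (2 * I + 2 * C * D)" by (simp add: mult_ac)
  then have "\<rho> * (norm u)\<^sup>2 \<le> 2 * I + 2 * C * D" using R by simp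
  then show ?thesis by (simp add: I_def D_def mult.assoc)
qed

section \<open>Operators in a closed complex subspace\<close>

context
  fixes V :: "'a::euclidean_space \<Rightarrow> real" and C :: real
  assumes V: "V \<in> borel_measurable lebesgue" "AE x in lebesgue. \<bar>V x\<bar> \<le> C"
begin

lemma square_integrable_V_mult: "square_integrable (\<lambda>x. complex_of_real (V x) * rep_L2 f x)"
  by (rule square_integrable_mult_bounded[OF V square_integrable_rep])

lemma mult_operator_abs:
  assumes "square_integrable f"
  shows "mult_operator V (abs_L2 f) = abs_L2 (\<lambda>x. complex_of_real (V x) * f x)"
  unfolding mult_operator_def
proof (rule abs_L2_eqI[OF square_integrable_V_mult square_integrable_mult_bounded[OF V assms]])
  show "AE x in lebesgue. complex_of_real (V x) * rep_L2 (abs_L2 f) x = complex_of_real (V x) * f x"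
    using rep_abs_L2[OF assms] by eventually_elim simp
qed

lemma mult_operator_add: "mult_operator V (f + g) = mult_operator V f + mult_operator V g"
proof -
  have "f + g = abs_L2 (\<lambda>x. rep_L2 f x + rep_L2 g x)" using plus_L2.abs_eq[of "rep_L2 f" "rep_L2 g"] by simp
  then have "mult_operator V (f + g) = abs_L2 (\<lambda>x. complex_of_real (V x) * (rep_L2 f x + rep_L2 g x))"
    by (simp only: mult_operator_abs square_integrable_add square_integrable_rep)
  also have "\<dots> = mult_operator V f + mult_operator V g"
    unfolding mult_operator_def by (subst plus_L2.abs_eq) (auto simp: square_integrable_V_mult distrib_left)
  finally show ?thesis .
qed

lemma mult_operator_scaleC: "mult_operator V (c *\<^sub>C f) = c *\<^sub>C mult_operator V f"
proof -
  have "c *\<^sub>C f = abs_L2 (\<lambda>x. c * rep_L2 f x)" using scaleC.abs_eq[of "rep_L2 f" c] by simp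
  then have "mult_operator V (c *\<^sub>C f) = abs_L2 (\<lambda>x. complex_of_real (V x) * (c * rep_L2 f x))"
    by (simp only: mult_operator_abs square_integrable_scale square_integrable_rep)
  also have "\<dots> = c *\<^sub>C mult_operator V f"
    unfolding mult_operator_def by (subst scaleC.abs_eq) (auto simp: square_integrable_V_mult mult.left_commute)
  finally show ?thesis .
qed

lemma cinner_mult_operator: "cinner f (mult_operator V g) = cinner (mult_operator V f) g"
proof -
  have "cinner (abs_L2 (rep_L2 f)) (mult_operator V g) = (LINT x|lebesgue. cnj (rep_L2 f x) * (complex_of_real (V x) * rep_L2 g x))"
    unfolding mult_operator_def by (intro cinner_abs square_integrable_rep square_integrable_V_mult)
  also have "\<dots> = (LINT x|lebesgue. cnj (complex_of_real (V x) * rep_L2 f x) * rep_L2 g x)"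
    by (rule Bochner_Integration.integral_cong) auto
  also have "\<dots> = cinner (mult_operator V f) (abs_L2 (rep_L2 g))"
    unfolding mult_operator_def by (intro cinner_abs[symmetric] square_integrable_rep square_integrable_V_mult)
  finally show ?thesis by simp
qed

end

section \<open>Projections and self-adjoint operators in a closed complex subspace\<close>

locale closed_complex_subspace =
  fixes M :: "'a::euclidean_space L2 set"
  assumes closed_subspace: "closed_subspace M"
begin

lemma M_closed: "closed M" and M_zero: "0 \<in> M" and M_plus: "f \<in> M \<Longrightarrow> g \<in> M \<Longrightarrow> f + g \<in> M"
  and M_scaleC: "f \<in> M \<Longrightarrow> c *\<^sub>C f \<in> M"
  using closed_subspace unfolding closed_subspace_def by auto

lemma M_subspace: "subspace M"
  unfolding subspace_def using M_zero M_plus M_scaleC by (auto simp: scaleR_L2_def)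

text \<open>\<open>M\<close> is stable under multiplication by i, and the real part at
  \<open>\<i> *\<^sub>C m\<close> is the imaginary part at \<open>m\<close>.\<close>

lemma cinner_zero_iff_inner_zero:
  "(\<forall>m\<in>M. cinner m x = 0) \<longleftrightarrow> (\<forall>m\<in>M. m \<bullet> x = 0)"
proof
  assume *: "\<forall>m\<in>M. m \<bullet> x = 0"
  show "\<forall>m\<in>M. cinner m x = 0"
  proof
    fix m assume m: "m \<in> M"
    have "(\<i> *\<^sub>C m) \<bullet> x = 0" using * M_scaleC[OF m] by blast
    then have "Im (cinner m x) = 0" by (simp add: inner_L2_def cinner_scaleC_left)
    moreover have "Re (cinner m x) = 0" using * m by (simp add: inner_L2_def)
    ultimately show "cinner m x = 0" by (simp add: complex_eq_iff)
  qed
qed (simp add: inner_L2_def)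

lemma orth_proj_unique:
  assumes "p \<in> M" "\<forall>m\<in>M. cinner m (f - p) = 0" "q \<in> M" "\<forall>m\<in>M. cinner m (f - q) = 0"
  shows "p = q"
proof -
  have "p - q \<in> M" using assms M_subspace by (simp add: subspace_diff)
  then have "cinner (p - q) (f - q) - cinner (p - q) (f - p) = 0" using assms by simp
  then have "cinner (p - q) (p - q) = 0" by (simp add: cinner_diff_right)
  then show ?thesis by (simp add: cinner_self)
qed

lemma orth_proj: "orth_proj M f \<in> M" "m \<in> M \<Longrightarrow> cinner m (f - orth_proj M f) = 0"
proof -
  obtain p where p: "p \<in> M" "\<And>m. m \<in> M \<Longrightarrow> m \<bullet> (f - p) = 0"
    using hilbert_projection_ex[OF M_closed M_subspace] by blast
  then have "p \<in> M \<and> (\<forall>m\<in>M. cinner m (f - p) = 0)" using cinner_zero_iff_inner_zero by blast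
  then have "\<exists>!p. p \<in> M \<and> (\<forall>m\<in>M. cinner m (f - p) = 0)" using orth_proj_unique by blast
  from theI'[OF this] show "orth_proj M f \<in> M" "m \<in> M \<Longrightarrow> cinner m (f - orth_proj M f) = 0"
    unfolding orth_proj_def by blast+
qed

lemma orth_proj_eqI:
  assumes "p \<in> M" "\<And>m. m \<in> M \<Longrightarrow> cinner m (f - p) = 0" shows "orth_proj M f = p"
  using orth_proj_unique[of "orth_proj M f" f p] orth_proj assms by blast

lemma cinner_orth_proj: "m \<in> M \<Longrightarrow> cinner m (orth_proj M f) = cinner m f"
  using orth_proj(2)[of m f] by (simp add: cinner_diff_right)

lemma orth_proj_add: "orth_proj M (f + g) = orth_proj M f + orth_proj M g"
proof (rule orth_proj_eqI)
  show "cinner m (f + g - (orth_proj M f + orth_proj M g)) = 0" if "m \<in> M" for m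
    using that by (simp add: cinner_diff_right cinner_add_right cinner_orth_proj)
qed (simp add: M_plus orth_proj)

lemma orth_proj_scaleC: "orth_proj M (c *\<^sub>C f) = c *\<^sub>C orth_proj M f"
proof (rule orth_proj_eqI)
  show "cinner m (c *\<^sub>C f - c *\<^sub>C orth_proj M f) = 0" if "m \<in> M" for m
    using that by (simp add: cinner_diff_right cinner_scaleC_right cinner_orth_proj)
qed (simp add: M_scaleC orth_proj)

lemma norm_orth_proj_le: "norm (orth_proj M f) \<le> norm f"
proof -
  let ?p = "orth_proj M f"
  have "(norm ?p)\<^sup>2 = Re (cinner ?p ?p)" by (simp add: cinner_self)
  also have "\<dots> = ?p \<bullet> f" by (simp only: cinner_orth_proj[OF orth_proj(1)] inner_L2_def)
  also have "\<dots> \<le> norm ?p * norm f" by (rule norm_cauchy_schwarz)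
  finally have "norm ?p * norm ?p \<le> norm ?p * norm f" by (simp add: power2_eq_square)
  then show ?thesis by (cases "norm ?p = 0") auto
qed

lemma maximal_monotone_if_selfadjoint_in:
  assumes sa: "selfadjoint_in M A" and \<delta>: "\<delta> \<ge> 0"
    and mono: "\<And>f f'. (f, f') \<in> A \<Longrightarrow> \<delta> * (norm f)\<^sup>2 \<le> f \<bullet> f'"
  shows "maximal_monotone M A \<delta>"
proof -
  have A: "A \<subseteq> M \<times> M" "(0, 0) \<in> A" "\<And>f f' g g'. (f, f') \<in> A \<Longrightarrow> (g, g') \<in> A \<Longrightarrow> (f + g, f' + g') \<in> A"
    "\<And>c f f'. (f, f') \<in> A \<Longrightarrow> (c *\<^sub>C f, c *\<^sub>C f') \<in> A"
    and dense: "closure (Domain A) = M" and adj: "adjoint_in M A = A"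
    using sa unfolding selfadjoint_in_def linear_operator_in_def by blast+
  have sub: "subspace A"
    unfolding subspace_def
  proof (intro conjI ballI allI)
    show "0 \<in> A" using A(2) by (simp add: zero_prod_def)
    fix x y and c :: real assume "x \<in> A" "y \<in> A"
    then show "x + y \<in> A" "c *\<^sub>R x \<in> A"
      using A(3)[of "fst x" "snd x" "fst y" "snd y"] A(4)[of "fst x" "snd x" "complex_of_real c"]
      by (simp_all add: plus_prod_def scaleR_prod_def scaleR_L2_def)
  qed
  show ?thesis
  proof (unfold_locales)
    show "closed M" "subspace M" "A \<subseteq> M \<times> M" "subspace A" "\<delta> \<ge> 0" "M \<subseteq> closure (Domain A)"
      using M_closed M_subspace A(1) sub \<delta> dense by auto
    show "\<delta> * (norm f)\<^sup>2 \<le> f \<bullet> f'" if "(f, f') \<in> A" for f f' by (rule mono[OF that])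
    show "\<exists>(f, f')\<in>A. f + l *\<^sub>R f' = g" if "l > 0" "g \<in> M" for l g
    proof (rule maximal_monotone_if_selfadjoint[OF M_closed M_subspace A(1) sub _ _ _ that])
      show "g \<bullet> f' = g' \<bullet> f" if "(f, f') \<in> A" "(g, g') \<in> A" for f f' g g'
      proof -
        have "(g, g') \<in> adjoint_in M A" using that adj by simp
        then have "cinner g f' = cinner g' f" using that(1) unfolding adjoint_in_def by blast
        then show ?thesis by (simp add: inner_L2_def)
      qed
      show "(g, g') \<in> A" if g: "g \<in> M" "g' \<in> M" and *: "\<And>f f'. (f, f') \<in> A \<Longrightarrow> g \<bullet> f' = g' \<bullet> f" for g g'
      proof -
        have "cinner g f' = cinner g' f" if "(f, f') \<in> A" for f f'
        proof -
          \<comment> \<open>The real adjoint identity at i times the pair \<open>(f, f')\<close>,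
            which is again in \<open>A\<close> by complex linearity, supplies the imaginary
            part.\<close>
          have "g \<bullet> (\<i> *\<^sub>C f') = g' \<bullet> (\<i> *\<^sub>C f)" by (rule *[OF A(4)[OF that]])
          then have "Im (cinner g f') = Im (cinner g' f)" by (simp add: Im_cinner)
          moreover have "Re (cinner g f') = Re (cinner g' f)" using *[OF that] by (simp add: inner_L2_def)
          ultimately show ?thesis by (simp add: complex_eq_iff)
        qed
        then have "(g, g') \<in> adjoint_in M A" using g unfolding adjoint_in_def by blast
        then show ?thesis using adj by simp
      qed
      show "0 \<le> f \<bullet> f'" if "(f, f') \<in> A" for f f'
        using mono[OF that] \<delta> by (meson mult_nonneg_nonneg order_trans zero_le_power2)
    qed
  qed
qed

end

context closed_complex_subspace
begin

text \<open>\<open>B\<close> is symmetric and defined on all of \<open>M\<close>, so it can be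
  carried across the adjoint identity: the adjoint of H + B is the adjoint of H plus B, on the same
  domain.\<close>

lemma selfadjoint_in_add_bounded:
  assumes sa: "selfadjoint_in M H"
    and B: "\<And>f. f \<in> M \<Longrightarrow> B f \<in> M" "\<And>f g. f \<in> M \<Longrightarrow> g \<in> M \<Longrightarrow> B (f + g) = B f + B g"
      "\<And>c f. f \<in> M \<Longrightarrow> B (c *\<^sub>C f) = c *\<^sub>C B f"
      "\<And>f g. f \<in> M \<Longrightarrow> g \<in> M \<Longrightarrow> cinner f (B g) = cinner (B f) g"
  shows "selfadjoint_in M {(f, f' + B f) | f f'. (f, f') \<in> H}"
proof -
  let ?A = "{(f, f' + B f) | f f'. (f, f') \<in> H}"
  have H: "H \<subseteq> M \<times> M" "single_valued H" "(0, 0) \<in> H"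
    "\<And>f f' g g'. (f, f') \<in> H \<Longrightarrow> (g, g') \<in> H \<Longrightarrow> (f + g, f' + g') \<in> H"
    "\<And>c f f'. (f, f') \<in> H \<Longrightarrow> (c *\<^sub>C f, c *\<^sub>C f') \<in> H"
    and dense: "closure (Domain H) = M" and adj: "adjoint_in M H = H"
    using sa unfolding selfadjoint_in_def linear_operator_in_def by blast+
  have HM: "f \<in> M" "f' \<in> M" if "(f, f') \<in> H" for f f' using H(1) that by auto
  have B0: "B 0 = 0" using B(2)[OF M_zero M_zero] by simp
  \<comment> \<open>Subtracting \<open>B f\<close> translates each statement about H + B into one
    about H.\<close>
  have mem: "(f, g) \<in> ?A \<longleftrightarrow> (f, g - B f) \<in> H" for f g
    by (auto intro!: exI[of _ "g - B f"])
  have "linear_operator_in M ?A"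
    unfolding linear_operator_in_def
  proof (intro conjI allI impI)
    show "?A \<subseteq> M \<times> M" using HM B(1) M_plus by auto
    show "single_valued ?A" using H(2) by (auto simp: single_valued_def)
    show "(0, 0) \<in> ?A" unfolding mem using H(3) B0 by simp
    show "(f + g, f' + g') \<in> ?A" if "(f, f') \<in> ?A" "(g, g') \<in> ?A" for f f' g g'
    proof -
      have "(f + g, f' - B f + (g' - B g)) \<in> H" using that unfolding mem by (rule H(4))
      moreover have "B (f + g) = B f + B g" using that HM unfolding mem by (intro B(2)) blast+
      ultimately show ?thesis unfolding mem by (simp add: algebra_simps)
    qed
    show "(c *\<^sub>C f, c *\<^sub>C f') \<in> ?A" if "(f, f') \<in> ?A" for c f f'
    proof -
      have "(c *\<^sub>C f, c *\<^sub>C (f' - B f)) \<in> H" using that unfolding mem by (rule H(5))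
      moreover have "c *\<^sub>C (f' - B f) + c *\<^sub>C B f = c *\<^sub>C f'" using scaleC_add_right[of c "f' - B f" "B f"] by simp
      then have "c *\<^sub>C (f' - B f) = c *\<^sub>C f' - c *\<^sub>C B f" by (simp add: eq_diff_eq)
      moreover have "B (c *\<^sub>C f) = c *\<^sub>C B f" using that HM unfolding mem by (intro B(3)) blast
      ultimately show ?thesis unfolding mem by simp
    qed
  qed
  moreover have "Domain ?A = Domain H" by auto
  moreover have "adjoint_in M ?A = ?A"
  proof (intro equalityI subrelI)
    fix g g' assume "(g, g') \<in> adjoint_in M ?A"
    then have g: "g \<in> M" "g' \<in> M" and *: "\<And>f f'. (f, f') \<in> ?A \<Longrightarrow> cinner g f' = cinner g' f"
      unfolding adjoint_in_def by blast+
    have "cinner g f' = cinner (g' - B g) f" if "(f, f') \<in> H" for f f'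
    proof -
      have "cinner g (f' + B f) = cinner g' f" using that by (intro *) blast
      then show ?thesis using B(4)[OF g(1) HM(1)[OF that]]
        by (simp add: cinner_add_right cinner_diff_left eq_diff_eq)
    qed
    then have "(g, g' - B g) \<in> adjoint_in M H"
      using g B(1) M_subspace unfolding adjoint_in_def by (auto simp: subspace_diff)
    then show "(g, g') \<in> ?A" unfolding mem adj .
  next
    fix g g' assume g: "(g, g') \<in> ?A"
    then have gH: "(g, g' - B g) \<in> H" unfolding mem .
    then have gM: "g \<in> M" "g' \<in> M" using HM[OF gH] B(1) M_plus[of "g' - B g" "B g"] by auto
    have "cinner g f' = cinner g' f" if "(f, f') \<in> ?A" for f f'
    proof -
      have f: "(f, f' - B f) \<in> H" using that unfolding mem .
      have "(g, g' - B g) \<in> adjoint_in M H" using gH adj by simp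
      then have "cinner g (f' - B f) = cinner (g' - B g) f" using f unfolding adjoint_in_def by blast
      then show ?thesis using B(4)[OF gM(1) HM(1)[OF f]] by (simp add: cinner_diff_right cinner_diff_left)
    qed
    then show "(g, g') \<in> adjoint_in M ?A" using gM unfolding adjoint_in_def by blast
  qed
  ultimately show ?thesis using dense unfolding selfadjoint_in_def by simp
qed

text \<open>The Euler construction sees only the real structure of \<open>M\<close>. Multiplication
  by a complex number is continuous and preserves the graph of \<open>H\<close>, so it commutes with
  the semigroup.\<close>

lemma semigroup_generated_by_maximal_monotone:
  assumes "maximal_monotone M H \<delta>" and scale: "\<And>c f f'. (f, f') \<in> H \<Longrightarrow> (c *\<^sub>C f, c *\<^sub>C f') \<in> H"
  shows "semigroup_generated_by M {(f, - f') | f f'. (f, f') \<in> H} (maximal_monotone.E H)"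
proof -
  interpret maximal_monotone M H \<delta> by fact
  have cont: "continuous_on UNIV (\<lambda>f. c *\<^sub>C f :: 'a L2)" for c
  proof -
    have "(cmod c)-lipschitz_on UNIV (\<lambda>f. c *\<^sub>C f :: 'a L2)"
    proof (rule lipschitz_onI)
      fix f g :: "'a L2"
      have "c *\<^sub>C f = c *\<^sub>C (f - g) + c *\<^sub>C g" by (simp flip: scaleC_add_right)
      then show "dist (c *\<^sub>C f) (c *\<^sub>C g) \<le> cmod c * dist f g" by (simp add: dist_norm norm_scaleC)
    qed simp
    then show ?thesis by (rule lipschitz_on_continuous_on)
  qed
  have "E t (c *\<^sub>C f) = c *\<^sub>C E t f" if "t \<ge> 0" "f \<in> M" for t c f
    by (rule E_commute[where U = "\<lambda>f. c *\<^sub>C f"])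
      (auto simp: that scaleC_add_right scaleC_scaleR scale cont M_scaleC)
  then show ?thesis
    unfolding semigroup_generated_by_def generator_eq
    using E_in E_add E_0 E_semigroup E_tendsto semigroup.bounded by auto
qed

lemma c0_semigroup_if_generated_by:
  assumes "semigroup_generated_by M G E" shows "c0_semigroup M E"
proof
  show "closed M" "subspace M" by (rule M_closed M_subspace)+
  show "E t (c *\<^sub>R x) = c *\<^sub>R E t x" if "t \<ge> 0" "x \<in> M" for t c x
    using assms that unfolding semigroup_generated_by_def scaleR_L2_def by blast
qed (use assms in \<open>unfold semigroup_generated_by_def, blast+\<close>)

end

section \<open>Exponential decay and the cost in the Bochner spaces\<close>

lemma exp_decay_integral_le:
  fixes \<delta> T :: real
  assumes "\<delta> > 0" "T \<ge> 0"
  shows "(LINT t|lebesgue_on {0<..<T}. exp (- \<delta> * t)) \<le> 1 / \<delta>"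
proof -
  have "integrable (lebesgue_on {0<..<T}) (\<lambda>t. exp (- \<delta> * t))"
    by (intro integrable_continuous_on_Ioo continuous_intros)
  then have 1: "((\<lambda>t. exp (- \<delta> * t)) has_integral (LINT t|lebesgue_on {0<..<T}. exp (- \<delta> * t))) {0<..<T}"
    by (rule has_integral_integral_lebesgue_on) simp
  have "((\<lambda>t. exp (- \<delta> * t)) has_integral (- exp (- \<delta> * T) / \<delta> - (- exp (- \<delta> * 0) / \<delta>))) {0..T}"
    by (intro fundamental_theorem_of_calculus assms)
       (use assms in \<open>auto intro!: derivative_eq_intros simp flip: has_real_derivative_iff_has_vector_derivative\<close>)
  then have "((\<lambda>t. exp (- \<delta> * t)) has_integral (- exp (- \<delta> * T) / \<delta> - (- exp (- \<delta> * 0) / \<delta>))) {0<..<T}"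
    by (simp add: has_integral_Icc_iff_Ioo)
  from has_integral_unique[OF 1 this]
  have eq: "(LINT t|lebesgue_on {0<..<T}. exp (- \<delta> * t)) = - exp (- \<delta> * T) / \<delta> - (- exp (- \<delta> * 0) / \<delta>)" .
  show ?thesis unfolding eq using assms by (simp add: field_simps)
qed

text \<open>For p \<ge> 1 the factor exp(-\<delta> t p) is at most exp(-\<delta> t), so the p-th
  power integral is at most c^p / \<delta>, whatever the length of the interval.\<close>

lemma Lr_decaying:
  fixes u :: "real \<Rightarrow> 'b::{banach,second_countable_topology}"
  assumes cont: "continuous_on {0..T} u" and M: "\<And>t. t \<in> {0<..<T} \<Longrightarrow> u t \<in> M"
    and decay: "\<And>t. t \<in> {0<..<T} \<Longrightarrow> norm (u t) \<le> exp (- \<delta> * t) * c"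
    and \<delta>: "\<delta> > 0" and c: "c \<ge> 0" and T: "T \<ge> 0" and r: "r \<ge> 1"
  shows "u \<in> Lr_space r T M" "Lr_norm r T u \<le> max 1 (1 / \<delta>) * c"
proof -
  have meas: "u \<in> borel_measurable (lebesgue_on {0<..<T})"
    by (rule borel_measurable_integrable[OF integrable_continuous_on_Ioo[OF cont]])
  have le_c: "norm (u t) \<le> c" if "t \<in> {0<..<T}" for t
  proof -
    have "exp (- \<delta> * t) * c \<le> 1 * c" using that \<delta> c by (intro mult_right_mono) auto
    then show ?thesis using decay[OF that] by simp
  qed
  have ae: "AE t in lebesgue_on {0<..<T}. norm (u t) \<le> c" by (rule AE_I2) (simp add: le_c)
  have "u \<in> Lr_space r T M \<and> Lr_norm r T u \<le> max 1 (1 / \<delta>) * c"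
  proof (cases "r = \<infinity>")
    case True
    have "Inf {C. 0 \<le> C \<and> (AE t in lebesgue_on {0<..<T}. norm (u t) \<le> C)} \<le> c"
      by (rule cInf_lower) (use ae c in \<open>auto intro!: bdd_belowI[of _ 0]\<close>)
    also have "c \<le> max 1 (1 / \<delta>) * c" using mult_right_mono[of 1 "max 1 (1 / \<delta>)" c] c by simp
    finally show ?thesis
      using True ae meas M unfolding Lr_space_def Lr_norm_def by auto
  next
    case False
    then obtain p where p: "r = ereal p" using r by (cases r) auto
    then have p1: "p \<ge> 1" using r by simp
    have cont': "continuous_on {0..T} (\<lambda>t. norm (u t) powr p)"
      using p1 by (intro continuous_on_powr' continuous_on_norm cont continuous_on_const) auto
    have int: "integrable (lebesgue_on {0<..<T}) (\<lambda>t. norm (u t) powr p)"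
      by (rule integrable_continuous_on_Ioo[OF cont'])
    have "(LINT t|lebesgue_on {0<..<T}. norm (u t) powr p) \<le> (LINT t|lebesgue_on {0<..<T}. c powr p * exp (- \<delta> * t))"
    proof (rule integral_mono[OF int])
      show "integrable (lebesgue_on {0<..<T}) (\<lambda>t. c powr p * exp (- \<delta> * t))"
        by (intro integrable_continuous_on_Ioo continuous_intros)
      fix t assume "t \<in> space (lebesgue_on {0<..<T})"
      then have t: "t \<in> {0<..<T}" by simp
      have "norm (u t) powr p \<le> (exp (- \<delta> * t) * c) powr p"
        using decay[OF t] p1 by (intro powr_mono2) auto
      also have "\<dots> = c powr p * exp (- \<delta> * t * p)" using c by (simp add: powr_mult exp_powr_real)
      also have "\<dots> \<le> c powr p * exp (- \<delta> * t)"
        using p1 t \<delta> mult_left_mono[of 1 p "\<delta> * t"] by (intro mult_left_mono) auto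
      finally show "norm (u t) powr p \<le> c powr p * exp (- \<delta> * t)" .
    qed
    also have "\<dots> = c powr p * (LINT t|lebesgue_on {0<..<T}. exp (- \<delta> * t))" by simp
    also have "\<dots> \<le> c powr p * (1 / \<delta>)"
      by (intro mult_left_mono exp_decay_integral_le \<delta> T) auto
    \<comment> \<open>With this factor at least 1 its exponent 1/p can be raised to 1 below, which
      makes the bound independent of p.\<close>
    also have "\<dots> \<le> c powr p * max 1 (1 / \<delta>)" by (intro mult_left_mono) auto
    finally have "(LINT t|lebesgue_on {0<..<T}. norm (u t) powr p) powr (1 / p) \<le> (c powr p * max 1 (1 / \<delta>)) powr (1 / p)"
      using p1 by (intro powr_mono2) (auto intro: integral_nonneg_AE)
    also have "\<dots> = c * max 1 (1 / \<delta>) powr (1 / p)"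
      using p1 c by (simp add: powr_mult powr_powr powr_one)
    also have "\<dots> \<le> c * max 1 (1 / \<delta>) powr 1"
      using p1 c by (intro mult_left_mono powr_mono) auto
    also have "\<dots> = max 1 (1 / \<delta>) * c" by (simp add: powr_one)
    finally show ?thesis
      using p meas M int unfolding Lr_space_def Lr_norm_def by auto
  qed
  then show "u \<in> Lr_space r T M" "Lr_norm r T u \<le> max 1 (1 / \<delta>) * c" by auto
qed

theorem corollary6p1:
  fixes M :: "'a::euclidean_space L2 set" and H :: "'a operator"
    and V :: "'a \<Rightarrow> real" and \<eta> R \<rho> \<alpha> :: real
  assumes "\<eta> > 0"
    and "closed_subspace M" and "selfadjoint_in M H" and "ge_laplacian M H \<eta>"
    and "V \<in> L_infinity" and "AE x in lebesgue. V x \<ge> 0"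
    and "R > 0" and "\<rho> > 0" and "thick R \<rho> V"
    and "0 < \<alpha>" and "\<alpha> < 1"
  shows "\<exists>T\<^sub>0>0. \<exists>K>0. \<forall>T\<ge>T\<^sub>0. \<forall>r\<ge>1. cost_uniformly_controllable M H V \<alpha> T r K"
proof -
  interpret closed_complex_subspace M by unfold_locales fact
  obtain C where C: "C > 0" "AE x in lebesgue. \<bar>V x\<bar> \<le> C" and V: "V \<in> borel_measurable lebesgue"
    using L_infinityE[OF \<open>V \<in> L_infinity\<close>] by blast
  define B where "B = control_operator M V"
  have B_M: "B f \<in> M" for f unfolding B_def control_operator_def by (rule orth_proj)
  have B_add: "B (f + g) = B f + B g" and B_scale: "B (c *\<^sub>C f) = c *\<^sub>C B f" for f g c
    unfolding B_def control_operator_def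
    by (simp_all only: mult_operator_add[OF V C(2)] mult_operator_scaleC[OF V C(2)] orth_proj_add orth_proj_scaleC)
  have B_diff: "B (f - g) = B f - B g" for f g using B_add[of "f - g" g] by simp
  have B_minus: "B (- f) = - B f" for f using B_diff[of f f] B_diff[of 0 f] by simp
  have B_inner: "cinner f (B g) = cinner f (mult_operator V g)" if "f \<in> M" for f g
    unfolding B_def control_operator_def by (rule cinner_orth_proj[OF that])
  \<comment> \<open>For vectors of \<open>M\<close> the projection drops out of the inner product,
    leaving the symmetry of multiplication by a real function.\<close>
  have B_sym: "cinner f (B g) = cinner (B f) g" if "f \<in> M" "g \<in> M" for f g
    using B_inner[OF that(1), of g] B_inner[OF that(2), of f] cinner_mult_operator[OF V C(2), of f g]
      cinner_commute[of "B f" g] cinner_commute[of "mult_operator V f" g] by simp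
  have B_norm: "norm (B f) \<le> C * norm f" for f
    unfolding B_def control_operator_def
    using order_trans[OF norm_orth_proj_le norm_mult_operator_le[OF V C(2)]] C(1) by simp
  define A where "A = {(f, f' + B f) | f f'. (f, f') \<in> H}"
  have saA: "selfadjoint_in M A"
    unfolding A_def using \<open>selfadjoint_in M H\<close> B_M B_add B_scale B_sym by (intro selfadjoint_in_add_bounded) auto
  obtain S where S: "sqrt_operator M H S" "Domain S \<subseteq> W12"
    and S_ge: "\<And>u v. (u, v) \<in> S \<Longrightarrow> (norm v)\<^sup>2 \<ge> \<eta> * dirichlet_energy u"
    using \<open>ge_laplacian M H \<eta>\<close> unfolding ge_laplacian_def by blast
  \<comment> \<open>Writing H f = S (S f) and moving one \<open>S\<close> across by self-adjointness
    gives <f, H f> = |S f|^2, the quantity that \<open>ge_laplacian\<close> bounds below.\<close>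
  have H_ge: "f \<in> M \<and> f \<in> W12 \<and> \<eta> * dirichlet_energy f \<le> f \<bullet> f'" if "(f, f') \<in> H" for f f'
  proof -
    have "(f, f') \<in> S O S" using that S(1) unfolding sqrt_operator_def by blast
    then obtain y where y: "(f, y) \<in> S" "(y, f') \<in> S" by blast
    have "(f, y) \<in> adjoint_in M S" using S(1) y(1) unfolding sqrt_operator_def selfadjoint_in_def by blast
    then have "f \<in> M" "cinner f f' = cinner y y" using y(2) unfolding adjoint_in_def by blast+
    then have "f \<bullet> f' = (norm y)\<^sup>2" by (simp add: inner_L2_def cinner_self)
    then show ?thesis using S_ge[OF y(1)] S(2) y(1) \<open>f \<in> M\<close> by auto
  qed
  have energy: "dirichlet_energy f \<ge> 0" for f :: "'a L2"
    unfolding dirichlet_energy_eq by (intro sum_nonneg) auto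
  \<comment> \<open>Chosen so that 2 I + 2 C R^2 d D \<le> \<kappa> (\<eta> D + I), with D the
    Dirichlet energy and I the form of V: the summand 2 absorbs the potential term, the other one
    the energy term, expressed through \<eta> D.\<close>
  define \<kappa> where "\<kappa> = 2 + 2 * C * (R\<^sup>2 * real DIM('a)) / \<eta>"
  define \<delta> where "\<delta> = \<rho> / \<kappa>"
  have \<kappa>: "\<kappa> > 0" unfolding \<kappa>_def using C \<open>\<eta> > 0\<close> by (intro add_pos_nonneg) auto
  have \<delta>: "\<delta> > 0" unfolding \<delta>_def using \<kappa> \<open>\<rho> > 0\<close> by simp
  have A_ge: "\<delta> * (norm f)\<^sup>2 \<le> f \<bullet> f'" if fA: "(f, f') \<in> A" for f f'
  proof -
    obtain f'' where f'': "(f, f'') \<in> H" "f' = f'' + B f" using fA unfolding A_def by blast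
    note f = H_ge[OF f''(1)]
    define I where "I = f \<bullet> mult_operator V f"
    have I: "I \<ge> 0" unfolding I_def by (rule inner_mult_operator_nonneg[OF V C(2) \<open>AE x in lebesgue. V x \<ge> 0\<close>])
    have "f \<bullet> f' = f \<bullet> f'' + I"
      using B_inner[of f f] f unfolding f'' I_def inner_L2_def by (simp add: cinner_add_right)
    then have "\<eta> * dirichlet_energy f + I \<le> f \<bullet> f'" using f by simp
    moreover have "\<rho> * (norm f)\<^sup>2 \<le> \<kappa> * (\<eta> * dirichlet_energy f + I)"
    proof -
      have "\<rho> * (norm f)\<^sup>2 \<le> 2 * I + 2 * C * (R\<^sup>2 * real DIM('a) * dirichlet_energy f)"
        unfolding I_def using f assms C V by (intro thick_inequality) auto
      \<comment> \<open>The two nonnegative cross terms of the product with \<kappa> are added so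
        that it factors.\<close>
      also have "\<dots> \<le> 2 * I + 2 * C * (R\<^sup>2 * real DIM('a) * dirichlet_energy f)
          + 2 * (\<eta> * dirichlet_energy f) + 2 * C * (R\<^sup>2 * real DIM('a)) / \<eta> * I"
        using C I energy[of f] \<open>\<eta> > 0\<close> by simp
      also have "\<dots> = \<kappa> * (\<eta> * dirichlet_energy f + I)"
        using \<open>\<eta> > 0\<close> by (simp add: \<kappa>_def field_simps)
      finally show ?thesis .
    qed
    ultimately have "\<rho> * (norm f)\<^sup>2 \<le> \<kappa> * (f \<bullet> f')"
      using \<kappa> by (meson mult_left_mono less_imp_le order_trans)
    then show ?thesis using \<kappa> by (simp add: \<delta>_def field_simps)
  qed
  have "maximal_monotone M H 0"
  proof (rule maximal_monotone_if_selfadjoint_in[OF \<open>selfadjoint_in M H\<close>])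
    show "0 * (norm f)\<^sup>2 \<le> f \<bullet> f'" if "(f, f') \<in> H" for f f'
      using H_ge[OF that] mult_nonneg_nonneg[OF less_imp_le[OF \<open>\<eta> > 0\<close>] energy[of f]] by simp
  qed simp
  moreover have "(c *\<^sub>C f, c *\<^sub>C f') \<in> H" if "(f, f') \<in> H" for c f f'
    using \<open>selfadjoint_in M H\<close> that unfolding selfadjoint_in_def linear_operator_in_def by blast
  ultimately have "semigroup_generated_by M {(f, - f') | f f'. (f, f') \<in> H} (maximal_monotone.E H)"
    by (rule semigroup_generated_by_maximal_monotone)
  \<comment> \<open>The Euler semigroup of H is a witness, so the semigroup selected by
    \<open>exp_semigroup\<close> is generated by -H as well.\<close>
  then have gen: "semigroup_generated_by M {(f, - f') | f f'. (f, f') \<in> H} (exp_semigroup M H)"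
    unfolding exp_semigroup_def by (rule someI[where P = "semigroup_generated_by M _"])
  define E where "E = exp_semigroup M H"
  interpret E: c0_semigroup M E
    unfolding E_def by (rule c0_semigroup_if_generated_by[OF gen])
  interpret A: maximal_monotone M A \<delta>
    by (rule maximal_monotone_if_selfadjoint_in[OF saA less_imp_le[OF \<delta>] A_ge])
  define F where "F = A.E"
  have dense: "M \<subseteq> closure (Domain H)" and HM: "H \<subseteq> M \<times> M"
    using \<open>selfadjoint_in M H\<close> unfolding selfadjoint_in_def linear_operator_in_def by auto
  have genE: "((\<lambda>t. (E t f - f) /\<^sub>R t) \<longlongrightarrow> - f') (at_right 0)" if "(f, f') \<in> H" for f f'
  proof -
    have "(f, - f') \<in> {(f, f') \<in> M \<times> M. ((\<lambda>t. (E t f - f) /\<^sub>R t) \<longlongrightarrow> f') (at_right 0)}"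
      using gen that unfolding semigroup_generated_by_def E_def by blast
    then show ?thesis by simp
  qed
  have A_mem: "(f, f' + B f) \<in> A" if "(f, f') \<in> H" for f f' using that unfolding A_def by blast
  \<comment> \<open>On \<open>Domain H\<close>, which is also the domain of \<open>A\<close>, the
    generators -H of \<open>E\<close> and -(H + B) of \<open>F\<close> differ exactly by the bounded
    operator \<open>B\<close>.\<close>
  have duh: "(LINT s|lebesgue_on {0<..<T}. E (T - s) (B (F s f))) = E T f - F T f" if "f \<in> M" "T \<ge> 0" for f T
  proof (rule duhamel[where D = "Domain H" and C\<^sub>B = C, OF E.c0_semigroup_axioms _ B_M _ less_imp_le[OF C(1)] _ dense _ _ that])
    show "c0_semigroup M F" unfolding F_def by (rule A.semigroup.c0_semigroup_axioms)
    show "norm (B x - B y) \<le> C * norm (x - y)" for x y using B_norm[of "x - y"] by (simp add: B_diff)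
    show "Domain H \<subseteq> M" using HM by blast
    show "\<exists>g\<in>M. ((\<lambda>t. (E t x - x) /\<^sub>R t) \<longlongrightarrow> g) (at_right 0) \<and> ((\<lambda>t. (F t x - x) /\<^sub>R t) \<longlongrightarrow> g - B x) (at_right 0)"
      if x: "x \<in> Domain H" for x
    proof -
      obtain x' where x': "(x, x') \<in> H" using x by blast
      have "((\<lambda>t. (F t x - x) /\<^sub>R t) \<longlongrightarrow> - (x' + B x)) (at_right 0)"
        unfolding F_def by (rule A.E_deriv_0[OF A_mem[OF x']])
      moreover have "- x' \<in> M" using x' HM M_subspace by (auto intro: subspace_neg)
      ultimately show ?thesis using genE[OF x'] by (intro bexI[of _ "- x'"]) auto
    qed
    \<comment> \<open>The difference quotients of F at \<open>F s x\<close> converge, so this vector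
      is in the domain of the generator of \<open>F\<close>, which \<open>generator_eq\<close>
      identifies with the domain of \<open>A\<close> and hence of H.\<close>
    show "F s x \<in> Domain H" if x: "x \<in> Domain H" and s: "s \<ge> 0" for x s
    proof -
      obtain x' where x': "(x, x') \<in> H" using x by blast
      define g where "g = - (x' + B x)"
      have xM: "x \<in> M" "g \<in> M"
        unfolding g_def using A.A_in[OF A_mem[OF x']] by (auto intro!: subspace_neg[OF M_subspace] simp del: minus_add_distrib)
      have "((\<lambda>h. (F h (F s x) - F s x) /\<^sub>R h) \<longlongrightarrow> F s g) (at_right 0)"
        unfolding F_def using A.E_deriv_0[OF A_mem[OF x']] xM s
        by (intro A.semigroup.generator_invariant) (auto simp: g_def)
      then have "(F s x, F s g) \<in> {(f, f') \<in> M \<times> M. ((\<lambda>t. (A.E t f - f) /\<^sub>R t) \<longlongrightarrow> f') (at_right 0)}"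
        using A.E_in s xM by (simp add: F_def)
      then have "(F s x, F s g) \<in> {(f, - f') | f f'. (f, f') \<in> A}" by (simp only: A.generator_eq)
      then show ?thesis unfolding A_def by blast
    qed
  qed
  \<comment> \<open>The time at which exp(-\<delta> t) has come down to \<alpha>; it is positive
    because ln \<alpha> < 0.\<close>
  define T\<^sub>0 where "T\<^sub>0 = - ln \<alpha> / \<delta>"
  have T\<^sub>0: "T\<^sub>0 > 0" using \<open>0 < \<alpha>\<close> \<open>\<alpha> < 1\<close> \<delta> by (simp add: T\<^sub>0_def divide_neg_pos)
  have "cost_uniformly_controllable M H V \<alpha> T r (max 1 (1 / \<delta>))" if T: "T \<ge> T\<^sub>0" and r: "r \<ge> 1" for T r
    unfolding cost_uniformly_controllable_def
  proof
    fix f assume f: "f \<in> M"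
    have T0: "T \<ge> 0" using T T\<^sub>0 by simp
    define u where "u s = - F s f" for s
    have cont: "continuous_on {0..T} u"
      unfolding u_def F_def
      by (intro continuous_on_minus continuous_on_subset[OF A.semigroup.continuous_on_orbit[OF f]]) auto
    have uM: "u t \<in> M" if "t \<in> {0<..<T}" for t
      using that A.E_in f M_subspace by (simp add: u_def F_def subspace_neg)
    have decay: "norm (u t) \<le> exp (- \<delta> * t) * norm f" if "t \<in> {0<..<T}" for t
      using that A.E_norm[of t f] f by (simp add: u_def F_def)
    note u = Lr_decaying[OF cont uM decay \<delta> norm_ge_zero T0 r]
    have "(LINT s|lebesgue_on {0<..<T}. exp_semigroup M H (T - s) (control_operator M V (u s)))
      = (LINT s|lebesgue_on {0<..<T}. - E (T - s) (B (F s f)))"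
    proof (rule Bochner_Integration.integral_cong[OF refl])
      fix s assume "s \<in> space (lebesgue_on {0<..<T})"
      then have "E (T - s) (- B (F s f)) = - E (T - s) (B (F s f))"
        using E.scaleR[of "T - s" "B (F s f)" "-1"] B_M by simp
      then show "exp_semigroup M H (T - s) (control_operator M V (u s)) = - E (T - s) (B (F s f))"
        by (simp only: u_def B_minus flip: E_def B_def)
    qed
    \<comment> \<open>The feedback sign reverses the Duhamel integral, so that adding the free
      evolution \<open>E T f\<close> leaves exactly \<open>F T f\<close>.\<close>
    also have "\<dots> = F T f - E T f" using duh[OF f T0] by simp
    finally have "solution M H V f u T = F T f" unfolding solution_def by (simp add: E_def)
    moreover have "norm (F T f) \<le> \<alpha> * norm f"
    proof -
      have "- ln \<alpha> \<le> \<delta> * T" using T \<delta> by (simp add: T\<^sub>0_def field_simps)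
      then have "exp (- \<delta> * T) \<le> exp (ln \<alpha>)" by simp
      then have "exp (- \<delta> * T) * norm f \<le> \<alpha> * norm f" using \<open>0 < \<alpha>\<close> by (intro mult_right_mono) auto
      then show ?thesis using A.E_norm[OF T0 f] by (simp add: F_def)
    qed
    ultimately show "\<exists>u\<in>Lr_space r T M. norm (solution M H V f u T) \<le> \<alpha> * norm f \<and> Lr_norm r T u \<le> max 1 (1 / \<delta>) * norm f"
      using u by (intro bexI[of _ u]) simp_all
  qed
  moreover have "max 1 (1 / \<delta>) > 0" by simp
  ultimately show ?thesis using T\<^sub>0 by blast
qed

end
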